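(* Let $\mathbf{R}$ be a discrete valuation ring with maximal ideal $\pi\mathbf{R}$ and residue field $\mathbf{k}$, let $k\ge 1$ be an integer, and put $\mathbf{R}_j=\mathbf{R}/\pi^j\mathbf{R}$ for $j \geq 1$. Let $\mathfrak{L}$ be a Lie algebra over $\mathbf{R}_k$ and let $\bar{\mathfrak{L}}=\mathfrak{L}\otimes_{\mathbf{R}}\mathbf{k}$ be its reduction to a Lie algebra over $\mathbf{k}$. Then there is a well-defined cohomology class $[J]\in H^3(\bar{\mathfrak{L}},ad)$, namely the class of the $3$-form $J_{[\cdot,\cdot]}\in\wedge^3(\bar{\mathfrak{L}},ad)$ attached to any bracket algebra lift $(B,[\cdot,\cdot])$ of $\mathfrak{L}$ to $\mathbf{R}_{k+1}$ (that is, $J_{[\cdot,\cdot]}$ is a cocycle and its class does not depend on the choice of the bracket algebra lift), and $[J]=0$ if and only if $\mathfrak{L}$ has an $\mathbf{R}_{k+1}$-Lie algebra lift $\hat{\mathfrak{L}}$.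
   Context: A Lie algebra over $\mathbf{R}_j$ ($j\ge1$) is a free $\mathbf{R}_j$-module of finite rank with an $\mathbf{R}_j$-bilinear bracket that is alternating ($[v,v]=0$ for all $v$) and satisfies the Jacobi identity $[[u,v],w]+[[v,w],u]+[[w,u],v]=0$. Cohomology. $\wedge^s(\bar{\mathfrak{L}},ad)$ is the $\mathbf{k}$-vector space of alternating $s$-multilinear $\bar{\mathfrak{L}}$-valued forms on $\bar{\mathfrak{L}}$, with differential $$(d\omega)(x_0,\dots,x_s)=\sum_{i=0}^s(-1)^i[x_i,\omega(x_0,\dots,\hat{x_i},\dots,x_s)]+\sum_{i<j}(-1)^{i+j}\omega([x_i,x_j],x_0,\dots,\hat{x_i},\dots,\hat{x_j},\dots,x_s),$$ and $H^*(\bar{\mathfrak{L}},ad)$ is the cohomology of this complex. Lifts. A bracket algebra lift of $\mathfrak{L}$ to $\mathbf{R}_{k+1}$ is a free $\mathbf{R}_{k+1}$-module $B$ of the same finite rank as $\mathfrak{L}$, with an alternating $\mathbf{R}_{k+1}$-bilinear map $[\cdot,\cdot]:B\times B\to B$ (the Jacobi identity is not required), together with a surjective $\mathbf{R}_{k+1}$-linear map $mod:B\to\mathfrak{L}$ that preserves brackets (so $mod$ carries any basis of $B$ to a basis of $\mathfrak{L}$ and has kernel $\pi^kB$). An $\mathbf{R}_{k+1}$-Lie algebra lift of $\mathfrak{L}$ is a bracket algebra lift whose bracket satisfies the Jacobi identity. The form $J$. Fix the uniformizer $\pi$. Given a bracket algebra lift $(B,[\cdot,\cdot])$, let $\lambda:B\to\bar{\mathfrak{L}}$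 be the composite of $mod$ with the reduction $\mathfrak{L}\to\bar{\mathfrak{L}}$, and let $\chi:\pi^kB\to\bar{\mathfrak{L}}$ be the isomorphism of abelian groups given by $\chi(\pi^kx)=\lambda(x)$. The map $\bar J_{[\cdot,\cdot]}(x,y,z)=[[x,y],z]+[[y,z],x]+[[z,x],y]$ on $B$ takes values in $\pi^kB$, and $J_{[\cdot,\cdot]}$ is the $\bar{\mathfrak{L}}$-valued alternating $3$-form on $\bar{\mathfrak{L}}$ that it induces: $$J_{[\cdot,\cdot]}(\lambda(x),\lambda(y),\lambda(z))=\chi\big(\bar J_{[\cdot,\cdot]}(x,y,z)\big)\qquad (x,y,z\in B).$$ *)

theory Defs
  imports "HOL-Algebra.Algebra"
begin

section \<open>Discrete valuation rings and their truncations\<close>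

definition discrete_valuation_ring :: "('r, 'm) ring_scheme \<Rightarrow> bool" where
  "discrete_valuation_ring R \<longleftrightarrow>
     principal_domain R \<and> \<not> field R \<and> (\<exists>!M. maximalideal M R)"

definition uniformizer :: "('r, 'm) ring_scheme \<Rightarrow> 'r \<Rightarrow> bool" where
  "uniformizer R \<pi> \<longleftrightarrow> \<pi> \<in> carrier R \<and> maximalideal (PIdl\<^bsub>R\<^esub> \<pi>) R"

definition trunc_ring :: "('r, 'm) ring_scheme \<Rightarrow> 'r \<Rightarrow> nat \<Rightarrow> 'r set ring" where
  "trunc_ring R \<pi> j = R Quot (PIdl\<^bsub>R\<^esub> (\<pi> [^]\<^bsub>R\<^esub> j))"

definition trunc :: "('r, 'm) ring_scheme \<Rightarrow> 'r \<Rightarrow> nat \<Rightarrow> 'r \<Rightarrow> 'r set" where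
  "trunc R \<pi> j r = PIdl\<^bsub>R\<^esub> (\<pi> [^]\<^bsub>R\<^esub> j) +>\<^bsub>R\<^esub> r"

definition residue_field :: "('r, 'm) ring_scheme \<Rightarrow> 'r \<Rightarrow> 'r set ring" where
  "residue_field R \<pi> = R Quot (PIdl\<^bsub>R\<^esub> \<pi>)"


section \<open>Bracket algebras and Lie algebras\<close>

definition free_of_rank :: "('a, 'm) ring_scheme \<Rightarrow> ('a, 'b, 'n) module_scheme \<Rightarrow> nat \<Rightarrow> bool" where
  "free_of_rank S M n \<longleftrightarrow>
     (\<exists>E. finite E \<and> card E = n \<and> E \<subseteq> carrier M \<and>
        (\<forall>v \<in> carrier M. \<exists>!c. c \<in> E \<rightarrow>\<^sub>E carrier S \<and> v = (\<Oplus>\<^bsub>M\<^esub> e \<in> E. c e \<odot>\<^bsub>M\<^esub> e)))"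

text \<open>The ring fields \<^const>\<open>monoid.mult\<close> and \<^const>\<open>one\<close> inherited from the module record
  play no role; the Lie bracket is a separate field.\<close>

record ('a, 'b) bracket_module = "('a, 'b) module" +
  bracket :: "'b \<Rightarrow> 'b \<Rightarrow> 'b"

locale bracket_algebra = module S M
  for S :: "('a, 'm) ring_scheme" and M :: "('a, 'b, 'n) bracket_module_scheme" +
  assumes finite_free: "\<exists>n. free_of_rank S M n"
    and bracket_closed:
      "\<lbrakk>x \<in> carrier M; y \<in> carrier M\<rbrakk> \<Longrightarrow> bracket M x y \<in> carrier M"
    and bracket_add_left:
      "\<lbrakk>x \<in> carrier M; y \<in> carrier M; z \<in> carrier M\<rbrakk> \<Longrightarrow>
       bracket M (x \<oplus>\<^bsub>M\<^esub> y) z = bracket M x z \<oplus>\<^bsub>M\<^esub> bracket M y z"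
    and bracket_add_right:
      "\<lbrakk>x \<in> carrier M; y \<in> carrier M; z \<in> carrier M\<rbrakk> \<Longrightarrow>
       bracket M x (y \<oplus>\<^bsub>M\<^esub> z) = bracket M x y \<oplus>\<^bsub>M\<^esub> bracket M x z"
    and bracket_smult_left:
      "\<lbrakk>a \<in> carrier S; x \<in> carrier M; y \<in> carrier M\<rbrakk> \<Longrightarrow>
       bracket M (a \<odot>\<^bsub>M\<^esub> x) y = a \<odot>\<^bsub>M\<^esub> bracket M x y"
    and bracket_smult_right:
      "\<lbrakk>a \<in> carrier S; x \<in> carrier M; y \<in> carrier M\<rbrakk> \<Longrightarrow>
       bracket M x (a \<odot>\<^bsub>M\<^esub> y) = a \<odot>\<^bsub>M\<^esub> bracket M x y"
    and bracket_alternating: "x \<in> carrier M \<Longrightarrow> bracket M x x = \<zero>\<^bsub>M\<^esub>"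

definition jacobiator :: "('a, 'b, 'n) bracket_module_scheme \<Rightarrow> 'b \<Rightarrow> 'b \<Rightarrow> 'b \<Rightarrow> 'b" where
  "jacobiator M x y z =
     bracket M (bracket M x y) z \<oplus>\<^bsub>M\<^esub> bracket M (bracket M y z) x
       \<oplus>\<^bsub>M\<^esub> bracket M (bracket M z x) y"

locale lie_algebra = bracket_algebra S M
  for S :: "('a, 'm) ring_scheme" and M :: "('a, 'b, 'n) bracket_module_scheme" +
  assumes jacobi:
    "\<lbrakk>x \<in> carrier M; y \<in> carrier M; z \<in> carrier M\<rbrakk> \<Longrightarrow> jacobiator M x y z = \<zero>\<^bsub>M\<^esub>"


section \<open>Reduction to the residue field\<close>

text \<open>The base change of an \<open>R/\<pi>\<^sup>kR\<close>-algebra \<open>L\<close> to the residue field is realised as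
  \<open>L/\<pi>L\<close>, with all operations induced from representatives (as in \<^const>\<open>FactRing\<close>, the
  unions below are unions of copies of one coset).  That \<open>L/\<pi>L\<close>, with
  \<open>x \<otimes> c = c \<cdot> (x + \<pi>L)\<close>, is the tensor product of \<open>L\<close> and the residue field over \<open>R\<close>
  is proved in \<open>reduction_tensor\<close> and \<open>reduction_tensor_universal\<close> at the end of the theory.\<close>

definition pi_multiples ::
    "('r, 'm) ring_scheme \<Rightarrow> 'r \<Rightarrow> nat \<Rightarrow> ('r set, 'l, 'n) module_scheme \<Rightarrow> 'l set" where
  "pi_multiples R \<pi> k L = (\<lambda>x. trunc R \<pi> k \<pi> \<odot>\<^bsub>L\<^esub> x) ` carrier L"

definition reduction ::
    "('r, 'm) ring_scheme \<Rightarrow> 'r \<Rightarrow> nat \<Rightarrow> ('r set, 'l, 'n) bracket_module_scheme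
      \<Rightarrow> ('r set, 'l set) bracket_module" where
  "reduction R \<pi> k L = (let I = pi_multiples R \<pi> k L in
     \<lparr>carrier = a_rcosets\<^bsub>L\<^esub> I,
      monoid.mult = undefined,
      one = undefined,
      ring.zero = I,
      ring.add = set_add L,
      smult = (\<lambda>c A. \<Union>r\<in>c. \<Union>x\<in>A. I +>\<^bsub>L\<^esub> (trunc R \<pi> k r \<odot>\<^bsub>L\<^esub> x)),
      bracket = (\<lambda>A C. \<Union>x\<in>A. \<Union>y\<in>C. I +>\<^bsub>L\<^esub> bracket L x y)\<rparr>)"

definition reduction_map ::
    "('r, 'm) ring_scheme \<Rightarrow> 'r \<Rightarrow> nat \<Rightarrow> ('r set, 'l, 'n) bracket_module_scheme \<Rightarrow> 'l \<Rightarrow> 'l set"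
  where "reduction_map R \<pi> k L x = pi_multiples R \<pi> k L +>\<^bsub>L\<^esub> x"


section \<open>Cohomology with coefficients in the adjoint representation\<close>

text \<open>An \<open>s\<close>-form is a function on lists of length \<open>s\<close>, extensional (\<^const>\<open>undefined\<close>)
  outside \<open>s\<close>-tuples of elements of the carrier.\<close>

definition tuples :: "('a, 'v, 'n) module_scheme \<Rightarrow> nat \<Rightarrow> 'v list set" where
  "tuples V s = {xs. length xs = s \<and> set xs \<subseteq> carrier V}"

definition alt_forms ::
    "('a, 'm) ring_scheme \<Rightarrow> ('a, 'v, 'n) module_scheme \<Rightarrow> nat \<Rightarrow> ('v list \<Rightarrow> 'v) set" where
  "alt_forms K V s = {\<omega>. \<omega> \<in> tuples V s \<rightarrow>\<^sub>E carrier V \<and>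
     (\<forall>xs \<in> tuples V s. \<forall>i < s. \<forall>u \<in> carrier V. \<forall>v \<in> carrier V.
        \<omega> (xs[i := u \<oplus>\<^bsub>V\<^esub> v]) = \<omega> (xs[i := u]) \<oplus>\<^bsub>V\<^esub> \<omega> (xs[i := v])) \<and>
     (\<forall>xs \<in> tuples V s. \<forall>i < s. \<forall>c \<in> carrier K. \<forall>u \<in> carrier V.
        \<omega> (xs[i := c \<odot>\<^bsub>V\<^esub> u]) = c \<odot>\<^bsub>V\<^esub> \<omega> (xs[i := u])) \<and>
     (\<forall>xs \<in> tuples V s. \<not> distinct xs \<longrightarrow> \<omega> xs = \<zero>\<^bsub>V\<^esub>)}"

definition form_space ::
    "('a, 'm) ring_scheme \<Rightarrow> ('a, 'v, 'n) module_scheme \<Rightarrow> nat \<Rightarrow> ('a, 'v list \<Rightarrow> 'v) module" where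
  "form_space K V s =
     \<lparr>carrier = alt_forms K V s,
      monoid.mult = undefined,
      one = undefined,
      ring.zero = (\<lambda>xs\<in>tuples V s. \<zero>\<^bsub>V\<^esub>),
      ring.add = (\<lambda>\<omega> \<eta>. \<lambda>xs\<in>tuples V s. \<omega> xs \<oplus>\<^bsub>V\<^esub> \<eta> xs),
      smult = (\<lambda>c \<omega>. \<lambda>xs\<in>tuples V s. c \<odot>\<^bsub>V\<^esub> \<omega> xs)\<rparr>"

text \<open>The list \<open>nths xs (- {i})\<close> is \<open>xs\<close> with the entry at position \<open>i\<close> omitted.\<close>

definition differential ::
    "('a, 'v, 'n) bracket_module_scheme \<Rightarrow> nat \<Rightarrow> ('v list \<Rightarrow> 'v) \<Rightarrow> 'v list \<Rightarrow> 'v" where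
  "differential V s \<omega> = (\<lambda>xs\<in>tuples V (Suc s).
     (\<Oplus>\<^bsub>V\<^esub> i \<in> {0..s}.
        add_pow V ((- 1 :: int) ^ i) (bracket V (xs ! i) (\<omega> (nths xs (- {i})))))
     \<oplus>\<^bsub>V\<^esub>
     (\<Oplus>\<^bsub>V\<^esub> j \<in> {0..s}. \<Oplus>\<^bsub>V\<^esub> i \<in> {0..<j}.
        add_pow V ((- 1 :: int) ^ (i + j)) (\<omega> (bracket V (xs ! i) (xs ! j) # nths xs (- {i, j})))))"

definition cocycles ::
    "('a, 'm) ring_scheme \<Rightarrow> ('a, 'v, 'n) bracket_module_scheme \<Rightarrow> nat \<Rightarrow> ('v list \<Rightarrow> 'v) set" where
  "cocycles K V s =
     {\<omega> \<in> alt_forms K V s. differential V s \<omega> = \<zero>\<^bsub>form_space K V (Suc s)\<^esub>}"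

definition coboundaries ::
    "('a, 'm) ring_scheme \<Rightarrow> ('a, 'v, 'n) bracket_module_scheme \<Rightarrow> nat \<Rightarrow> ('v list \<Rightarrow> 'v) set" where
  "coboundaries K V s = (case s of
       0 \<Rightarrow> {\<zero>\<^bsub>form_space K V 0\<^esub>}
     | Suc r \<Rightarrow> differential V r ` alt_forms K V r)"

definition cohomology_class ::
    "('a, 'm) ring_scheme \<Rightarrow> ('a, 'v, 'n) bracket_module_scheme \<Rightarrow> nat
      \<Rightarrow> ('v list \<Rightarrow> 'v) \<Rightarrow> ('v list \<Rightarrow> 'v) set" where
  "cohomology_class K V s \<omega> = coboundaries K V s +>\<^bsub>form_space K V s\<^esub> \<omega>"

definition cohomology ::
    "('a, 'm) ring_scheme \<Rightarrow> ('a, 'v, 'n) bracket_module_scheme \<Rightarrow> nat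
      \<Rightarrow> ('a, ('v list \<Rightarrow> 'v) set) module" where
  "cohomology K V s =
     \<lparr>carrier = cohomology_class K V s ` cocycles K V s,
      monoid.mult = undefined,
      one = undefined,
      ring.zero = coboundaries K V s,
      ring.add = set_add (form_space K V s),
      smult = (\<lambda>c A. \<Union>\<omega>\<in>A. cohomology_class K V s (c \<odot>\<^bsub>form_space K V s\<^esub> \<omega>))\<rparr>"


section \<open>Lifts\<close>

text \<open>\<open>R\<^sub>k\<^sub>+\<^sub>1\<close>-linearity of \<open>\<mu> : B \<rightarrow> L\<close> refers to the action of \<open>R\<^sub>k\<^sub>+\<^sub>1\<close> on \<open>L\<close> through
  \<open>R\<^sub>k\<^sub>+\<^sub>1 \<rightarrow> R\<^sub>k\<close>; it is expressed with representatives \<open>r\<close> in \<open>R\<close>.\<close>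

definition bracket_algebra_lift ::
    "('r, 'm) ring_scheme \<Rightarrow> 'r \<Rightarrow> nat \<Rightarrow> ('r set, 'l, 'n) bracket_module_scheme
      \<Rightarrow> ('r set, 'b) bracket_module \<Rightarrow> ('b \<Rightarrow> 'l) \<Rightarrow> bool" where
  "bracket_algebra_lift R \<pi> k L B \<mu> \<longleftrightarrow>
     bracket_algebra (trunc_ring R \<pi> (k + 1)) B \<and>
     (\<exists>n. free_of_rank (trunc_ring R \<pi> k) L n \<and> free_of_rank (trunc_ring R \<pi> (k + 1)) B n) \<and>
     \<mu> ` carrier B = carrier L \<and>
     (\<forall>x \<in> carrier B. \<forall>y \<in> carrier B. \<mu> (x \<oplus>\<^bsub>B\<^esub> y) = \<mu> x \<oplus>\<^bsub>L\<^esub> \<mu> y) \<and>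
     (\<forall>r \<in> carrier R. \<forall>x \<in> carrier B.
        \<mu> (trunc R \<pi> (k + 1) r \<odot>\<^bsub>B\<^esub> x) = trunc R \<pi> k r \<odot>\<^bsub>L\<^esub> \<mu> x) \<and>
     (\<forall>x \<in> carrier B. \<forall>y \<in> carrier B. \<mu> (bracket B x y) = bracket L (\<mu> x) (\<mu> y))"

definition lie_algebra_lift ::
    "('r, 'm) ring_scheme \<Rightarrow> 'r \<Rightarrow> nat \<Rightarrow> ('r set, 'l, 'n) bracket_module_scheme
      \<Rightarrow> ('r set, 'b) bracket_module \<Rightarrow> ('b \<Rightarrow> 'l) \<Rightarrow> bool" where
  "lie_algebra_lift R \<pi> k L B \<mu> \<longleftrightarrow>
     bracket_algebra_lift R \<pi> k L B \<mu> \<and> lie_algebra (trunc_ring R \<pi> (k + 1)) B"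

text \<open>Lifts may live on an arbitrary type \<open>'b\<close>, but existence of a lift must be asserted on
  a specific one.  The type \<open>nat \<Rightarrow> 'r set\<close> contains a copy of \<open>(R\<^sub>k\<^sub>+\<^sub>1)\<^sup>n\<close> for every \<open>n\<close>,
  hence an isomorphic copy of every lift.  Stating a property of a class both for lifts on this
  type and for lifts on an arbitrary \<open>'b\<close> makes the class independent of the choice of \<open>'b\<close>.\<close>

type_synonym 'r coord = "nat \<Rightarrow> 'r set"


section \<open>The form \<open>J\<close>\<close>

definition lift_lambda ::
    "('r, 'm) ring_scheme \<Rightarrow> 'r \<Rightarrow> nat \<Rightarrow> ('r set, 'l, 'n) bracket_module_scheme
      \<Rightarrow> ('b \<Rightarrow> 'l) \<Rightarrow> 'b \<Rightarrow> 'l set" where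
  "lift_lambda R \<pi> k L \<mu> x = reduction_map R \<pi> k L (\<mu> x)"

text \<open>Meaningful for arguments in \<open>\<pi>\<^sup>kB\<close>.\<close>

definition lift_chi ::
    "('r, 'm) ring_scheme \<Rightarrow> 'r \<Rightarrow> nat \<Rightarrow> ('r set, 'l, 'n) bracket_module_scheme
      \<Rightarrow> ('r set, 'b) bracket_module \<Rightarrow> ('b \<Rightarrow> 'l) \<Rightarrow> 'b \<Rightarrow> 'l set" where
  "lift_chi R \<pi> k L B \<mu> v =
     (THE w. \<exists>x \<in> carrier B. v = trunc R \<pi> (k + 1) (\<pi> [^]\<^bsub>R\<^esub> k) \<odot>\<^bsub>B\<^esub> x \<and>
        w = lift_lambda R \<pi> k L \<mu> x)"

definition J_form ::
    "('r, 'm) ring_scheme \<Rightarrow> 'r \<Rightarrow> nat \<Rightarrow> ('r set, 'l, 'n) bracket_module_scheme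
      \<Rightarrow> ('r set, 'b) bracket_module \<Rightarrow> ('b \<Rightarrow> 'l) \<Rightarrow> 'l set list \<Rightarrow> 'l set" where
  "J_form R \<pi> k L B \<mu> = (\<lambda>xs \<in> tuples (reduction R \<pi> k L) 3.
     (THE w. \<exists>x \<in> carrier B. \<exists>y \<in> carrier B. \<exists>z \<in> carrier B.
        xs = [lift_lambda R \<pi> k L \<mu> x, lift_lambda R \<pi> k L \<mu> y, lift_lambda R \<pi> k L \<mu> z] \<and>
        w = lift_chi R \<pi> k L B \<mu> (jacobiator B x y z)))"

abbreviation obstruction_cohomology ::
    "('r, 'm) ring_scheme \<Rightarrow> 'r \<Rightarrow> nat \<Rightarrow> ('r set, 'l, 'n) bracket_module_scheme
      \<Rightarrow> ('r set, ('l set list \<Rightarrow> 'l set) set) module" where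
  "obstruction_cohomology R \<pi> k L \<equiv> cohomology (residue_field R \<pi>) (reduction R \<pi> k L) 3"

abbreviation obstruction_cocycles ::
    "('r, 'm) ring_scheme \<Rightarrow> 'r \<Rightarrow> nat \<Rightarrow> ('r set, 'l, 'n) bracket_module_scheme
      \<Rightarrow> ('l set list \<Rightarrow> 'l set) set" where
  "obstruction_cocycles R \<pi> k L \<equiv> cocycles (residue_field R \<pi>) (reduction R \<pi> k L) 3"

abbreviation J_class ::
    "('r, 'm) ring_scheme \<Rightarrow> 'r \<Rightarrow> nat \<Rightarrow> ('r set, 'l, 'n) bracket_module_scheme
      \<Rightarrow> ('r set, 'b) bracket_module \<Rightarrow> ('b \<Rightarrow> 'l) \<Rightarrow> ('l set list \<Rightarrow> 'l set) set" where
  "J_class R \<pi> k L B \<mu> \<equiv>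
     cohomology_class (residue_field R \<pi>) (reduction R \<pi> k L) 3 (J_form R \<pi> k L B \<mu>)"


section \<open>The reduction is the tensor product with the residue field\<close>

context
  fixes R :: "('r, 'm) ring_scheme" and \<pi> :: 'r and k :: nat
    and L :: "('r set, 'l, 'n) bracket_module_scheme"
  assumes R: "cring R" and pi: "\<pi> \<in> carrier R" and L: "module (trunc_ring R \<pi> k) L"
begin

interpretation R: cring R by (rule R)
interpretation L: module "trunc_ring R \<pi> k" L by (rule L)

private abbreviation "I \<equiv> pi_multiples R \<pi> k L"
private abbreviation "Lb \<equiv> reduction R \<pi> k L"
private abbreviation "K \<equiv> residue_field R \<pi>"
private abbreviation "t \<equiv> trunc R \<pi> k"
private abbreviation "q \<equiv> reduction_map R \<pi> k L"
private abbreviation "rs r \<equiv> PIdl\<^bsub>R\<^esub> \<pi> +>\<^bsub>R\<^esub> r"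

private lemma id_t: "ideal (PIdl\<^bsub>R\<^esub> (\<pi> [^]\<^bsub>R\<^esub> k)) R"
  by (simp add: R.cgenideal_ideal pi)

private lemma id_p: "ideal (PIdl\<^bsub>R\<^esub> \<pi>) R"
  by (simp add: R.cgenideal_ideal pi)

private lemma t_hom: "t \<in> ring_hom R (trunc_ring R \<pi> k)"
  unfolding trunc_ring_def trunc_def[abs_def] by (rule ideal.rcos_ring_hom[OF id_t])

private lemma rs_hom: "rs \<in> ring_hom R K"
  unfolding residue_field_def by (rule ideal.rcos_ring_hom[OF id_p])

private lemma t_simps [simp]:
  "r \<in> carrier R \<Longrightarrow> t r \<in> carrier (trunc_ring R \<pi> k)"
  "r \<in> carrier R \<Longrightarrow> s \<in> carrier R \<Longrightarrow> t (r \<oplus>\<^bsub>R\<^esub> s) = t r \<oplus>\<^bsub>trunc_ring R \<pi> k\<^esub> t s"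
  "r \<in> carrier R \<Longrightarrow> s \<in> carrier R \<Longrightarrow> t (r \<otimes>\<^bsub>R\<^esub> s) = t r \<otimes>\<^bsub>trunc_ring R \<pi> k\<^esub> t s"
  "t \<one>\<^bsub>R\<^esub> = \<one>\<^bsub>trunc_ring R \<pi> k\<^esub>"
  using t_hom by (auto simp: ring_hom_def)

private lemma I_subgroup: "additive_subgroup I L"
proof (rule additive_subgroupI, rule group.subgroupI[OF L.a_group], simp_all)
  show "I \<subseteq> carrier L" by (auto simp: pi_multiples_def pi)
  show "I \<noteq> {}" by (auto simp: pi_multiples_def)
next
  fix a assume "a \<in> I"
  then obtain x where x: "x \<in> carrier L" "a = t \<pi> \<odot>\<^bsub>L\<^esub> x" by (auto simp: pi_multiples_def)
  then have "\<ominus>\<^bsub>L\<^esub> a = t \<pi> \<odot>\<^bsub>L\<^esub> (\<ominus>\<^bsub>L\<^esub> x)" by (simp add: L.smult_r_minus pi)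
  then show "inv\<^bsub>add_monoid L\<^esub> a \<in> I"
    using x by (auto simp: pi_multiples_def a_inv_def[symmetric])
next
  fix a b assume "a \<in> I" "b \<in> I"
  then obtain x y where "x \<in> carrier L" "a = t \<pi> \<odot>\<^bsub>L\<^esub> x" "y \<in> carrier L" "b = t \<pi> \<odot>\<^bsub>L\<^esub> y"
    by (auto simp: pi_multiples_def)
  then show "a \<oplus>\<^bsub>L\<^esub> b \<in> I"
    by (auto simp: pi_multiples_def L.smult_r_distr[symmetric] pi)
qed

interpretation I: abelian_subgroup I L
  by (rule abelian_subgroupI3[OF I_subgroup L.abelian_group_axioms])

private lemma I_smult: "r \<in> carrier R \<Longrightarrow> h \<in> I \<Longrightarrow> t r \<odot>\<^bsub>L\<^esub> h \<in> I"
proof -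
  assume r: "r \<in> carrier R" and "h \<in> I"
  then obtain x where x: "x \<in> carrier L" "h = t \<pi> \<odot>\<^bsub>L\<^esub> x" by (auto simp: pi_multiples_def)
  have "t r \<odot>\<^bsub>L\<^esub> h = t (\<pi> \<otimes>\<^bsub>R\<^esub> r) \<odot>\<^bsub>L\<^esub> x"
    using r x pi by (simp add: L.smult_assoc1[symmetric] L.R.m_comm)
  also have "\<dots> = t \<pi> \<odot>\<^bsub>L\<^esub> (t r \<odot>\<^bsub>L\<^esub> x)" using r x pi by (simp add: L.smult_assoc1)
  finally show ?thesis using r x by (auto simp: pi_multiples_def)
qed

private lemma I_smult_pi: "r \<in> PIdl\<^bsub>R\<^esub> \<pi> \<Longrightarrow> x \<in> carrier L \<Longrightarrow> t r \<odot>\<^bsub>L\<^esub> x \<in> I"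
proof -
  assume "r \<in> PIdl\<^bsub>R\<^esub> \<pi>" and x: "x \<in> carrier L"
  then obtain a where a: "a \<in> carrier R" "r = \<pi> \<otimes>\<^bsub>R\<^esub> a"
    using pi by (auto simp: cgenideal_def R.m_comm)
  then have "t r \<odot>\<^bsub>L\<^esub> x = t \<pi> \<odot>\<^bsub>L\<^esub> (t a \<odot>\<^bsub>L\<^esub> x)" using x pi by (simp add: L.smult_assoc1)
  then show ?thesis using a x by (auto simp: pi_multiples_def)
qed

private lemma q_eqI: "x \<in> carrier L \<Longrightarrow> h \<in> I \<Longrightarrow> q (h \<oplus>\<^bsub>L\<^esub> x) = q x"
  unfolding reduction_map_def
  by (metis I.a_Hcarr I.a_rcos_sum I.a_rcos_const I.a_subset L.a_coset_add_zero
      L.M.zero_closed L.M.l_zero)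

private lemma q_smult:
  assumes r: "r \<in> carrier R" and x: "x \<in> carrier L"
  shows "rs r \<odot>\<^bsub>Lb\<^esub> q x = q (t r \<odot>\<^bsub>L\<^esub> x)"
proof -
  have *: "q (t r' \<odot>\<^bsub>L\<^esub> x') = q (t r \<odot>\<^bsub>L\<^esub> x)" if "r' \<in> rs r" "x' \<in> q x" for r' x'
  proof -
    from that obtain a h where a: "a \<in> PIdl\<^bsub>R\<^esub> \<pi>" "r' = a \<oplus>\<^bsub>R\<^esub> r"
      and h: "h \<in> I" "x' = h \<oplus>\<^bsub>L\<^esub> x"
      by (auto simp: reduction_map_def a_r_coset_def r_coset_def)
    have aR: "a \<in> carrier R" using a ideal.Icarr[OF id_p] by blast
    have hL: "h \<in> carrier L" using h by (simp add: I.a_Hcarr)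
    have "t r' \<odot>\<^bsub>L\<^esub> x' = (t a \<odot>\<^bsub>L\<^esub> x' \<oplus>\<^bsub>L\<^esub> t r \<odot>\<^bsub>L\<^esub> h) \<oplus>\<^bsub>L\<^esub> t r \<odot>\<^bsub>L\<^esub> x"
      using aR hL r x a h
      by (simp add: L.smult_l_distr L.smult_r_distr L.M.a_ac)
    moreover have "t a \<odot>\<^bsub>L\<^esub> x' \<oplus>\<^bsub>L\<^esub> t r \<odot>\<^bsub>L\<^esub> h \<in> I"
      using a h hL x r by (intro I.a_closed I_smult I_smult_pi) auto
    ultimately show ?thesis using r x by (simp add: q_eqI)
  qed
  have "r \<in> rs r" using r id_p
    by (meson R.abelian_group_axioms abelian_subgroup.a_rcos_self abelian_subgroupI3
        ideal.axioms(1))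
  moreover have "x \<in> q x" using x by (simp add: reduction_map_def I.a_rcos_self)
  ultimately have "(\<Union>r'\<in>rs r. \<Union>x'\<in>q x. q (t r' \<odot>\<^bsub>L\<^esub> x')) = q (t r \<odot>\<^bsub>L\<^esub> x)"
    using * by blast
  then show ?thesis by (simp add: reduction_def Let_def reduction_map_def)
qed

private lemma Lb_carrier: "carrier Lb = q ` carrier L"
  by (auto simp: reduction_def Let_def reduction_map_def A_RCOSETS_defs a_r_coset_def r_coset_def)

private lemma K_carrier: "carrier K = rs ` carrier R"
  by (auto simp: residue_field_def FactRing_def A_RCOSETS_defs a_r_coset_def r_coset_def)

private lemma q_add:
  "x \<in> carrier L \<Longrightarrow> y \<in> carrier L \<Longrightarrow> q x \<oplus>\<^bsub>Lb\<^esub> q y = q (x \<oplus>\<^bsub>L\<^esub> y)"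
  by (simp add: reduction_def Let_def reduction_map_def I.a_rcos_sum)

private lemma rs_simps:
  "r \<in> carrier R \<Longrightarrow> s \<in> carrier R \<Longrightarrow> rs r \<oplus>\<^bsub>K\<^esub> rs s = rs (r \<oplus>\<^bsub>R\<^esub> s)"
  "r \<in> carrier R \<Longrightarrow> s \<in> carrier R \<Longrightarrow> rs r \<otimes>\<^bsub>K\<^esub> rs s = rs (r \<otimes>\<^bsub>R\<^esub> s)"
  "\<one>\<^bsub>K\<^esub> = rs \<one>\<^bsub>R\<^esub>"
  using rs_hom by (auto simp: ring_hom_def)

lemma reduction_tensor:
  shows "abelian_group Lb"
    and "\<lbrakk>x \<in> carrier L; c \<in> carrier K\<rbrakk> \<Longrightarrow> c \<odot>\<^bsub>Lb\<^esub> q x \<in> carrier Lb"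
    and "\<lbrakk>x \<in> carrier L; y \<in> carrier L; c \<in> carrier K\<rbrakk> \<Longrightarrow>
          c \<odot>\<^bsub>Lb\<^esub> q (x \<oplus>\<^bsub>L\<^esub> y) = c \<odot>\<^bsub>Lb\<^esub> q x \<oplus>\<^bsub>Lb\<^esub> c \<odot>\<^bsub>Lb\<^esub> q y"
    and "\<lbrakk>x \<in> carrier L; c \<in> carrier K; d \<in> carrier K\<rbrakk> \<Longrightarrow>
          (c \<oplus>\<^bsub>K\<^esub> d) \<odot>\<^bsub>Lb\<^esub> q x = c \<odot>\<^bsub>Lb\<^esub> q x \<oplus>\<^bsub>Lb\<^esub> d \<odot>\<^bsub>Lb\<^esub> q x"
    and "\<lbrakk>r \<in> carrier R; x \<in> carrier L; c \<in> carrier K\<rbrakk> \<Longrightarrow>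
          c \<odot>\<^bsub>Lb\<^esub> q (t r \<odot>\<^bsub>L\<^esub> x) = (rs r \<otimes>\<^bsub>K\<^esub> c) \<odot>\<^bsub>Lb\<^esub> q x"
proof -
  have z: "\<zero>\<^bsub>Lb\<^esub> = q \<zero>\<^bsub>L\<^esub>"
    by (simp add: reduction_def Let_def reduction_map_def I.a_subset)
  show "abelian_group Lb"
  proof (rule abelian_groupI)
    fix x assume "x \<in> carrier Lb"
    then obtain u where u: "u \<in> carrier L" "x = q u" by (auto simp: Lb_carrier)
    then have "q (\<ominus>\<^bsub>L\<^esub> u) \<oplus>\<^bsub>Lb\<^esub> x = \<zero>\<^bsub>Lb\<^esub>" by (simp add: q_add z L.M.l_neg)
    then show "\<exists>y \<in> carrier Lb. y \<oplus>\<^bsub>Lb\<^esub> x = \<zero>\<^bsub>Lb\<^esub>"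
      using u by (auto simp: Lb_carrier)
  qed (auto simp: Lb_carrier q_add z L.M.a_ac)
qed (auto simp: K_carrier Lb_carrier q_smult q_add rs_simps L.smult_r_distr L.smult_l_distr
       L.smult_assoc1[symmetric] L.R.m_comm)

lemma reduction_tensor_universal:
  fixes N :: "('c, 'p) ring_scheme" and f :: "'l \<Rightarrow> 'r set \<Rightarrow> 'c"
  assumes N: "abelian_group N"
    and f_closed: "\<And>x c. \<lbrakk>x \<in> carrier L; c \<in> carrier K\<rbrakk> \<Longrightarrow> f x c \<in> carrier N"
    and f_add1: "\<And>x y c. \<lbrakk>x \<in> carrier L; y \<in> carrier L; c \<in> carrier K\<rbrakk> \<Longrightarrow>
          f (x \<oplus>\<^bsub>L\<^esub> y) c = f x c \<oplus>\<^bsub>N\<^esub> f y c"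
    and f_add2: "\<And>x c d. \<lbrakk>x \<in> carrier L; c \<in> carrier K; d \<in> carrier K\<rbrakk> \<Longrightarrow>
          f x (c \<oplus>\<^bsub>K\<^esub> d) = f x c \<oplus>\<^bsub>N\<^esub> f x d"
    and f_balanced: "\<And>r x c. \<lbrakk>r \<in> carrier R; x \<in> carrier L; c \<in> carrier K\<rbrakk> \<Longrightarrow>
          f (t r \<odot>\<^bsub>L\<^esub> x) c = f x (rs r \<otimes>\<^bsub>K\<^esub> c)"
  shows "\<exists>!g. g \<in> extensional (carrier Lb) \<and> g \<in> hom (add_monoid Lb) (add_monoid N) \<and>
           (\<forall>x \<in> carrier L. \<forall>c \<in> carrier K. g (c \<odot>\<^bsub>Lb\<^esub> q x) = f x c)"
proof -
  interpret N: abelian_group N by (rule N)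
  interpret K: cring K
    unfolding residue_field_def by (rule ideal.quotient_is_cring[OF id_p R])
  have zK: "\<zero>\<^bsub>K\<^esub> = rs \<pi>"
    using ideal.axioms(1)[OF id_p] R.cgenideal_self[OF pi] pi
    by (simp add: residue_field_def FactRing_def)
       (metis R.abelian_group_axioms abelian_subgroup.a_rcos_const abelian_subgroupI3)
  have f0: "f x \<zero>\<^bsub>K\<^esub> = \<zero>\<^bsub>N\<^esub>" if "x \<in> carrier L" for x
    using f_add2[of x "\<zero>\<^bsub>K\<^esub>" "\<zero>\<^bsub>K\<^esub>"] f_closed[of x "\<zero>\<^bsub>K\<^esub>"] that
    by (metis K.zero_closed K.l_zero N.add.l_cancel_one')
  have fI: "f h \<one>\<^bsub>K\<^esub> = \<zero>\<^bsub>N\<^esub>" if "h \<in> I" for h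
    using that f_balanced[OF pi, of _ "\<one>\<^bsub>K\<^esub>"] f0
    by (auto simp: pi_multiples_def zK[symmetric])
  have f_cong: "f x \<one>\<^bsub>K\<^esub> = f y \<one>\<^bsub>K\<^esub>" if "x \<in> carrier L" "y \<in> q x" for x y
  proof -
    from that(2) obtain h where h: "h \<in> I" "y = h \<oplus>\<^bsub>L\<^esub> x"
      by (auto simp: reduction_map_def a_r_coset_def r_coset_def)
    then show ?thesis using that(1) by (simp add: f_add1 fI I.a_Hcarr f_closed)
  qed
  define g where "g = (\<lambda>A \<in> carrier Lb. f (SOME x. x \<in> A) \<one>\<^bsub>K\<^esub>)"
  have gq: "g (q x) = f x \<one>\<^bsub>K\<^esub>" if x: "x \<in> carrier L" for x
  proof -
    have "x \<in> q x" using x by (simp add: reduction_map_def I.a_rcos_self)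
    then have "(SOME y. y \<in> q x) \<in> q x" by (rule someI)
    then show ?thesis using x f_cong[OF x] by (simp add: g_def Lb_carrier)
  qed
  have g_hom: "g \<in> hom (add_monoid Lb) (add_monoid N)"
    by (rule homI) (auto simp: Lb_carrier gq f_closed q_add f_add1)
  have g_t: "g (c \<odot>\<^bsub>Lb\<^esub> q x) = f x c" if "x \<in> carrier L" "c \<in> carrier K" for x c
    using that by (auto simp: K_carrier q_smult gq f_balanced rs_simps)
  show ?thesis
  proof (rule ex1I[of _ g])
    show "g \<in> extensional (carrier Lb) \<and> g \<in> hom (add_monoid Lb) (add_monoid N) \<and>
           (\<forall>x \<in> carrier L. \<forall>c \<in> carrier K. g (c \<odot>\<^bsub>Lb\<^esub> q x) = f x c)"
      using g_hom g_t by (auto simp: g_def)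
  next
    fix g' assume g': "g' \<in> extensional (carrier Lb) \<and> g' \<in> hom (add_monoid Lb) (add_monoid N) \<and>
           (\<forall>x \<in> carrier L. \<forall>c \<in> carrier K. g' (c \<odot>\<^bsub>Lb\<^esub> q x) = f x c)"
    show "g' = g"
    proof (rule extensionalityI[of _ "carrier Lb"])
      fix A assume "A \<in> carrier Lb"
      then obtain x where x: "x \<in> carrier L" "A = q x" by (auto simp: Lb_carrier)
      have "\<one>\<^bsub>K\<^esub> \<odot>\<^bsub>Lb\<^esub> q x = q x" using x by (simp add: rs_simps q_smult)
      then show "g' A = g A" using g' x g_t by (metis K.one_closed)
    qed (use g' in \<open>auto simp: g_def\<close>)
  qed
qed

end

end

theory Submission
  imports Defs
begin

text \<open>All modules over the truncations \<open>R/\<pi>\<^sup>jR\<close> are viewed as \<open>R\<close>-modules.  Write \<open>V = L/\<pi>L\<close>.  For a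
  bracket algebra lift \<open>B\<close>, multiplication by \<open>\<pi>\<^sup>k\<close> induces an embedding \<open>\<iota>\<close> of \<open>V\<close> into \<open>B\<close> whose image
  \<open>\<pi>\<^sup>kB\<close> is the kernel of \<open>B \<rightarrow> L\<close> (a count of dimensions over the residue field), so identities between
  \<open>V\<close>-valued forms can be verified in \<open>B\<close> after applying \<open>\<iota>\<close>.  In \<open>B\<close>, the Jacobiator of any alternating
  bracket satisfies the cocycle identity.

  Since lifts are free, there is a linear map \<open>\<phi> : B \<rightarrow> B'\<close> over \<open>L\<close> between any two of them, and it
  preserves brackets up to \<open>\<iota>\<omega>\<close> for some \<open>2\<close>-form \<open>\<omega>\<close>; expanding the Jacobiators gives \<open>J' = J + d\<omega>\<close>.
  The same computation with \<open>\<phi> = id\<close> shows that adding \<open>\<iota>\<eta>\<close> to the bracket of \<open>B\<close> subtracts \<open>d\<eta>\<close> from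
  \<open>J\<close>, so that an exact \<open>J\<close> can be removed.\<close>

text \<open>\<open>B\<close>, \<open>L\<close> and \<open>V\<close> have three different rings of
  scalars, while the maps between them must be linear over one ring; this is why everything is
  brought down to \<open>R\<close>. Each truncation is a quotient of \<open>R\<close>, so forms,
  differentials and classes do not change. The obstacle is that the definition of a lift does not
  provide the kernel of \<open>\<mu>\<close>. It has to be extracted from the equality of ranks,
  which makes \<open>\<pi>B\<close> the kernel of \<open>B \<rightarrow> V\<close>; dividing by
  \<open>\<pi>\<close> as often as \<open>k\<close> times turns this into
  \<open>\<pi>\<^sup>kB\<close> as the kernel of \<open>\<mu>\<close>. The hypothesis
  \<open>k \<ge> 1\<close> enters chiefly as \<open>\<pi>\<^sup>kV = 0\<close>: the image of
  \<open>\<iota>\<close> vanishes in \<open>V\<close>, so a bracket changed by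
  \<open>\<iota>\<eta>\<close> still induces the bracket of \<open>V\<close>, and its Jacobiator
  changes by a differential without quadratic terms. The correction touches the bracket alone and
  keeps the module and \<open>\<mu>\<close>; a Lie algebra lift therefore appears on the type of the
  lift that is corrected, and a single lift built on coordinates settles existence.\<close>

section \<open>Linear maps and bases\<close>

text \<open>Nothing is required off \<open>carrier M\<close>, so that \<open>\<mu>\<close>,
  \<open>red\<close> and \<open>id\<close> qualify as they are; two maps are only compared on the
  carrier.\<close>

definition linear_map ::
    "('a, 'm) ring_scheme \<Rightarrow> ('a, 'b, 'n) module_scheme \<Rightarrow> ('a, 'c, 'p) module_scheme
      \<Rightarrow> ('b \<Rightarrow> 'c) \<Rightarrow> bool" where
  "linear_map S M N f \<longleftrightarrow> f \<in> carrier M \<rightarrow> carrier N \<and>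
     (\<forall>x \<in> carrier M. \<forall>y \<in> carrier M. f (x \<oplus>\<^bsub>M\<^esub> y) = f x \<oplus>\<^bsub>N\<^esub> f y) \<and>
     (\<forall>a \<in> carrier S. \<forall>x \<in> carrier M. f (a \<odot>\<^bsub>M\<^esub> x) = a \<odot>\<^bsub>N\<^esub> f x)"

lemma linear_mapI:
  assumes "\<And>x. x \<in> carrier M \<Longrightarrow> f x \<in> carrier N"
    and "\<And>x y. x \<in> carrier M \<Longrightarrow> y \<in> carrier M \<Longrightarrow> f (x \<oplus>\<^bsub>M\<^esub> y) = f x \<oplus>\<^bsub>N\<^esub> f y"
    and "\<And>a x. a \<in> carrier S \<Longrightarrow> x \<in> carrier M \<Longrightarrow> f (a \<odot>\<^bsub>M\<^esub> x) = a \<odot>\<^bsub>N\<^esub> f x"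
  shows "linear_map S M N f"
  using assms by (auto simp: linear_map_def)

lemma linear_mapD:
  assumes "linear_map S M N f"
  shows "x \<in> carrier M \<Longrightarrow> f x \<in> carrier N"
    and "x \<in> carrier M \<Longrightarrow> y \<in> carrier M \<Longrightarrow> f (x \<oplus>\<^bsub>M\<^esub> y) = f x \<oplus>\<^bsub>N\<^esub> f y"
    and "a \<in> carrier S \<Longrightarrow> x \<in> carrier M \<Longrightarrow> f (a \<odot>\<^bsub>M\<^esub> x) = a \<odot>\<^bsub>N\<^esub> f x"
  using assms by (auto simp: linear_map_def)

lemma linear_map_zero_minus:
  assumes M: "module S M" and N: "module S N" and f: "linear_map S M N f"
  shows "f \<zero>\<^bsub>M\<^esub> = \<zero>\<^bsub>N\<^esub>"
    and "x \<in> carrier M \<Longrightarrow> f (\<ominus>\<^bsub>M\<^esub> x) = \<ominus>\<^bsub>N\<^esub> f x"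
    and "x \<in> carrier M \<Longrightarrow> y \<in> carrier M \<Longrightarrow> f (x \<ominus>\<^bsub>M\<^esub> y) = f x \<ominus>\<^bsub>N\<^esub> f y"
proof -
  interpret M: module S M by (rule M)
  interpret N: module S N by (rule N)
  note D = linear_mapD[OF f]
  show 0: "f \<zero>\<^bsub>M\<^esub> = \<zero>\<^bsub>N\<^esub>"
    using D(2)[of "\<zero>\<^bsub>M\<^esub>" "\<zero>\<^bsub>M\<^esub>"] D(1)[of "\<zero>\<^bsub>M\<^esub>"]
    by (metis M.M.zero_closed M.M.l_zero N.M.add.l_cancel_one')
  show m: "f (\<ominus>\<^bsub>M\<^esub> x) = \<ominus>\<^bsub>N\<^esub> f x" if "x \<in> carrier M" for x
    using D(2)[of "\<ominus>\<^bsub>M\<^esub> x" x] D(1) that 0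
    by (metis M.M.a_inv_closed M.M.l_neg N.M.minus_equality)
  show "f (x \<ominus>\<^bsub>M\<^esub> y) = f x \<ominus>\<^bsub>N\<^esub> f y" if "x \<in> carrier M" "y \<in> carrier M" for x y
    using that by (simp add: a_minus_def D m)
qed

lemma linear_map_finsum:
  assumes M: "module S M" and N: "module S N" and f: "linear_map S M N f"
    and "finite A" "g \<in> A \<rightarrow> carrier M"
  shows "f (\<Oplus>\<^bsub>M\<^esub>i\<in>A. g i) = (\<Oplus>\<^bsub>N\<^esub>i\<in>A. f (g i))"
proof -
  interpret M: module S M by (rule M)
  interpret N: module S N by (rule N)
  show ?thesis
    using assms(4,5)
  proof (induct A)
    case (insert i A)
    then have "\<And>x. x \<in> insert i A \<Longrightarrow> f (g x) \<in> carrier N"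
      using linear_mapD(1)[OF f] by blast
    with insert show ?case
      by (simp add: linear_mapD(2)[OF f] Pi_def)
  qed (simp add: linear_map_zero_minus[OF M N f])
qed

lemma (in module) finsum_smult_rdistr:
  assumes "finite A" "f \<in> A \<rightarrow> carrier R" "x \<in> carrier M"
  shows "(\<Oplus>\<^bsub>R\<^esub>i\<in>A. f i) \<odot>\<^bsub>M\<^esub> x = (\<Oplus>\<^bsub>M\<^esub>i\<in>A. f i \<odot>\<^bsub>M\<^esub> x)"
  using assms(1,2)
proof (induct A)
  case (insert i A)
  with assms(3) show ?case by (simp add: Pi_def smult_l_distr)
qed (use assms(3) in simp)

section \<open>Bases and the coordinates they define\<close>

definition basis :: "('a, 'm) ring_scheme \<Rightarrow> ('a, 'b, 'n) module_scheme \<Rightarrow> 'b set \<Rightarrow> bool" where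
  "basis S M E \<longleftrightarrow> finite E \<and> E \<subseteq> carrier M \<and>
     (\<forall>v \<in> carrier M. \<exists>!c. c \<in> E \<rightarrow>\<^sub>E carrier S \<and> v = (\<Oplus>\<^bsub>M\<^esub> e \<in> E. c e \<odot>\<^bsub>M\<^esub> e))"

lemma free_of_rank_iff: "free_of_rank S M n \<longleftrightarrow> (\<exists>E. basis S M E \<and> card E = n)"
  by (auto simp: free_of_rank_def basis_def)

lemma basis_expansion:
  assumes "basis S M E" "v \<in> carrier M"
  obtains c where "c \<in> E \<rightarrow> carrier S" "v = (\<Oplus>\<^bsub>M\<^esub> e \<in> E. c e \<odot>\<^bsub>M\<^esub> e)"
  using assms unfolding basis_def by (fastforce simp: PiE_def)

text \<open>The uniqueness in \<open>basis\<close> concerns families that are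
  \<open>undefined\<close> off \<open>E\<close>; restricting \<open>c\<close> and \<open>d\<close>
  to \<open>E\<close> brings arbitrary families into that form without changing the sums.\<close>

lemma basis_unique:
  assumes M: "module S M" and "basis S M E"
    and c: "c \<in> E \<rightarrow> carrier S" and d: "d \<in> E \<rightarrow> carrier S"
    and eq: "(\<Oplus>\<^bsub>M\<^esub> e \<in> E. c e \<odot>\<^bsub>M\<^esub> e) = (\<Oplus>\<^bsub>M\<^esub> e \<in> E. d e \<odot>\<^bsub>M\<^esub> e)"
    and e: "e \<in> E"
  shows "c e = d e"
proof -
  interpret M: module S M by (rule M)
  from assms(2) have E: "finite E" "E \<subseteq> carrier M" by (auto simp: basis_def)
  let ?c = "restrict c E" and ?d = "restrict d E"
  have *: "(\<Oplus>\<^bsub>M\<^esub> e \<in> E. restrict c E e \<odot>\<^bsub>M\<^esub> e) = (\<Oplus>\<^bsub>M\<^esub> e \<in> E. c e \<odot>\<^bsub>M\<^esub> e)"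
    if "c \<in> E \<rightarrow> carrier S" for c
    by (rule M.M.finsum_cong') (use that E in auto)
  have "(\<Oplus>\<^bsub>M\<^esub> e \<in> E. c e \<odot>\<^bsub>M\<^esub> e) \<in> carrier M"
    by (rule M.M.finsum_closed) (use c E in auto)
  with assms(2) have ex1: "\<exists>!b. b \<in> E \<rightarrow>\<^sub>E carrier S \<and>
      (\<Oplus>\<^bsub>M\<^esub> e \<in> E. c e \<odot>\<^bsub>M\<^esub> e) = (\<Oplus>\<^bsub>M\<^esub> e \<in> E. b e \<odot>\<^bsub>M\<^esub> e)"
    unfolding basis_def by blast
  have "?c \<in> E \<rightarrow>\<^sub>E carrier S" "?d \<in> E \<rightarrow>\<^sub>E carrier S"
    using c d by auto
  moreover obtain b where b: "\<And>y. y \<in> E \<rightarrow>\<^sub>E carrier S \<and>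
      (\<Oplus>\<^bsub>M\<^esub> e \<in> E. c e \<odot>\<^bsub>M\<^esub> e) = (\<Oplus>\<^bsub>M\<^esub> e \<in> E. y e \<odot>\<^bsub>M\<^esub> e) \<Longrightarrow> y = b"
    using ex1 by (elim ex1E) blast
  ultimately have "?c = b" "?d = b"
    using *[OF c] *[OF d] eq by (simp_all del: restrict_apply)
  then have "?c = ?d" by simp
  with e show ?thesis by (metis restrict_apply')
qed

lemma (in module) finsum_delta:
  assumes E: "finite E" "E \<subseteq> carrier M" and i: "i \<in> E"
  shows "(\<Oplus>\<^bsub>M\<^esub> e \<in> E. (if e = i then \<one>\<^bsub>R\<^esub> else \<zero>\<^bsub>R\<^esub>) \<odot>\<^bsub>M\<^esub> e) = i"
proof -
  have "(\<Oplus>\<^bsub>M\<^esub> e \<in> E. (if e = i then \<one>\<^bsub>R\<^esub> else \<zero>\<^bsub>R\<^esub>) \<odot>\<^bsub>M\<^esub> e)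
      = (\<Oplus>\<^bsub>M\<^esub> e \<in> E. if i = e then e else \<zero>\<^bsub>M\<^esub>)"
    by (rule M.finsum_cong') (use E in auto)
  also have "\<dots> = i"
    by (rule M.add.finprod_singleton[of i E "\<lambda>x. x"]) (use E i in auto)
  finally show ?thesis .
qed

text \<open>Coordinates are additive and homogeneous in the vector, because sums and multiples of
  coordinate families represent the sums and multiples of the vectors and coordinates are unique.
  The extension combines the \<open>g e\<close> with these coordinates.\<close>

lemma basis_linear_extension:
  assumes M: "module S M" and N: "module S N" and E: "basis S M E"
    and g: "g \<in> E \<rightarrow> carrier N"
  obtains f where "linear_map S M N f" "\<And>e. e \<in> E \<Longrightarrow> f e = g e"
proof -
  interpret M: module S M by (rule M)
  interpret N: module S N by (rule N)
  from E have fin: "finite E" and sub: "E \<subseteq> carrier M" by (auto simp: basis_def)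
  note gc = Pi_mem[OF g] and ec = subsetD[OF sub]
  obtain k where k: "\<And>v. v \<in> carrier M \<Longrightarrow> k v \<in> E \<rightarrow> carrier S"
    "\<And>v. v \<in> carrier M \<Longrightarrow> v = (\<Oplus>\<^bsub>M\<^esub> e \<in> E. k v e \<odot>\<^bsub>M\<^esub> e)"
  proof -
    have "\<forall>v \<in> carrier M. \<exists>c. c \<in> E \<rightarrow> carrier S \<and> v = (\<Oplus>\<^bsub>M\<^esub> e \<in> E. c e \<odot>\<^bsub>M\<^esub> e)"
      using basis_expansion[OF E] by blast
    from bchoice[OF this] that show ?thesis by blast
  qed
  note kc = Pi_mem[OF k(1)]
  define f where "f v = (\<Oplus>\<^bsub>N\<^esub> e \<in> E. k v e \<odot>\<^bsub>N\<^esub> g e)" for v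
  have uniq: "k v e = c e" if "v \<in> carrier M" "c \<in> E \<rightarrow> carrier S"
    "v = (\<Oplus>\<^bsub>M\<^esub> e \<in> E. c e \<odot>\<^bsub>M\<^esub> e)" "e \<in> E" for v c e
    using basis_unique[OF M E k(1)[OF that(1)] that(2) _ that(4)] k(2)[OF that(1)] that(3) by simp
  have "linear_map S M N f"
  proof (rule linear_mapI)
    show "f x \<in> carrier N" if "x \<in> carrier M" for x
      unfolding f_def using that by (intro N.M.finsum_closed) (auto intro!: kc gc)
  next
    fix x y assume xy: "x \<in> carrier M" "y \<in> carrier M"
    have "k (x \<oplus>\<^bsub>M\<^esub> y) e = k x e \<oplus>\<^bsub>S\<^esub> k y e" if "e \<in> E" for e
    proof (rule uniq[OF _ _ _ that])
      have "x \<oplus>\<^bsub>M\<^esub> y = (\<Oplus>\<^bsub>M\<^esub> e \<in> E. k x e \<odot>\<^bsub>M\<^esub> e) \<oplus>\<^bsub>M\<^esub> (\<Oplus>\<^bsub>M\<^esub> e \<in> E. k y e \<odot>\<^bsub>M\<^esub> e)"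
        using k(2) xy by simp
      also have "\<dots> = (\<Oplus>\<^bsub>M\<^esub> e \<in> E. k x e \<odot>\<^bsub>M\<^esub> e \<oplus>\<^bsub>M\<^esub> k y e \<odot>\<^bsub>M\<^esub> e)"
        by (rule M.M.finsum_addf[symmetric]) (use xy in \<open>auto simp: ec intro!: kc\<close>)
      also have "\<dots> = (\<Oplus>\<^bsub>M\<^esub> e \<in> E. (k x e \<oplus>\<^bsub>S\<^esub> k y e) \<odot>\<^bsub>M\<^esub> e)"
        by (rule M.M.finsum_cong')
          (use xy in \<open>auto simp: ec intro!: kc M.smult_l_distr[symmetric]\<close>)
      finally show "x \<oplus>\<^bsub>M\<^esub> y = \<dots>" .
    qed (use xy in \<open>auto intro!: kc\<close>)
    then have "f (x \<oplus>\<^bsub>M\<^esub> y) = (\<Oplus>\<^bsub>N\<^esub> e \<in> E. k x e \<odot>\<^bsub>N\<^esub> g e \<oplus>\<^bsub>N\<^esub> k y e \<odot>\<^bsub>N\<^esub> g e)"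
      unfolding f_def
      by (intro N.M.finsum_cong') (use xy in \<open>auto intro!: kc gc N.smult_l_distr\<close>)
    also have "\<dots> = f x \<oplus>\<^bsub>N\<^esub> f y"
      unfolding f_def
      by (rule N.M.finsum_addf) (use xy in \<open>auto intro!: kc gc\<close>)
    finally show "f (x \<oplus>\<^bsub>M\<^esub> y) = f x \<oplus>\<^bsub>N\<^esub> f y" .
  next
    fix a x assume a: "a \<in> carrier S" and x: "x \<in> carrier M"
    have "k (a \<odot>\<^bsub>M\<^esub> x) e = a \<otimes>\<^bsub>S\<^esub> k x e" if "e \<in> E" for e
    proof (rule uniq[OF _ _ _ that])
      have "a \<odot>\<^bsub>M\<^esub> x = a \<odot>\<^bsub>M\<^esub> (\<Oplus>\<^bsub>M\<^esub> e \<in> E. k x e \<odot>\<^bsub>M\<^esub> e)"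
        using k(2) x by simp
      also have "\<dots> = (\<Oplus>\<^bsub>M\<^esub> e \<in> E. a \<odot>\<^bsub>M\<^esub> (k x e \<odot>\<^bsub>M\<^esub> e))"
        by (rule M.finsum_smult_ldistr) (use fin a x in \<open>auto simp: ec intro!: kc\<close>)
      also have "\<dots> = (\<Oplus>\<^bsub>M\<^esub> e \<in> E. (a \<otimes>\<^bsub>S\<^esub> k x e) \<odot>\<^bsub>M\<^esub> e)"
        by (rule M.M.finsum_cong')
          (use a x in \<open>auto simp: ec intro!: kc M.smult_assoc1[symmetric]\<close>)
      finally show "a \<odot>\<^bsub>M\<^esub> x = \<dots>" .
    qed (use a x in \<open>auto intro!: kc\<close>)
    then have "f (a \<odot>\<^bsub>M\<^esub> x) = (\<Oplus>\<^bsub>N\<^esub> e \<in> E. a \<odot>\<^bsub>N\<^esub> (k x e \<odot>\<^bsub>N\<^esub> g e))"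
      unfolding f_def
      by (intro N.M.finsum_cong') (use a x in \<open>auto intro!: kc gc N.smult_assoc1\<close>)
    also have "\<dots> = a \<odot>\<^bsub>N\<^esub> f x"
      unfolding f_def
      by (rule N.finsum_smult_ldistr[symmetric])
        (use fin a x in \<open>auto intro!: kc gc\<close>)
    finally show "f (a \<odot>\<^bsub>M\<^esub> x) = a \<odot>\<^bsub>N\<^esub> f x" .
  qed
  moreover have "f i = g i" if i: "i \<in> E" for i
  proof -
    have "k i e = (if e = i then \<one>\<^bsub>S\<^esub> else \<zero>\<^bsub>S\<^esub>)" if "e \<in> E" for e
      by (rule uniq[OF _ _ _ that]) (use M.finsum_delta[OF fin sub i] i ec in auto)
    then have "f i = (\<Oplus>\<^bsub>N\<^esub> e \<in> E. if i = e then g e else \<zero>\<^bsub>N\<^esub>)"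
      unfolding f_def by (intro N.M.finsum_cong') (auto simp: gc)
    also have "\<dots> = g i"
      by (rule N.M.add.finprod_singleton) (use i fin g in auto)
    finally show ?thesis .
  qed
  ultimately show ?thesis by (rule that)
qed

lemma linear_map_eq_on_basis:
  assumes M: "module S M" and N: "module S N" and E: "basis S M E"
    and f: "linear_map S M N f" and g: "linear_map S M N g"
    and eq: "\<And>e. e \<in> E \<Longrightarrow> f e = g e" and v: "v \<in> carrier M"
  shows "f v = g v"
proof -
  interpret M: module S M by (rule M)
  interpret N: module S N by (rule N)
  from E have fin: "finite E" and sub: "E \<subseteq> carrier M" by (auto simp: basis_def)
  obtain c where c: "c \<in> E \<rightarrow> carrier S" "v = (\<Oplus>\<^bsub>M\<^esub> e \<in> E. c e \<odot>\<^bsub>M\<^esub> e)"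
    using basis_expansion[OF E v] .
  have cl: "(\<lambda>e. c e \<odot>\<^bsub>M\<^esub> e) \<in> E \<rightarrow> carrier M" using c(1) sub by auto
  have "f v = (\<Oplus>\<^bsub>N\<^esub> e \<in> E. f (c e \<odot>\<^bsub>M\<^esub> e))"
    by (simp add: c(2) linear_map_finsum[OF M N f fin cl])
  also have "\<dots> = (\<Oplus>\<^bsub>N\<^esub> e \<in> E. g (c e \<odot>\<^bsub>M\<^esub> e))"
  proof (rule N.M.finsum_cong')
    show "f (c e \<odot>\<^bsub>M\<^esub> e) = g (c e \<odot>\<^bsub>M\<^esub> e)" if "e \<in> E" for e
      using that sub Pi_mem[OF c(1) that]
      by (auto simp: linear_mapD(3)[OF f] linear_mapD(3)[OF g] eq)
  qed (use cl linear_mapD(1)[OF g] in auto)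
  also have "\<dots> = g v"
    by (simp add: c(2) linear_map_finsum[OF M N g fin cl])
  finally show ?thesis .
qed

section \<open>Linear dependence over a field\<close>

text \<open>Gaussian elimination, one vector \<open>u i\<close> at a time.\<close>

lemma (in module) exists_dependence:
  assumes K: "field R" and "finite I" "finite J" "card I < card J"
    and "u \<in> I \<rightarrow> carrier M" and "\<And>j. j \<in> J \<Longrightarrow> a j \<in> I \<rightarrow> carrier R"
    and "\<And>j. j \<in> J \<Longrightarrow> v j = (\<Oplus>\<^bsub>M\<^esub> i \<in> I. a j i \<odot>\<^bsub>M\<^esub> u i)"
  shows "\<exists>x \<in> J \<rightarrow> carrier R. (\<exists>j \<in> J. x j \<noteq> \<zero>\<^bsub>R\<^esub>) \<and> (\<Oplus>\<^bsub>M\<^esub> j \<in> J. x j \<odot>\<^bsub>M\<^esub> v j) = \<zero>\<^bsub>M\<^esub>"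
  using assms(2-)
proof (induct I arbitrary: J v a)
  case empty
  interpret K: field R by (rule K)
  from empty have "J \<noteq> {}" by auto
  then obtain j where "j \<in> J" by auto
  \<comment> \<open>With no \<open>u i\<close> available every \<open>v j\<close> is an empty sum,
    so any coefficients do; 1 is nonzero in a field.\<close>
  moreover have "(\<Oplus>\<^bsub>M\<^esub> j \<in> J. \<one>\<^bsub>R\<^esub> \<odot>\<^bsub>M\<^esub> v j) = (\<Oplus>\<^bsub>M\<^esub> j \<in> J. \<zero>\<^bsub>M\<^esub>)"
    by (rule M.finsum_cong') (use empty in auto)
  ultimately show ?case
    by (intro bexI[of _ "\<lambda>_. \<one>\<^bsub>R\<^esub>"]) auto
next
  case (insert i0 I)
  interpret K: field R by (rule K)
  have u: "u i0 \<in> carrier M" "u \<in> I \<rightarrow> carrier M" using insert.prems(3) by auto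
  have ac: "a j i \<in> carrier R" if "j \<in> J" "i \<in> insert i0 I" for i j
    using insert.prems(4) that by blast
  have w: "(\<Oplus>\<^bsub>M\<^esub> i \<in> I. a j i \<odot>\<^bsub>M\<^esub> u i) \<in> carrier M" if "j \<in> J" for j
    by (rule M.finsum_closed) (use u ac that in auto)
  have v: "v j = a j i0 \<odot>\<^bsub>M\<^esub> u i0 \<oplus>\<^bsub>M\<^esub> (\<Oplus>\<^bsub>M\<^esub> i \<in> I. a j i \<odot>\<^bsub>M\<^esub> u i)" if "j \<in> J" for j
    unfolding insert.prems(5)[OF that]
    by (rule M.finsum_insert) (use insert(1,2) u ac that in auto)
  have vc: "v j \<in> carrier M" if "j \<in> J" for j using v[OF that] w[OF that] ac[OF that] u by auto
  show ?case
  proof (cases "\<exists>j \<in> J. a j i0 \<noteq> \<zero>\<^bsub>R\<^esub>")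
    \<comment> \<open>\<open>u i0\<close> contributes to no \<open>v j\<close>, so the induction
      hypothesis applies to the same vectors.\<close>
    case False
    then have "v j = (\<Oplus>\<^bsub>M\<^esub> i \<in> I. a j i \<odot>\<^bsub>M\<^esub> u i)" if "j \<in> J" for j
      using v[OF that] w[OF that] u that by auto
    moreover have "card I < card J" using insert by auto
    ultimately show ?thesis
      by (intro insert.hyps(3)[of J a]) (use insert.prems u ac in auto)
  next
    case True
    then obtain j0 where j0: "j0 \<in> J" "a j0 i0 \<noteq> \<zero>\<^bsub>R\<^esub>" by auto
    define b where "b = inv\<^bsub>R\<^esub> (a j0 i0)"
    have b: "b \<in> carrier R" "b \<otimes>\<^bsub>R\<^esub> a j0 i0 = \<one>\<^bsub>R\<^esub>"
      using j0 ac[OF j0(1)] K.field_Units by (auto simp: b_def)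
    \<comment> \<open>With pivot \<open>v j0\<close>, this is the multiple of the pivot whose
      subtraction removes \<open>u i0\<close> from \<open>v j\<close>.\<close>
    define t where "t j = a j i0 \<otimes>\<^bsub>R\<^esub> b" for j
    have t: "t j \<in> carrier R" if "j \<in> J" for j using b ac[OF that] by (simp add: t_def)
    define v' where "v' j = v j \<ominus>\<^bsub>M\<^esub> t j \<odot>\<^bsub>M\<^esub> v j0" for j
    have v'c: "v' j \<in> carrier M" if "j \<in> J" for j using vc t that j0 by (simp add: v'_def)
    let ?J = "J - {j0}"
    define a' where "a' j i = a j i \<ominus>\<^bsub>R\<^esub> t j \<otimes>\<^bsub>R\<^esub> a j0 i" for j i
    have a'c: "a' j i \<in> carrier R" if "j \<in> J" "i \<in> insert i0 I" for i j
      using that ac t j0 by (simp add: a'_def)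
    have v'_eq: "v' j = (\<Oplus>\<^bsub>M\<^esub> i \<in> I. a' j i \<odot>\<^bsub>M\<^esub> u i)" if j: "j \<in> J" for j
    proof -
      have sum: "(\<Oplus>\<^bsub>M\<^esub> i \<in> I. a j i \<odot>\<^bsub>M\<^esub> u i)
        = (\<Oplus>\<^bsub>M\<^esub> i \<in> I. a' j i \<odot>\<^bsub>M\<^esub> u i) \<oplus>\<^bsub>M\<^esub> t j \<odot>\<^bsub>M\<^esub> (\<Oplus>\<^bsub>M\<^esub> i \<in> I. a j0 i \<odot>\<^bsub>M\<^esub> u i)"
      proof -
        have "(\<Oplus>\<^bsub>M\<^esub> i \<in> I. a j i \<odot>\<^bsub>M\<^esub> u i)
          = (\<Oplus>\<^bsub>M\<^esub> i \<in> I. a' j i \<odot>\<^bsub>M\<^esub> u i \<oplus>\<^bsub>M\<^esub> t j \<odot>\<^bsub>M\<^esub> (a j0 i \<odot>\<^bsub>M\<^esub> u i))"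
        proof (rule M.finsum_cong')
          fix i assume i: "i \<in> I"
          have "a j i = a' j i \<oplus>\<^bsub>R\<^esub> t j \<otimes>\<^bsub>R\<^esub> a j0 i"
            using i ac[OF j] ac[OF j0(1)] t[OF j]
            by (simp add: a'_def R.minus_eq R.a_assoc R.l_neg)
          then show "a j i \<odot>\<^bsub>M\<^esub> u i = a' j i \<odot>\<^bsub>M\<^esub> u i \<oplus>\<^bsub>M\<^esub> t j \<odot>\<^bsub>M\<^esub> (a j0 i \<odot>\<^bsub>M\<^esub> u i)"
            using i u a'c[OF j] ac[OF j0(1)] t[OF j]
            by (simp add: smult_l_distr smult_assoc1 Pi_iff)
        qed (use u ac a'c t j j0 in \<open>auto simp: Pi_iff\<close>)
        also have "\<dots> = (\<Oplus>\<^bsub>M\<^esub> i \<in> I. a' j i \<odot>\<^bsub>M\<^esub> u i) \<oplus>\<^bsub>M\<^esub> (\<Oplus>\<^bsub>M\<^esub> i \<in> I. t j \<odot>\<^bsub>M\<^esub> (a j0 i \<odot>\<^bsub>M\<^esub> u i))"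
          by (rule M.finsum_addf) (use u ac a'c t j j0 in \<open>auto simp: Pi_iff\<close>)
        also have "(\<Oplus>\<^bsub>M\<^esub> i \<in> I. t j \<odot>\<^bsub>M\<^esub> (a j0 i \<odot>\<^bsub>M\<^esub> u i)) = t j \<odot>\<^bsub>M\<^esub> (\<Oplus>\<^bsub>M\<^esub> i \<in> I. a j0 i \<odot>\<^bsub>M\<^esub> u i)"
          by (rule finsum_smult_ldistr[symmetric])
            (use insert(1) u ac t j j0 in \<open>auto simp: Pi_iff\<close>)
        finally show ?thesis .
      qed
      have S': "(\<Oplus>\<^bsub>M\<^esub> i \<in> I. a' j i \<odot>\<^bsub>M\<^esub> u i) \<in> carrier M"
        by (rule M.finsum_closed) (use u a'c j in \<open>auto simp: Pi_iff\<close>)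
      have "t j \<otimes>\<^bsub>R\<^esub> a j0 i0 = a j i0"
        using b ac[OF j] ac[OF j0(1)] by (simp add: t_def R.m_assoc)
      then have tv: "t j \<odot>\<^bsub>M\<^esub> v j0
          = a j i0 \<odot>\<^bsub>M\<^esub> u i0 \<oplus>\<^bsub>M\<^esub> t j \<odot>\<^bsub>M\<^esub> (\<Oplus>\<^bsub>M\<^esub> i \<in> I. a j0 i \<odot>\<^bsub>M\<^esub> u i)"
        using u ac[OF j0(1)] t[OF j] w[OF j0(1)]
        by (simp add: v[OF j0(1)] smult_r_distr smult_assoc1[symmetric])
      have "v j = (\<Oplus>\<^bsub>M\<^esub> i \<in> I. a' j i \<odot>\<^bsub>M\<^esub> u i) \<oplus>\<^bsub>M\<^esub> t j \<odot>\<^bsub>M\<^esub> v j0"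
        using u ac[OF j] t[OF j] w[OF j0(1)] S' by (simp add: v[OF j] sum tv M.a_ac)
      then show ?thesis
        using S' t[OF j] vc[OF j0(1)] by (simp add: v'_def M.minus_eq M.a_assoc M.r_neg)
    qed
    have "\<exists>y \<in> ?J \<rightarrow> carrier R. (\<exists>j \<in> ?J. y j \<noteq> \<zero>\<^bsub>R\<^esub>) \<and> (\<Oplus>\<^bsub>M\<^esub> j \<in> ?J. y j \<odot>\<^bsub>M\<^esub> v' j) = \<zero>\<^bsub>M\<^esub>"
    proof (rule insert.hyps(3)[of ?J a'])
      show "card I < card ?J" using insert.prems(1,2) insert.hyps(1,2) j0 by simp
    qed (use insert.prems u a'c v'_eq in auto)
    then obtain y where y: "y \<in> ?J \<rightarrow> carrier R" "\<exists>j \<in> ?J. y j \<noteq> \<zero>\<^bsub>R\<^esub>"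
      "(\<Oplus>\<^bsub>M\<^esub> j \<in> ?J. y j \<odot>\<^bsub>M\<^esub> v' j) = \<zero>\<^bsub>M\<^esub>" by auto
    have yc: "y j \<in> carrier R" if "j \<in> ?J" for j using y(1) that by blast
    define s where "s = (\<Oplus>\<^bsub>R\<^esub> j \<in> ?J. y j \<otimes>\<^bsub>R\<^esub> t j)"
    have s: "s \<in> carrier R" unfolding s_def by (rule R.finsum_closed) (use yc t in auto)
    \<comment> \<open>In the relation found among the \<open>v' j\<close> the pivot
      \<open>v j0\<close> occurs with total coefficient \<open>- s\<close>, collected from all
      subtracted multiples.\<close>
    define x where "x j = (if j = j0 then \<ominus>\<^bsub>R\<^esub> s else y j)" for j
    have x: "x \<in> J \<rightarrow> carrier R" using s yc by (auto simp: x_def)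
    have fin: "finite ?J" using insert.prems by simp
    have "(\<Oplus>\<^bsub>M\<^esub> j \<in> ?J. x j \<odot>\<^bsub>M\<^esub> v j)
        = (\<Oplus>\<^bsub>M\<^esub> j \<in> ?J. y j \<odot>\<^bsub>M\<^esub> v' j \<oplus>\<^bsub>M\<^esub> (y j \<otimes>\<^bsub>R\<^esub> t j) \<odot>\<^bsub>M\<^esub> v j0)"
    proof (rule M.finsum_cong')
      fix j assume j: "j \<in> ?J"
      have "v j = v' j \<oplus>\<^bsub>M\<^esub> t j \<odot>\<^bsub>M\<^esub> v j0"
        using j t[of j] vc[of j] vc[OF j0(1)] by (simp add: v'_def M.minus_eq M.a_assoc M.l_neg)
      then show "x j \<odot>\<^bsub>M\<^esub> v j = y j \<odot>\<^bsub>M\<^esub> v' j \<oplus>\<^bsub>M\<^esub> (y j \<otimes>\<^bsub>R\<^esub> t j) \<odot>\<^bsub>M\<^esub> v j0"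
        using j yc[OF j] v'c[of j] t[of j] vc[OF j0(1)]
        by (simp add: x_def smult_r_distr smult_assoc1)
    qed (use yc t v'c vc j0 in auto)
    also have "\<dots> = (\<Oplus>\<^bsub>M\<^esub> j \<in> ?J. y j \<odot>\<^bsub>M\<^esub> v' j) \<oplus>\<^bsub>M\<^esub> (\<Oplus>\<^bsub>M\<^esub> j \<in> ?J. (y j \<otimes>\<^bsub>R\<^esub> t j) \<odot>\<^bsub>M\<^esub> v j0)"
      by (rule M.finsum_addf) (use yc t v'c vc j0 in auto)
    also have "(\<Oplus>\<^bsub>M\<^esub> j \<in> ?J. (y j \<otimes>\<^bsub>R\<^esub> t j) \<odot>\<^bsub>M\<^esub> v j0) = s \<odot>\<^bsub>M\<^esub> v j0"
      unfolding s_def by (rule finsum_smult_rdistr[symmetric]) (use fin yc t vc j0 in auto)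
    finally have rest: "(\<Oplus>\<^bsub>M\<^esub> j \<in> ?J. x j \<odot>\<^bsub>M\<^esub> v j) = s \<odot>\<^bsub>M\<^esub> v j0"
      using y(3) s vc[OF j0(1)] by simp
    have "(\<Oplus>\<^bsub>M\<^esub> j \<in> insert j0 ?J. x j \<odot>\<^bsub>M\<^esub> v j) = x j0 \<odot>\<^bsub>M\<^esub> v j0 \<oplus>\<^bsub>M\<^esub> (\<Oplus>\<^bsub>M\<^esub> j \<in> ?J. x j \<odot>\<^bsub>M\<^esub> v j)"
      by (rule M.finsum_insert) (use fin x vc j0 in auto)
    then have "(\<Oplus>\<^bsub>M\<^esub> j \<in> J. x j \<odot>\<^bsub>M\<^esub> v j) = \<zero>\<^bsub>M\<^esub>"
      using s vc[OF j0(1)] j0(1) by (simp add: rest insert_absorb) (simp add: x_def smult_l_minus M.l_neg)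
    moreover have "\<exists>j \<in> J. x j \<noteq> \<zero>\<^bsub>R\<^esub>" using y(2) by (auto simp: x_def)
    ultimately show ?thesis using x by (intro bexI[of _ x] conjI)
  qed
qed

section \<open>Alternating brackets\<close>

text \<open>This is \<open>bracket_algebra\<close> without freeness: a free module over a truncation
  is in general no longer free when seen over \<open>R\<close>, where the computations take
  place.\<close>

locale alternating_bracket = module R M
  for R :: "('a, 'm) ring_scheme" and M :: "('a, 'b, 'n) bracket_module_scheme" +
  assumes bracket_closed [simp]:
      "\<lbrakk>x \<in> carrier M; y \<in> carrier M\<rbrakk> \<Longrightarrow> bracket M x y \<in> carrier M"
    and bracket_add_left:
      "\<lbrakk>x \<in> carrier M; y \<in> carrier M; z \<in> carrier M\<rbrakk> \<Longrightarrow>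
       bracket M (x \<oplus>\<^bsub>M\<^esub> y) z = bracket M x z \<oplus>\<^bsub>M\<^esub> bracket M y z"
    and bracket_add_right:
      "\<lbrakk>x \<in> carrier M; y \<in> carrier M; z \<in> carrier M\<rbrakk> \<Longrightarrow>
       bracket M x (y \<oplus>\<^bsub>M\<^esub> z) = bracket M x y \<oplus>\<^bsub>M\<^esub> bracket M x z"
    and bracket_smult_left:
      "\<lbrakk>a \<in> carrier R; x \<in> carrier M; y \<in> carrier M\<rbrakk> \<Longrightarrow>
       bracket M (a \<odot>\<^bsub>M\<^esub> x) y = a \<odot>\<^bsub>M\<^esub> bracket M x y"
    and bracket_smult_right:
      "\<lbrakk>a \<in> carrier R; x \<in> carrier M; y \<in> carrier M\<rbrakk> \<Longrightarrow>
       bracket M x (a \<odot>\<^bsub>M\<^esub> y) = a \<odot>\<^bsub>M\<^esub> bracket M x y"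
    and bracket_alternating: "x \<in> carrier M \<Longrightarrow> bracket M x x = \<zero>\<^bsub>M\<^esub>"
begin

lemma bracket_zero [simp]:
  assumes "x \<in> carrier M"
  shows "bracket M \<zero>\<^bsub>M\<^esub> x = \<zero>\<^bsub>M\<^esub>" "bracket M x \<zero>\<^bsub>M\<^esub> = \<zero>\<^bsub>M\<^esub>"
  using bracket_smult_left[of "\<zero>\<^bsub>R\<^esub>" x x] bracket_smult_right[of "\<zero>\<^bsub>R\<^esub>" x x] assms by simp_all

lemma bracket_minus_left:
  assumes "x \<in> carrier M" "y \<in> carrier M"
  shows "bracket M (\<ominus>\<^bsub>M\<^esub> x) y = \<ominus>\<^bsub>M\<^esub> bracket M x y"
  using bracket_add_left[of "\<ominus>\<^bsub>M\<^esub> x" x y] assms by (simp add: M.l_neg M.minus_equality)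

lemma bracket_minus_right:
  assumes "x \<in> carrier M" "y \<in> carrier M"
  shows "bracket M x (\<ominus>\<^bsub>M\<^esub> y) = \<ominus>\<^bsub>M\<^esub> bracket M x y"
  using bracket_add_right[of x "\<ominus>\<^bsub>M\<^esub> y" y] assms by (simp add: M.l_neg M.minus_equality)

lemma bracket_swap:
  assumes "x \<in> carrier M" "y \<in> carrier M"
  shows "bracket M y x = \<ominus>\<^bsub>M\<^esub> bracket M x y"
proof -
  have "bracket M (x \<oplus>\<^bsub>M\<^esub> y) (x \<oplus>\<^bsub>M\<^esub> y) = bracket M y x \<oplus>\<^bsub>M\<^esub> bracket M x y"
    using assms by (simp add: bracket_add_left bracket_add_right bracket_alternating[OF assms(1)]
          bracket_alternating[OF assms(2)] M.a_comm)
  moreover have "bracket M (x \<oplus>\<^bsub>M\<^esub> y) (x \<oplus>\<^bsub>M\<^esub> y) = \<zero>\<^bsub>M\<^esub>"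
    using assms by (simp add: bracket_alternating)
  ultimately show ?thesis
    using assms by (metis M.minus_equality bracket_closed)
qed

section \<open>The Jacobiator of an alternating bracket\<close>

lemma jacobiator_closed [simp]:
  "\<lbrakk>x \<in> carrier M; y \<in> carrier M; z \<in> carrier M\<rbrakk> \<Longrightarrow> jacobiator M x y z \<in> carrier M"
  by (simp add: jacobiator_def)

lemma jacobiator_cyclic:
  "\<lbrakk>x \<in> carrier M; y \<in> carrier M; z \<in> carrier M\<rbrakk> \<Longrightarrow> jacobiator M x y z = jacobiator M y z x"
  by (simp add: jacobiator_def M.a_ac)

lemma jacobiator_add:
  "\<lbrakk>x \<in> carrier M; x' \<in> carrier M; y \<in> carrier M; z \<in> carrier M\<rbrakk> \<Longrightarrow>
     jacobiator M (x \<oplus>\<^bsub>M\<^esub> x') y z = jacobiator M x y z \<oplus>\<^bsub>M\<^esub> jacobiator M x' y z"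
  by (simp add: jacobiator_def bracket_add_left bracket_add_right M.a_ac)

lemma jacobiator_smult:
  "\<lbrakk>a \<in> carrier R; x \<in> carrier M; y \<in> carrier M; z \<in> carrier M\<rbrakk> \<Longrightarrow>
     jacobiator M (a \<odot>\<^bsub>M\<^esub> x) y z = a \<odot>\<^bsub>M\<^esub> jacobiator M x y z"
  by (simp add: jacobiator_def bracket_smult_left bracket_smult_right smult_r_distr)

lemma jacobiator_alternating:
  assumes "x \<in> carrier M" "y \<in> carrier M"
  shows "jacobiator M x x y = \<zero>\<^bsub>M\<^esub>"
  using assms bracket_swap[of x y]
  by (simp add: jacobiator_def bracket_alternating bracket_minus_left M.r_neg)

text \<open>Replacing \<open>[z, x]\<close> by \<open>- [x, z]\<close> keeps the arguments of every
  innermost bracket in the given order. In the cocycle identity equal terms then look equal.\<close>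

lemma jacobiator_decomp:
  assumes "x \<in> carrier M" "y \<in> carrier M" "z \<in> carrier M"
  shows "jacobiator M x y z = bracket M (bracket M x y) z \<oplus>\<^bsub>M\<^esub> bracket M (bracket M y z) x
     \<ominus>\<^bsub>M\<^esub> bracket M (bracket M x z) y"
  using assms bracket_swap[of x z]
  by (simp add: jacobiator_def bracket_minus_left M.minus_eq)

end

text \<open>The cancellation in the cocycle identity for the Jacobiator: the \<open>t\<close>s stand for terms
  \<open>[[[x, y], z], w]\<close> and the \<open>q\<close>s for terms \<open>[[x, y], [z, w]]\<close>.\<close>

lemma (in abelian_group) cancelling_sum:
  assumes c: "{t1, t2, t3, t4, t5, t6, t7, t8, t9, t10, t11, t12, q1, q2, q3} \<subseteq> carrier G"
  shows "(\<ominus> (t7 \<oplus> t12 \<ominus> t10) \<oplus> (t4 \<oplus> t11 \<ominus> t6) \<oplus> \<ominus> (t2 \<oplus> t9 \<ominus> t5) \<oplus> (t1 \<oplus> t8 \<ominus> t3))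
    \<oplus> (\<ominus> (t1 \<oplus> (\<ominus> q1) \<ominus> t2) \<oplus> (t3 \<oplus> (\<ominus> q2) \<ominus> t4) \<oplus> \<ominus> (t8 \<oplus> q3 \<ominus> t7)
      \<oplus> \<ominus> (t5 \<oplus> (\<ominus> q3) \<ominus> t6) \<oplus> (t9 \<oplus> q2 \<ominus> t10) \<oplus> \<ominus> (t11 \<oplus> q1 \<ominus> t12)) = \<zero>" (is "?l = _")
proof -
  let ?s = "t1 \<oplus> t2 \<oplus> t3 \<oplus> t4 \<oplus> t5 \<oplus> t6 \<oplus> t7 \<oplus> t8 \<oplus> t9 \<oplus> t10 \<oplus> t11 \<oplus> t12 \<oplus> q1 \<oplus> q2 \<oplus> q3"
  have "?l = ?s \<oplus> \<ominus> ?s"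
    using c by (simp add: a_minus_def minus_add a_ac)
  also have "\<dots> = \<zero>" by (rule r_neg) (use c in simp)
  finally show ?thesis .
qed

text \<open>The left side repeats the summands of \<open>differential_3\<close> in the same order,
  so that \<open>obstruction_cocycle\<close> can rewrite one into the other. Only bilinearity and
  antisymmetry enter: each of the twelve threefold brackets and of the three brackets of brackets
  occurs once with either sign.\<close>

lemma (in alternating_bracket) jacobiator_cocycle:
  assumes c [simp]: "a \<in> carrier M" "b \<in> carrier M" "c \<in> carrier M" "d \<in> carrier M"
  shows "(bracket M a (jacobiator M b c d) \<oplus>\<^bsub>M\<^esub> \<ominus>\<^bsub>M\<^esub> bracket M b (jacobiator M a c d)
     \<oplus>\<^bsub>M\<^esub> bracket M c (jacobiator M a b d) \<oplus>\<^bsub>M\<^esub> \<ominus>\<^bsub>M\<^esub> bracket M d (jacobiator M a b c))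
     \<oplus>\<^bsub>M\<^esub> (\<ominus>\<^bsub>M\<^esub> jacobiator M (bracket M a b) c d \<oplus>\<^bsub>M\<^esub> jacobiator M (bracket M a c) b d
       \<oplus>\<^bsub>M\<^esub> \<ominus>\<^bsub>M\<^esub> jacobiator M (bracket M b c) a d \<oplus>\<^bsub>M\<^esub> \<ominus>\<^bsub>M\<^esub> jacobiator M (bracket M a d) b c
       \<oplus>\<^bsub>M\<^esub> jacobiator M (bracket M b d) a c \<oplus>\<^bsub>M\<^esub> \<ominus>\<^bsub>M\<^esub> jacobiator M (bracket M c d) a b) = \<zero>\<^bsub>M\<^esub>"
proof -
  let ?T = "\<lambda>x y z w. bracket M (bracket M (bracket M x y) z) w"
  \<comment> \<open>The outer argument \<open>w\<close> is moved to the right, at the cost of a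
    sign, to give the same left-normed brackets as the second group of terms.\<close>
  have outer: "bracket M w (jacobiator M x y z) = \<ominus>\<^bsub>M\<^esub> (?T x y z w \<oplus>\<^bsub>M\<^esub> ?T y z x w \<ominus>\<^bsub>M\<^esub> ?T x z y w)"
    if "x \<in> carrier M" "y \<in> carrier M" "z \<in> carrier M" "w \<in> carrier M" for x y z w
    using that bracket_swap[of "jacobiator M x y z" w]
    by (simp add: jacobiator_decomp bracket_add_left bracket_minus_left M.minus_eq)
  have inner: "jacobiator M (bracket M x y) z w
      = ?T x y z w \<oplus>\<^bsub>M\<^esub> bracket M (bracket M z w) (bracket M x y) \<ominus>\<^bsub>M\<^esub> ?T x y w z"
    if "x \<in> carrier M" "y \<in> carrier M" "z \<in> carrier M" "w \<in> carrier M" for x y z w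
    using that by (simp add: jacobiator_decomp)
  \<comment> \<open>Each splitting of the four arguments into two pairs produces two brackets of
    brackets, one the negative of the other.\<close>
  have q: "bracket M (bracket M c d) (bracket M a b) = \<ominus>\<^bsub>M\<^esub> bracket M (bracket M a b) (bracket M c d)"
    "bracket M (bracket M b d) (bracket M a c) = \<ominus>\<^bsub>M\<^esub> bracket M (bracket M a c) (bracket M b d)"
    "bracket M (bracket M b c) (bracket M a d) = \<ominus>\<^bsub>M\<^esub> bracket M (bracket M a d) (bracket M b c)"
    by (simp_all add: bracket_swap[symmetric])
  show ?thesis
    using M.cancelling_sum[of "?T a b c d" "?T a b d c" "?T a c b d" "?T a c d b" "?T a d b c"
        "?T a d c b" "?T b c d a" "?T b c a d" "?T b d a c" "?T b d c a" "?T c d a b" "?T c d b a"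
        "bracket M (bracket M a b) (bracket M c d)" "bracket M (bracket M a c) (bracket M b d)"
        "bracket M (bracket M a d) (bracket M b c)"]
    by (simp add: outer inner q)
qed


section \<open>Forms of degree two and three\<close>

lemma tuples_2: "xs \<in> tuples V 2 \<longleftrightarrow> (\<exists>a \<in> carrier V. \<exists>b \<in> carrier V. xs = [a, b])"
  by (auto simp: tuples_def length_Suc_conv numeral_2_eq_2)

lemma tuples_3:
  "xs \<in> tuples V 3 \<longleftrightarrow> (\<exists>a \<in> carrier V. \<exists>b \<in> carrier V. \<exists>c \<in> carrier V. xs = [a, b, c])"
  by (auto simp: tuples_def length_Suc_conv numeral_3_eq_3)

lemma tuples_4:
  "xs \<in> tuples V (Suc 3) \<longleftrightarrow> (\<exists>a \<in> carrier V. \<exists>b \<in> carrier V. \<exists>c \<in> carrier V. \<exists>d \<in> carrier V.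
     xs = [a, b, c, d])"
  by (auto simp: tuples_def length_Suc_conv numeral_3_eq_3)

lemma alt_forms_2I:
  assumes "\<omega> \<in> extensional (tuples V 2)"
    and "\<And>a b. \<lbrakk>a \<in> carrier V; b \<in> carrier V\<rbrakk> \<Longrightarrow> \<omega> [a, b] \<in> carrier V"
    and "\<And>a a' b. \<lbrakk>a \<in> carrier V; a' \<in> carrier V; b \<in> carrier V\<rbrakk> \<Longrightarrow>
       \<omega> [a \<oplus>\<^bsub>V\<^esub> a', b] = \<omega> [a, b] \<oplus>\<^bsub>V\<^esub> \<omega> [a', b]"
    and "\<And>a b b'. \<lbrakk>a \<in> carrier V; b \<in> carrier V; b' \<in> carrier V\<rbrakk> \<Longrightarrow>
       \<omega> [a, b \<oplus>\<^bsub>V\<^esub> b'] = \<omega> [a, b] \<oplus>\<^bsub>V\<^esub> \<omega> [a, b']"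
    and "\<And>r a b. \<lbrakk>r \<in> carrier R; a \<in> carrier V; b \<in> carrier V\<rbrakk> \<Longrightarrow>
       \<omega> [r \<odot>\<^bsub>V\<^esub> a, b] = r \<odot>\<^bsub>V\<^esub> \<omega> [a, b]"
    and "\<And>r a b. \<lbrakk>r \<in> carrier R; a \<in> carrier V; b \<in> carrier V\<rbrakk> \<Longrightarrow>
       \<omega> [a, r \<odot>\<^bsub>V\<^esub> b] = r \<odot>\<^bsub>V\<^esub> \<omega> [a, b]"
    and "\<And>a. a \<in> carrier V \<Longrightarrow> \<omega> [a, a] = \<zero>\<^bsub>V\<^esub>"
  shows "\<omega> \<in> alt_forms R V 2"
  using assms
  by (auto simp: alt_forms_def tuples_2 PiE_def less_2_cases_iff)

lemma alt_forms_2D: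
  assumes "\<omega> \<in> alt_forms R V 2"
  shows "\<omega> \<in> extensional (tuples V 2)"
    and "\<lbrakk>a \<in> carrier V; b \<in> carrier V\<rbrakk> \<Longrightarrow> \<omega> [a, b] \<in> carrier V"
    and "\<lbrakk>a \<in> carrier V; a' \<in> carrier V; b \<in> carrier V\<rbrakk> \<Longrightarrow>
       \<omega> [a \<oplus>\<^bsub>V\<^esub> a', b] = \<omega> [a, b] \<oplus>\<^bsub>V\<^esub> \<omega> [a', b]"
    and "\<lbrakk>a \<in> carrier V; b \<in> carrier V; b' \<in> carrier V\<rbrakk> \<Longrightarrow>
       \<omega> [a, b \<oplus>\<^bsub>V\<^esub> b'] = \<omega> [a, b] \<oplus>\<^bsub>V\<^esub> \<omega> [a, b']"
    and "\<lbrakk>r \<in> carrier R; a \<in> carrier V; b \<in> carrier V\<rbrakk> \<Longrightarrow>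
       \<omega> [r \<odot>\<^bsub>V\<^esub> a, b] = r \<odot>\<^bsub>V\<^esub> \<omega> [a, b]"
    and "\<lbrakk>r \<in> carrier R; a \<in> carrier V; b \<in> carrier V\<rbrakk> \<Longrightarrow>
       \<omega> [a, r \<odot>\<^bsub>V\<^esub> b] = r \<odot>\<^bsub>V\<^esub> \<omega> [a, b]"
    and "a \<in> carrier V \<Longrightarrow> \<omega> [a, a] = \<zero>\<^bsub>V\<^esub>"
proof -
  have *: "\<omega> \<in> tuples V 2 \<rightarrow>\<^sub>E carrier V"
    "\<And>xs i u v. \<lbrakk>xs \<in> tuples V 2; i < 2; u \<in> carrier V; v \<in> carrier V\<rbrakk> \<Longrightarrow>
       \<omega> (xs[i := u \<oplus>\<^bsub>V\<^esub> v]) = \<omega> (xs[i := u]) \<oplus>\<^bsub>V\<^esub> \<omega> (xs[i := v])"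
    "\<And>xs i r u. \<lbrakk>xs \<in> tuples V 2; i < 2; r \<in> carrier R; u \<in> carrier V\<rbrakk> \<Longrightarrow>
       \<omega> (xs[i := r \<odot>\<^bsub>V\<^esub> u]) = r \<odot>\<^bsub>V\<^esub> \<omega> (xs[i := u])"
    "\<And>xs. \<lbrakk>xs \<in> tuples V 2; \<not> distinct xs\<rbrakk> \<Longrightarrow> \<omega> xs = \<zero>\<^bsub>V\<^esub>"
    using assms by (auto simp: alt_forms_def)
  have t: "[a, b] \<in> tuples V 2" if "a \<in> carrier V" "b \<in> carrier V" for a b
    using that by (auto simp: tuples_2)
  show "\<omega> \<in> extensional (tuples V 2)" using *(1) by (auto simp: PiE_def)
  show "\<omega> [a, b] \<in> carrier V" if "a \<in> carrier V" "b \<in> carrier V"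
    using *(1) t that by (blast dest: PiE_mem)
  show "\<omega> [a \<oplus>\<^bsub>V\<^esub> a', b] = \<omega> [a, b] \<oplus>\<^bsub>V\<^esub> \<omega> [a', b]"
    if "a \<in> carrier V" "a' \<in> carrier V" "b \<in> carrier V"
    using *(2)[OF t[of a b], of 0 a a'] that by simp
  show "\<omega> [a, b \<oplus>\<^bsub>V\<^esub> b'] = \<omega> [a, b] \<oplus>\<^bsub>V\<^esub> \<omega> [a, b']"
    if "a \<in> carrier V" "b \<in> carrier V" "b' \<in> carrier V"
    using *(2)[OF t[of a b], of 1 b b'] that by simp
  show "\<omega> [r \<odot>\<^bsub>V\<^esub> a, b] = r \<odot>\<^bsub>V\<^esub> \<omega> [a, b]"
    if "r \<in> carrier R" "a \<in> carrier V" "b \<in> carrier V"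
    using *(3)[OF t[of a b], of 0 r a] that by simp
  show "\<omega> [a, r \<odot>\<^bsub>V\<^esub> b] = r \<odot>\<^bsub>V\<^esub> \<omega> [a, b]"
    if "r \<in> carrier R" "a \<in> carrier V" "b \<in> carrier V"
    using *(3)[OF t[of a b], of 1 r b] that by simp
  show "\<omega> [a, a] = \<zero>\<^bsub>V\<^esub>" if "a \<in> carrier V"
    using *(4)[OF t[of a a]] that by simp
qed

text \<open>Cyclic symmetry moves any slot to the first place and any two slots to the first two, so
  linearity and alternation need checking only there. The Jacobiator is cyclic by its very shape.
  The closure conjuncts stand in for a module structure on \<open>V\<close>.\<close>

lemma alt_forms_3I:
  assumes ext: "\<omega> \<in> extensional (tuples V 3)"
    and closed: "\<And>a b c. \<lbrakk>a \<in> carrier V; b \<in> carrier V; c \<in> carrier V\<rbrakk> \<Longrightarrow> \<omega> [a, b, c] \<in> carrier V"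
    and cyclic: "\<And>a b c. \<lbrakk>a \<in> carrier V; b \<in> carrier V; c \<in> carrier V\<rbrakk> \<Longrightarrow> \<omega> [a, b, c] = \<omega> [b, c, a]"
    and add: "\<And>a a' b c. \<lbrakk>a \<in> carrier V; a' \<in> carrier V; b \<in> carrier V; c \<in> carrier V\<rbrakk> \<Longrightarrow>
       a \<oplus>\<^bsub>V\<^esub> a' \<in> carrier V \<and> \<omega> [a \<oplus>\<^bsub>V\<^esub> a', b, c] = \<omega> [a, b, c] \<oplus>\<^bsub>V\<^esub> \<omega> [a', b, c]"
    and smult: "\<And>r a b c. \<lbrakk>r \<in> carrier R; a \<in> carrier V; b \<in> carrier V; c \<in> carrier V\<rbrakk> \<Longrightarrow>
       r \<odot>\<^bsub>V\<^esub> a \<in> carrier V \<and> \<omega> [r \<odot>\<^bsub>V\<^esub> a, b, c] = r \<odot>\<^bsub>V\<^esub> \<omega> [a, b, c]"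
    and alternating: "\<And>a b. \<lbrakk>a \<in> carrier V; b \<in> carrier V\<rbrakk> \<Longrightarrow> \<omega> [a, a, b] = \<zero>\<^bsub>V\<^esub>"
  shows "\<omega> \<in> alt_forms R V 3"
proof -
  have add': "\<omega> [b, a \<oplus>\<^bsub>V\<^esub> a', c] = \<omega> [b, a, c] \<oplus>\<^bsub>V\<^esub> \<omega> [b, a', c]"
    "\<omega> [b, c, a \<oplus>\<^bsub>V\<^esub> a'] = \<omega> [b, c, a] \<oplus>\<^bsub>V\<^esub> \<omega> [b, c, a']"
    if "a \<in> carrier V" "a' \<in> carrier V" "b \<in> carrier V" "c \<in> carrier V" for a a' b c
    using that add[of a a' b c] add[of a a' c b] cyclic by metis+
  have smult': "\<omega> [b, r \<odot>\<^bsub>V\<^esub> a, c] = r \<odot>\<^bsub>V\<^esub> \<omega> [b, a, c]"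
    "\<omega> [b, c, r \<odot>\<^bsub>V\<^esub> a] = r \<odot>\<^bsub>V\<^esub> \<omega> [b, c, a]"
    if "r \<in> carrier R" "a \<in> carrier V" "b \<in> carrier V" "c \<in> carrier V" for r a b c
    using that smult[of r a b c] smult[of r a c b] cyclic by metis+
  have alt': "\<omega> [b, a, a] = \<zero>\<^bsub>V\<^esub>" "\<omega> [a, b, a] = \<zero>\<^bsub>V\<^esub>" if "a \<in> carrier V" "b \<in> carrier V" for a b
    using that alternating[of a b] cyclic by metis+
  have cases: "i = 0 \<or> i = 1 \<or> i = 2" if "i < (3::nat)" for i
    using that by linarith
  show ?thesis
    unfolding alt_forms_def
    using ext closed add smult add' smult' alternating alt'
    by (auto simp: tuples_3 PiE_def dest!: cases)
qed

lemma (in abelian_group) add_pow_minus_one [simp]: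
  "x \<in> carrier G \<Longrightarrow> add_pow G (- 1 :: int) x = \<ominus> x"
  "x \<in> carrier G \<Longrightarrow> add_pow G (1 :: int) x = x"
  by (simp_all add: add_pow_int_lt add_pow_int_ge)

lemma (in alternating_bracket) differential_2:
  assumes "\<And>a b. \<lbrakk>a \<in> carrier M; b \<in> carrier M\<rbrakk> \<Longrightarrow> \<omega> [a, b] \<in> carrier M"
    and "a \<in> carrier M" "b \<in> carrier M" "c \<in> carrier M"
  shows "differential M 2 \<omega> [a, b, c] =
    (bracket M a (\<omega> [b, c]) \<oplus>\<^bsub>M\<^esub> \<ominus>\<^bsub>M\<^esub> bracket M b (\<omega> [a, c]) \<oplus>\<^bsub>M\<^esub> bracket M c (\<omega> [a, b]))
    \<oplus>\<^bsub>M\<^esub> (\<ominus>\<^bsub>M\<^esub> \<omega> [bracket M a b, c] \<oplus>\<^bsub>M\<^esub> \<omega> [bracket M a c, b] \<oplus>\<^bsub>M\<^esub> \<ominus>\<^bsub>M\<^esub> \<omega> [bracket M b c, a])"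
proof -
  have "[a, b, c] \<in> tuples M (Suc 2)" using assms by (simp add: tuples_def)
  moreover have "{0..2::nat} = {0, 1, 2}" "{0..<2::nat} = {0, 1}" by auto
  ultimately show ?thesis
    using assms
    by (simp add: differential_def nths_Cons Pi_iff M.a_ac)
qed

lemma (in alternating_bracket) differential_3:
  assumes "\<And>a b c. \<lbrakk>a \<in> carrier M; b \<in> carrier M; c \<in> carrier M\<rbrakk> \<Longrightarrow> \<omega> [a, b, c] \<in> carrier M"
    and "a \<in> carrier M" "b \<in> carrier M" "c \<in> carrier M" "d \<in> carrier M"
  shows "differential M 3 \<omega> [a, b, c, d] =
    (bracket M a (\<omega> [b, c, d]) \<oplus>\<^bsub>M\<^esub> \<ominus>\<^bsub>M\<^esub> bracket M b (\<omega> [a, c, d])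
     \<oplus>\<^bsub>M\<^esub> bracket M c (\<omega> [a, b, d]) \<oplus>\<^bsub>M\<^esub> \<ominus>\<^bsub>M\<^esub> bracket M d (\<omega> [a, b, c]))
    \<oplus>\<^bsub>M\<^esub> (\<ominus>\<^bsub>M\<^esub> \<omega> [bracket M a b, c, d] \<oplus>\<^bsub>M\<^esub> \<omega> [bracket M a c, b, d]
     \<oplus>\<^bsub>M\<^esub> \<ominus>\<^bsub>M\<^esub> \<omega> [bracket M b c, a, d] \<oplus>\<^bsub>M\<^esub> \<ominus>\<^bsub>M\<^esub> \<omega> [bracket M a d, b, c]
     \<oplus>\<^bsub>M\<^esub> \<omega> [bracket M b d, a, c] \<oplus>\<^bsub>M\<^esub> \<ominus>\<^bsub>M\<^esub> \<omega> [bracket M c d, a, b])"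
proof -
  have "[a, b, c, d] \<in> tuples M (Suc 3)" using assms by (simp add: tuples_def)
  moreover have "{0..3::nat} = {0, 1, 2, 3}" "{0..<3::nat} = {0, 1, 2}" "{0..<2::nat} = {0, 1}" by auto
  ultimately show ?thesis
    using assms
    by (simp add: differential_def nths_Cons Pi_iff M.a_ac)
qed

section \<open>The obstruction form of a lift\<close>

text \<open>In the application \<open>B\<close> is a bracket algebra over \<open>R/\<pi>\<^sup>k\<^sup>+\<^sup>1R\<close> and \<open>V\<close> its reduction to the residue field, both
  seen as \<open>R\<close>-modules; \<open>p = \<pi>\<close> and \<open>q = \<pi>\<^sup>k\<close>.\<close>

locale pre_lift = B: alternating_bracket R B + V: alternating_bracket R V
  for R :: "('a, 'm) ring_scheme" and B :: "('a, 'b, 'n) bracket_module_scheme"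
    and V :: "('a, 'v, 'p) bracket_module_scheme" +
  fixes red :: "'b \<Rightarrow> 'v" and p q :: 'a
  assumes p: "p \<in> carrier R" and q: "q \<in> carrier R"
    and linear: "linear_map R B V red"
    and surj: "red ` carrier B = carrier V"
    and hom_bracket: "\<lbrakk>x \<in> carrier B; y \<in> carrier B\<rbrakk> \<Longrightarrow> red (bracket B x y) = bracket V (red x) (red y)"
    and smult_q_eq_0_iff: "x \<in> carrier B \<Longrightarrow> q \<odot>\<^bsub>B\<^esub> x = \<zero>\<^bsub>B\<^esub> \<longleftrightarrow> red x = \<zero>\<^bsub>V\<^esub>"
    and kernel: "\<lbrakk>x \<in> carrier B; red x = \<zero>\<^bsub>V\<^esub>\<rbrakk> \<Longrightarrow> \<exists>b \<in> carrier B. x = p \<odot>\<^bsub>B\<^esub> b"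
    and p_null: "v \<in> carrier V \<Longrightarrow> p \<odot>\<^bsub>V\<^esub> v = \<zero>\<^bsub>V\<^esub>"
    and q_null: "v \<in> carrier V \<Longrightarrow> q \<odot>\<^bsub>V\<^esub> v = \<zero>\<^bsub>V\<^esub>"
begin

lemmas red_closed [simp] = linear_mapD(1)[OF linear]
lemmas red_add = linear_mapD(2)[OF linear]
lemmas red_smult = linear_mapD(3)[OF linear]
lemmas red_zero_minus = linear_map_zero_minus[OF B.module_axioms V.module_axioms linear]

text \<open>The inverse of the isomorphism \<open>\<chi>\<close>.\<close>

definition \<iota> :: "'v \<Rightarrow> 'b" where
  "\<iota> v = q \<odot>\<^bsub>B\<^esub> (SOME x. x \<in> carrier B \<and> red x = v)"

text \<open>From right to left this makes \<open>\<iota>\<close> well defined, from left to right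
  injective.\<close>

lemma smult_q_eq_iff:
  assumes "x \<in> carrier B" "y \<in> carrier B"
  shows "q \<odot>\<^bsub>B\<^esub> x = q \<odot>\<^bsub>B\<^esub> y \<longleftrightarrow> red x = red y"
proof -
  have "q \<odot>\<^bsub>B\<^esub> x = q \<odot>\<^bsub>B\<^esub> y \<longleftrightarrow> q \<odot>\<^bsub>B\<^esub> (x \<ominus>\<^bsub>B\<^esub> y) = \<zero>\<^bsub>B\<^esub>"
    using assms q by (simp add: a_minus_def B.smult_r_distr B.smult_r_minus)
      (metis B.M.a_inv_closed B.M.add.inv_solve_right' B.M.l_zero B.M.minus_minus B.M.zero_closed B.smult_closed)
  also have "\<dots> \<longleftrightarrow> red x = red y"
    using assms by (simp add: smult_q_eq_0_iff red_zero_minus V.M.minus_eq)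
      (metis V.M.add.inv_solve_right' V.M.l_zero V.M.zero_closed red_closed V.M.minus_minus V.M.a_inv_closed)
  finally show ?thesis .
qed

lemma obtain_lift:
  assumes "v \<in> carrier V"
  obtains x where "x \<in> carrier B" "v = red x"
  using assms surj by blast

lemma iota_red [simp]:
  assumes x: "x \<in> carrier B"
  shows "\<iota> (red x) = q \<odot>\<^bsub>B\<^esub> x"
proof -
  have "(SOME y. y \<in> carrier B \<and> red y = red x) \<in> carrier B \<and> red (SOME y. y \<in> carrier B \<and> red y = red x) = red x"
    by (rule someI[of _ x]) (use x in simp)
  then show ?thesis using x by (simp add: \<iota>_def smult_q_eq_iff)
qed

lemma iota_closed [simp]: "v \<in> carrier V \<Longrightarrow> \<iota> v \<in> carrier B"
  using q by (auto elim!: obtain_lift)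

lemma iota_add:
  assumes "u \<in> carrier V" "v \<in> carrier V"
  shows "\<iota> (u \<oplus>\<^bsub>V\<^esub> v) = \<iota> u \<oplus>\<^bsub>B\<^esub> \<iota> v"
proof -
  obtain x y where "x \<in> carrier B" "u = red x" "y \<in> carrier B" "v = red y"
    using assms by (metis obtain_lift)
  then show ?thesis using q by (simp add: red_add[symmetric] B.smult_r_distr)
qed

lemma iota_minus:
  assumes "v \<in> carrier V"
  shows "\<iota> (\<ominus>\<^bsub>V\<^esub> v) = \<ominus>\<^bsub>B\<^esub> \<iota> v"
  using assms q by (auto elim!: obtain_lift simp: red_zero_minus[symmetric] B.smult_r_minus)

lemma iota_zero [simp]: "\<iota> \<zero>\<^bsub>V\<^esub> = \<zero>\<^bsub>B\<^esub>"
  using q by (simp add: red_zero_minus(1)[symmetric])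

lemma iota_smult:
  assumes "a \<in> carrier R" "v \<in> carrier V"
  shows "\<iota> (a \<odot>\<^bsub>V\<^esub> v) = a \<odot>\<^bsub>B\<^esub> \<iota> v"
proof -
  obtain x where x: "x \<in> carrier B" "v = red x" using assms(2) by (rule obtain_lift)
  then show ?thesis
    using assms(1) q by (simp add: red_smult[symmetric] B.smult_assoc1[symmetric] B.R.m_comm)
qed

lemma iota_inject: "\<lbrakk>u \<in> carrier V; v \<in> carrier V\<rbrakk> \<Longrightarrow> \<iota> u = \<iota> v \<longleftrightarrow> u = v"
  by (auto elim!: obtain_lift simp: smult_q_eq_iff)

text \<open>This rests on \<open>q_null\<close>, that is on \<open>k \<ge> 1\<close> in the
  application. Elements of \<open>B\<close> may be changed by values of \<open>\<iota>\<close>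
  without effect on their images in \<open>V\<close>.\<close>

lemma red_iota [simp]: "v \<in> carrier V \<Longrightarrow> red (\<iota> v) = \<zero>\<^bsub>V\<^esub>"
  using q by (auto elim!: obtain_lift simp: red_smult q_null)

text \<open>The image of \<open>\<iota>\<close> is an ideal on which \<open>B\<close> acts through
  \<open>V\<close>, by the adjoint action. This is the origin of the coefficients in
  \<open>ad\<close>.\<close>

lemma bracket_iota:
  assumes "x \<in> carrier B" "v \<in> carrier V"
  shows "bracket B x (\<iota> v) = \<iota> (bracket V (red x) v)"
    and "bracket B (\<iota> v) x = \<iota> (bracket V v (red x))"
  using assms q
  by (auto elim!: obtain_lift simp: hom_bracket[symmetric] B.bracket_smult_right B.bracket_smult_left)

text \<open>A multilinear expression on \<open>B\<close> with values in the image of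
  \<open>\<iota>\<close> thus vanishes as soon as one argument is a multiple of \<open>p\<close>,
  hence descends to \<open>V\<close>.\<close>

lemma p_smult_iota:
  assumes "v \<in> carrier V"
  shows "p \<odot>\<^bsub>B\<^esub> \<iota> v = \<zero>\<^bsub>B\<^esub>"
  using assms p by (simp add: iota_smult[symmetric] p_null)

end

text \<open>The smallness of the Jacobiator is what makes it a form on \<open>V\<close>. It is kept
  apart from \<open>pre_lift\<close> because the twisting computation does without it, and the
  corrected bracket is interpreted as a \<open>pre_lift\<close> only.\<close>

locale infinitesimal_lift = pre_lift R B V red p q
  for R :: "('a, 'm) ring_scheme" and B :: "('a, 'b, 'n) bracket_module_scheme"
    and V :: "('a, 'v, 'p) bracket_module_scheme"
    and red :: "'b \<Rightarrow> 'v" and p q :: 'a +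
  assumes jacobiator_small: "\<lbrakk>x \<in> carrier B; y \<in> carrier B; z \<in> carrier B\<rbrakk> \<Longrightarrow>
       \<exists>w \<in> carrier B. jacobiator B x y z = q \<odot>\<^bsub>B\<^esub> w"
begin

lemma jacobiator_iota:
  assumes "x \<in> carrier B" "y \<in> carrier B" "z \<in> carrier B"
  obtains v where "v \<in> carrier V" "jacobiator B x y z = \<iota> v"
  using jacobiator_small[OF assms] by (metis iota_red red_closed)

text \<open>Two elements over the same point of \<open>V\<close> differ by a multiple of
  \<open>p\<close>, and \<open>p\<close> kills all values of the Jacobiator.\<close>

lemma jacobiator_cong_left:
  assumes "x \<in> carrier B" "x' \<in> carrier B" "y \<in> carrier B" "z \<in> carrier B" "red x = red x'"
  shows "jacobiator B x y z = jacobiator B x' y z"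
proof -
  have "red (x \<ominus>\<^bsub>B\<^esub> x') = \<zero>\<^bsub>V\<^esub>"
    using assms by (simp add: red_zero_minus V.M.r_neg V.M.minus_eq)
  then obtain b where b: "b \<in> carrier B" "x \<ominus>\<^bsub>B\<^esub> x' = p \<odot>\<^bsub>B\<^esub> b"
    using kernel assms by blast
  obtain v where v: "v \<in> carrier V" "jacobiator B b y z = \<iota> v"
    using jacobiator_iota b assms by metis
  have "x = p \<odot>\<^bsub>B\<^esub> b \<oplus>\<^bsub>B\<^esub> x'"
    using assms by (simp add: b(2)[symmetric] B.M.minus_eq B.M.a_assoc B.M.l_neg)
  then show ?thesis
    using b v p assms by (simp add: B.jacobiator_add B.jacobiator_smult p_smult_iota)
qed

text \<open>The arguments are exchanged one after the other, each being rotated into the first place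
  for it.\<close>

lemma jacobiator_cong:
  assumes "x \<in> carrier B" "y \<in> carrier B" "z \<in> carrier B"
    and "x' \<in> carrier B" "y' \<in> carrier B" "z' \<in> carrier B"
    and "red x = red x'" "red y = red y'" "red z = red z'"
  shows "jacobiator B x y z = jacobiator B x' y' z'"
proof -
  have "jacobiator B x y z = jacobiator B x' y z"
    using assms by (intro jacobiator_cong_left)
  also have "\<dots> = jacobiator B y z x'"
    using assms by (intro B.jacobiator_cyclic)
  also have "\<dots> = jacobiator B y' z x'"
    using assms by (intro jacobiator_cong_left)
  also have "\<dots> = jacobiator B z x' y'"
    using assms by (intro B.jacobiator_cyclic)
  also have "\<dots> = jacobiator B z' x' y'"
    using assms by (intro jacobiator_cong_left)
  also have "\<dots> = jacobiator B x' y' z'"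
    using assms by (intro B.jacobiator_cyclic)
  finally show ?thesis .
qed

section \<open>The form on \<open>V\<close> induced by the Jacobiator\<close>

definition chi :: "'b \<Rightarrow> 'v" where
  "chi b = (THE w. \<exists>x \<in> carrier B. b = q \<odot>\<^bsub>B\<^esub> x \<and> w = red x)"

text \<open>\<open>chi\<close> and \<open>obstruction\<close> repeat \<open>lift_chi\<close> and
  \<open>J_form\<close> literally, with \<open>red\<close> and \<open>q\<close> for their instances,
  so that in the application the two agree by unfolding.\<close>

definition obstruction :: "'v list \<Rightarrow> 'v" where
  "obstruction = (\<lambda>xs \<in> tuples V 3.
     (THE w. \<exists>x \<in> carrier B. \<exists>y \<in> carrier B. \<exists>z \<in> carrier B.
        xs = [red x, red y, red z] \<and> w = chi (jacobiator B x y z)))"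

lemma chi_iota:
  assumes "v \<in> carrier V"
  shows "chi (\<iota> v) = v"
  unfolding chi_def
proof (rule the_equality)
  show "\<exists>x \<in> carrier B. \<iota> v = q \<odot>\<^bsub>B\<^esub> x \<and> v = red x"
    using assms by (auto elim!: obtain_lift)
next
  fix w assume "\<exists>x \<in> carrier B. \<iota> v = q \<odot>\<^bsub>B\<^esub> x \<and> w = red x"
  then show "w = v" using assms by (auto elim!: obtain_lift simp: smult_q_eq_iff)
qed

text \<open>By \<open>jacobiator_cong\<close> all choices of lifts give the same value. The second
  equation is what replaces the two definite descriptions in the computations below.\<close>

lemma obstruction_red:
  assumes x: "x \<in> carrier B" "y \<in> carrier B" "z \<in> carrier B"
  shows "obstruction [red x, red y, red z] \<in> carrier V"
    and "\<iota> (obstruction [red x, red y, red z]) = jacobiator B x y z"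
proof -
  obtain v where v: "v \<in> carrier V" "jacobiator B x y z = \<iota> v"
    using x by (rule jacobiator_iota)
  have "(THE w. \<exists>x' \<in> carrier B. \<exists>y' \<in> carrier B. \<exists>z' \<in> carrier B.
        [red x, red y, red z] = [red x', red y', red z'] \<and> w = chi (jacobiator B x' y' z')) = v"
  proof (rule the_equality)
    show "\<exists>x' \<in> carrier B. \<exists>y' \<in> carrier B. \<exists>z' \<in> carrier B.
        [red x, red y, red z] = [red x', red y', red z'] \<and> v = chi (jacobiator B x' y' z')"
    proof -
      have "v = chi (jacobiator B x y z)" using v by (simp add: chi_iota)
      with x show ?thesis by blast
    qed
  next
    fix w assume "\<exists>x' \<in> carrier B. \<exists>y' \<in> carrier B. \<exists>z' \<in> carrier B.
        [red x, red y, red z] = [red x', red y', red z'] \<and> w = chi (jacobiator B x' y' z')"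
    then obtain x' y' z' where x': "x' \<in> carrier B" "y' \<in> carrier B" "z' \<in> carrier B"
      "red x = red x'" "red y = red y'" "red z = red z'" and w: "w = chi (jacobiator B x' y' z')" by auto
    have "jacobiator B x' y' z' = \<iota> v"
      using jacobiator_cong[OF x x'] v by simp
    then show "w = v" using w v by (simp add: chi_iota)
  qed
  moreover have "[red x, red y, red z] \<in> tuples V 3" using x by (simp add: tuples_def)
  ultimately have "obstruction [red x, red y, red z] = v" by (simp only: obstruction_def restrict_apply')
  then show "obstruction [red x, red y, red z] \<in> carrier V"
    "\<iota> (obstruction [red x, red y, red z]) = jacobiator B x y z"
    using v by simp_all
qed

lemma obstruction_closed:
  assumes "a \<in> carrier V" "b \<in> carrier V" "c \<in> carrier V"
  shows "obstruction [a, b, c] \<in> carrier V"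
  using assms by (auto elim!: obtain_lift intro: obstruction_red)

lemma obstruction_alt_form: "obstruction \<in> alt_forms R V 3"
proof (rule alt_forms_3I)
  show "obstruction \<in> extensional (tuples V 3)" by (simp add: obstruction_def)
next
  fix a b c assume abc: "a \<in> carrier V" "b \<in> carrier V" "c \<in> carrier V"
  then obtain x y z where *: "x \<in> carrier B" "y \<in> carrier B" "z \<in> carrier B"
    "a = red x" "b = red y" "c = red z" by (metis obtain_lift)
  show "obstruction [a, b, c] \<in> carrier V" using abc by (rule obstruction_closed)
  have "\<iota> (obstruction [a, b, c]) = \<iota> (obstruction [b, c, a])"
    using * by (simp add: obstruction_red B.jacobiator_cyclic[of x y z])
  then show "obstruction [a, b, c] = obstruction [b, c, a]"
    using abc by (simp add: iota_inject obstruction_closed)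
  fix a' assume a': "a' \<in> carrier V"
  then obtain x' where x': "x' \<in> carrier B" "a' = red x'" by (rule obtain_lift)
  have "\<iota> (obstruction [a \<oplus>\<^bsub>V\<^esub> a', b, c]) = \<iota> (obstruction [a, b, c] \<oplus>\<^bsub>V\<^esub> obstruction [a', b, c])"
    using * x' by (simp add: obstruction_red iota_add B.jacobiator_add red_add[symmetric])
  then show "a \<oplus>\<^bsub>V\<^esub> a' \<in> carrier V \<and>
      obstruction [a \<oplus>\<^bsub>V\<^esub> a', b, c] = obstruction [a, b, c] \<oplus>\<^bsub>V\<^esub> obstruction [a', b, c]"
    using abc a' by (simp add: iota_inject obstruction_closed)
next
  fix r a b c assume r: "r \<in> carrier R" and abc: "a \<in> carrier V" "b \<in> carrier V" "c \<in> carrier V"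
  then obtain x y z where *: "x \<in> carrier B" "y \<in> carrier B" "z \<in> carrier B"
    "a = red x" "b = red y" "c = red z" by (metis obtain_lift)
  have "\<iota> (obstruction [r \<odot>\<^bsub>V\<^esub> a, b, c]) = \<iota> (r \<odot>\<^bsub>V\<^esub> obstruction [a, b, c])"
    using r * by (simp add: obstruction_red iota_smult B.jacobiator_smult red_smult[symmetric])
  then show "r \<odot>\<^bsub>V\<^esub> a \<in> carrier V \<and> obstruction [r \<odot>\<^bsub>V\<^esub> a, b, c] = r \<odot>\<^bsub>V\<^esub> obstruction [a, b, c]"
    using r abc by (simp add: iota_inject obstruction_closed)
next
  fix a b assume ab: "a \<in> carrier V" "b \<in> carrier V"
  then obtain x y where *: "x \<in> carrier B" "y \<in> carrier B" "a = red x" "b = red y"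
    by (metis obtain_lift)
  have "\<iota> (obstruction [a, a, b]) = \<iota> \<zero>\<^bsub>V\<^esub>"
    using * by (simp add: obstruction_red B.jacobiator_alternating)
  then show "obstruction [a, a, b] = \<zero>\<^bsub>V\<^esub>"
    using ab by (simp add: iota_inject obstruction_closed del: iota_zero)
qed

lemma obstruction_cocycle: "obstruction \<in> cocycles R V 3"
proof -
  have "differential V 3 obstruction xs = \<zero>\<^bsub>V\<^esub>" if "xs \<in> tuples V (Suc 3)" for xs
  proof -
    obtain a b c d where abcd: "a \<in> carrier V" "b \<in> carrier V" "c \<in> carrier V" "d \<in> carrier V"
      and xs: "xs = [a, b, c, d]"
      using \<open>xs \<in> tuples V (Suc 3)\<close> unfolding tuples_4 by blast
    obtain x y z w where *: "x \<in> carrier B" "y \<in> carrier B" "z \<in> carrier B" "w \<in> carrier B"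
      "a = red x" "b = red y" "c = red z" "d = red w" using abcd by (metis obtain_lift)
    let ?d = "differential V 3 obstruction [a, b, c, d]"
    have d: "?d \<in> carrier V"
      using abcd by (simp add: V.differential_3 obstruction_closed)
    \<comment> \<open>Pulled through the sum, \<open>\<iota>\<close> turns brackets in
      \<open>V\<close> into brackets in \<open>B\<close> and values of the form into Jacobiators,
      which leaves the left side of \<open>jacobiator_cocycle\<close>.\<close>
    have "\<iota> ?d = \<iota> \<zero>\<^bsub>V\<^esub>"
      using B.jacobiator_cocycle[OF *(1-4)] *
      by (simp add: V.differential_3 obstruction_closed iota_add iota_minus
          bracket_iota(1)[symmetric] obstruction_red hom_bracket[symmetric])
    then show ?thesis using d by (simp only: xs iota_inject V.M.zero_closed)
  qed
  then have "differential V 3 obstruction = \<zero>\<^bsub>form_space R V (Suc 3)\<^esub>"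
    by (auto simp: form_space_def differential_def fun_eq_iff)
  then show ?thesis using obstruction_alt_form by (simp add: cocycles_def)
qed

text \<open>This concerns the form itself and not its class: it decides whether \<open>B\<close>
  with its present bracket satisfies the Jacobi identity. An exact form only promises another
  bracket that does.\<close>

lemma obstruction_zero_iff:
  "obstruction = \<zero>\<^bsub>form_space R V 3\<^esub> \<longleftrightarrow>
     (\<forall>x \<in> carrier B. \<forall>y \<in> carrier B. \<forall>z \<in> carrier B. jacobiator B x y z = \<zero>\<^bsub>B\<^esub>)"
proof
  assume "obstruction = \<zero>\<^bsub>form_space R V 3\<^esub>"
  then have "obstruction [red x, red y, red z] = \<zero>\<^bsub>V\<^esub>"
    if "x \<in> carrier B" "y \<in> carrier B" "z \<in> carrier B" for x y z
    using that by (simp add: form_space_def tuples_def)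
  then show "\<forall>x \<in> carrier B. \<forall>y \<in> carrier B. \<forall>z \<in> carrier B. jacobiator B x y z = \<zero>\<^bsub>B\<^esub>"
    by (metis obstruction_red(2) iota_zero)
next
  assume R: "\<forall>x \<in> carrier B. \<forall>y \<in> carrier B. \<forall>z \<in> carrier B. jacobiator B x y z = \<zero>\<^bsub>B\<^esub>"
  show "obstruction = \<zero>\<^bsub>form_space R V 3\<^esub>"
  proof (rule extensionalityI[of _ "tuples V 3"])
    fix xs assume "xs \<in> tuples V 3"
    then obtain a b c where abc: "a \<in> carrier V" "b \<in> carrier V" "c \<in> carrier V" "xs = [a, b, c]"
      by (auto simp: tuples_3)
    then obtain x y z where *: "x \<in> carrier B" "y \<in> carrier B" "z \<in> carrier B"
      "a = red x" "b = red y" "c = red z" by (metis obtain_lift)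
    have "\<iota> (obstruction xs) = \<iota> \<zero>\<^bsub>V\<^esub>"
      using * R abc(4) by (simp add: obstruction_red)
    then have "obstruction xs = \<zero>\<^bsub>V\<^esub>"
      using abc by (simp only: iota_inject obstruction_closed V.M.zero_closed)
    then show "obstruction xs = \<zero>\<^bsub>form_space R V 3\<^esub> xs"
      using \<open>xs \<in> tuples V 3\<close> by (simp add: form_space_def)
  qed (simp_all add: obstruction_def form_space_def)
qed

end

section \<open>Comparison of lifts\<close>

lemma (in module) alt_forms_2_minus:
  assumes \<omega>: "\<omega> \<in> alt_forms R M 2" and a: "a \<in> carrier M" "b \<in> carrier M"
  shows "\<omega> [b, a] = \<ominus>\<^bsub>M\<^esub> \<omega> [a, b]" and "\<omega> [\<ominus>\<^bsub>M\<^esub> a, b] = \<ominus>\<^bsub>M\<^esub> \<omega> [a, b]"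
proof -
  note D = alt_forms_2D[OF \<omega>]
  have "\<omega> [a \<oplus>\<^bsub>M\<^esub> b, a \<oplus>\<^bsub>M\<^esub> b] = \<omega> [b, a] \<oplus>\<^bsub>M\<^esub> \<omega> [a, b]"
    using a by (simp add: D(2-4) D(7)[OF a(1)] D(7)[OF a(2)] M.a_comm)
  moreover have "\<omega> [a \<oplus>\<^bsub>M\<^esub> b, a \<oplus>\<^bsub>M\<^esub> b] = \<zero>\<^bsub>M\<^esub>" using a by (simp add: D(7))
  ultimately show "\<omega> [b, a] = \<ominus>\<^bsub>M\<^esub> \<omega> [a, b]" using a by (metis M.minus_equality D(2))
  have "\<omega> [\<zero>\<^bsub>M\<^esub>, b] = \<zero>\<^bsub>M\<^esub>" using D(5)[of "\<zero>\<^bsub>R\<^esub>" a b] a D(2) by simp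
  then show "\<omega> [\<ominus>\<^bsub>M\<^esub> a, b] = \<ominus>\<^bsub>M\<^esub> \<omega> [a, b]"
    using D(3)[of "\<ominus>\<^bsub>M\<^esub> a" a b] D(2) a by (simp add: M.l_neg M.minus_equality)
qed

text \<open>If a bracket changes by \<open>\<omega>\<close>, then
  \<open>[\<omega>(a, b), c] + \<omega>([a, b], c)\<close> is the change of
  \<open>[[a, b], c]\<close> to first order. So the differential is minus the first-order change of
  the Jacobiator.\<close>

lemma (in alternating_bracket) differential_2_cyclic:
  assumes \<omega>: "\<omega> \<in> alt_forms R M 2" and a: "a \<in> carrier M" "b \<in> carrier M" "c \<in> carrier M"
  shows "differential M 2 \<omega> [a, b, c] =
    \<ominus>\<^bsub>M\<^esub> ((bracket M (\<omega> [a, b]) c \<oplus>\<^bsub>M\<^esub> \<omega> [bracket M a b, c])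
      \<oplus>\<^bsub>M\<^esub> (bracket M (\<omega> [b, c]) a \<oplus>\<^bsub>M\<^esub> \<omega> [bracket M b c, a])
      \<oplus>\<^bsub>M\<^esub> (bracket M (\<omega> [c, a]) b \<oplus>\<^bsub>M\<^esub> \<omega> [bracket M c a, b]))"
proof -
  note D = alt_forms_2D[OF \<omega>]
  have 1: "bracket M (\<omega> [a, b]) c = \<ominus>\<^bsub>M\<^esub> bracket M c (\<omega> [a, b])"
    "bracket M (\<omega> [b, c]) a = \<ominus>\<^bsub>M\<^esub> bracket M a (\<omega> [b, c])"
    using a by (simp_all add: bracket_swap[symmetric] D(2))
  have "bracket M (\<omega> [c, a]) b = \<ominus>\<^bsub>M\<^esub> bracket M (\<omega> [a, c]) b"
    using a by (simp add: alt_forms_2_minus[OF \<omega>, of a c] bracket_minus_left D(2))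
  also have "\<dots> = bracket M b (\<omega> [a, c])"
    using a by (simp add: bracket_swap[symmetric] D(2))
  finally have 2: "bracket M (\<omega> [c, a]) b = bracket M b (\<omega> [a, c])" .
  have 3: "\<omega> [bracket M c a, b] = \<ominus>\<^bsub>M\<^esub> \<omega> [bracket M a c, b]"
    using a by (simp add: bracket_swap[of a c] alt_forms_2_minus(2)[OF \<omega>])
  show ?thesis
    using a by (simp add: differential_2 D(2) 1 2 3 M.minus_add M.a_ac)
qed

text \<open>Taking \<open>\<phi>\<close> into \<open>[[x, y], z]\<close> from the outside costs one
  error term for each of the two brackets, and neither error is inserted into the other, so nothing
  quadratic in \<open>\<omega>\<close> arises. The lemma serves twice: for a map between two lifts,
  and for the identity between two brackets on one module.\<close>

lemma jacobiator_twist: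
  assumes "pre_lift R B V red p q" and "pre_lift R B' V red' p q"
    and phi: "linear_map R B B' \<phi>" and red_phi: "\<And>x. x \<in> carrier B \<Longrightarrow> red' (\<phi> x) = red x"
    and \<omega>: "\<omega> \<in> alt_forms R V 2"
    and twist: "\<And>x y. \<lbrakk>x \<in> carrier B; y \<in> carrier B\<rbrakk> \<Longrightarrow> \<phi> (bracket B x y) =
       bracket B' (\<phi> x) (\<phi> y) \<oplus>\<^bsub>B'\<^esub> pre_lift.\<iota> B' red' q (\<omega> [red x, red y])"
    and x: "x \<in> carrier B" "y \<in> carrier B" "z \<in> carrier B"
  shows "jacobiator B' (\<phi> x) (\<phi> y) (\<phi> z) = \<phi> (jacobiator B x y z)
     \<oplus>\<^bsub>B'\<^esub> pre_lift.\<iota> B' red' q (differential V 2 \<omega> [red x, red y, red z])"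
proof -
  interpret L: pre_lift R B V red p q by fact
  interpret L': pre_lift R B' V red' p q by fact
  note D = alt_forms_2D[OF \<omega>] and phic [simp] = linear_mapD(1)[OF phi]
  \<comment> \<open>The total error of \<open>[[x, y], z]\<close>, as an element of
    \<open>V\<close>.\<close>
  let ?s = "\<lambda>x y z. bracket V (\<omega> [red x, red y]) (red z) \<oplus>\<^bsub>V\<^esub> \<omega> [bracket V (red x) (red y), red z]"
  have s: "?s x y z \<in> carrier V" if "x \<in> carrier B" "y \<in> carrier B" "z \<in> carrier B" for x y z
    using that by (simp add: D(2))
  have *: "\<phi> (bracket B (bracket B x y) z)
      = bracket B' (bracket B' (\<phi> x) (\<phi> y)) (\<phi> z) \<oplus>\<^bsub>B'\<^esub> L'.\<iota> (?s x y z)"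
    if "x \<in> carrier B" "y \<in> carrier B" "z \<in> carrier B" for x y z
  proof -
    have "\<phi> (bracket B (bracket B x y) z) = bracket B' (bracket B' (\<phi> x) (\<phi> y)) (\<phi> z)
       \<oplus>\<^bsub>B'\<^esub> bracket B' (L'.\<iota> (\<omega> [red x, red y])) (\<phi> z)
       \<oplus>\<^bsub>B'\<^esub> L'.\<iota> (\<omega> [bracket V (red x) (red y), red z])"
      using that by (simp add: twist L.hom_bracket L'.B.bracket_add_left D(2))
    also have "bracket B' (L'.\<iota> (\<omega> [red x, red y])) (\<phi> z) = L'.\<iota> (bracket V (\<omega> [red x, red y]) (red z))"
      using that by (simp add: L'.bracket_iota D(2) red_phi)
    finally show ?thesis using that by (simp add: L'.iota_add D(2) L'.B.M.a_assoc)
  qed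
  let ?S = "?s x y z \<oplus>\<^bsub>V\<^esub> ?s y z x \<oplus>\<^bsub>V\<^esub> ?s z x y"
  have d: "differential V 2 \<omega> [red x, red y, red z] = \<ominus>\<^bsub>V\<^esub> ?S"
    using x by (simp add: L.V.differential_2_cyclic[OF \<omega>])
  have S: "?S \<in> carrier V" using x s by simp
  have "\<phi> (jacobiator B x y z) = \<phi> (bracket B (bracket B x y) z)
      \<oplus>\<^bsub>B'\<^esub> \<phi> (bracket B (bracket B y z) x) \<oplus>\<^bsub>B'\<^esub> \<phi> (bracket B (bracket B z x) y)"
    using x by (simp add: jacobiator_def linear_mapD(2)[OF phi])
  also have "\<dots> = jacobiator B' (\<phi> x) (\<phi> y) (\<phi> z)
      \<oplus>\<^bsub>B'\<^esub> (L'.\<iota> (?s x y z) \<oplus>\<^bsub>B'\<^esub> L'.\<iota> (?s y z x) \<oplus>\<^bsub>B'\<^esub> L'.\<iota> (?s z x y))"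
    using x s by (simp only: *) (simp add: jacobiator_def L'.B.M.a_ac D(2))
  also have "\<dots> = jacobiator B' (\<phi> x) (\<phi> y) (\<phi> z) \<oplus>\<^bsub>B'\<^esub> L'.\<iota> ?S"
    using x s by (simp only: L'.iota_add L.V.M.a_closed)
  finally have "\<phi> (jacobiator B x y z) = jacobiator B' (\<phi> x) (\<phi> y) (\<phi> z) \<oplus>\<^bsub>B'\<^esub> L'.\<iota> ?S" .
  moreover have "jacobiator B' (\<phi> x) (\<phi> y) (\<phi> z) \<in> carrier B'" "L'.\<iota> ?S \<in> carrier B'"
    using x S by simp_all
  ultimately show ?thesis
    unfolding d using S by (simp only: L'.iota_minus L'.B.M.a_assoc L'.B.M.r_neg L'.B.M.r_zero
        L'.B.M.a_inv_closed)
qed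

text \<open>The form \<open>\<omega>\<close> is the defect of \<open>\<phi>\<close> as a
  homomorphism of brackets. The defect is bilinear and alternating on \<open>B\<close>, and by
  \<open>small\<close> it lies in the image of \<open>\<iota>\<close>; what remains is its descent
  to \<open>V\<close>.\<close>

lemma obstruction_compare:
  assumes L: "infinitesimal_lift R B V red p q" and L': "infinitesimal_lift R B' V red' p q"
    and phi: "linear_map R B B' \<phi>" and red_phi: "\<And>x. x \<in> carrier B \<Longrightarrow> red' (\<phi> x) = red x"
    and small: "\<And>x y. \<lbrakk>x \<in> carrier B; y \<in> carrier B\<rbrakk> \<Longrightarrow> \<exists>w \<in> carrier B'.
       \<phi> (bracket B x y) \<ominus>\<^bsub>B'\<^esub> bracket B' (\<phi> x) (\<phi> y) = q \<odot>\<^bsub>B'\<^esub> w"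
  obtains \<omega> where "\<omega> \<in> alt_forms R V 2"
    "infinitesimal_lift.obstruction B' V red' q =
       infinitesimal_lift.obstruction B V red q \<oplus>\<^bsub>form_space R V 3\<^esub> differential V 2 \<omega>"
proof -
  interpret L: infinitesimal_lift R B V red p q by fact
  interpret L': infinitesimal_lift R B' V red' p q by fact
  note phic [simp] = linear_mapD(1)[OF phi]
  note phiD = linear_mapD(2,3)[OF phi] linear_map_zero_minus[OF L.B.module_axioms L'.B.module_axioms phi]
  define \<delta> where "\<delta> x y = \<phi> (bracket B x y) \<ominus>\<^bsub>B'\<^esub> bracket B' (\<phi> x) (\<phi> y)" for x y
  have dc [simp]: "\<delta> x y \<in> carrier B'" if "x \<in> carrier B" "y \<in> carrier B" for x y
    using that by (simp add: \<delta>_def)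
  have d_add: "\<delta> (x \<oplus>\<^bsub>B\<^esub> x') y = \<delta> x y \<oplus>\<^bsub>B'\<^esub> \<delta> x' y" "\<delta> y (x \<oplus>\<^bsub>B\<^esub> x') = \<delta> y x \<oplus>\<^bsub>B'\<^esub> \<delta> y x'"
    if "x \<in> carrier B" "x' \<in> carrier B" "y \<in> carrier B" for x x' y
    using that by (simp_all add: \<delta>_def phiD L.B.bracket_add_left L.B.bracket_add_right
        L'.B.bracket_add_left L'.B.bracket_add_right L'.B.M.minus_eq L'.B.M.minus_add L'.B.M.a_ac)
  have d_smult: "\<delta> (a \<odot>\<^bsub>B\<^esub> x) y = a \<odot>\<^bsub>B'\<^esub> \<delta> x y" "\<delta> y (a \<odot>\<^bsub>B\<^esub> x) = a \<odot>\<^bsub>B'\<^esub> \<delta> y x"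
    if "a \<in> carrier R" "x \<in> carrier B" "y \<in> carrier B" for a x y
    using that by (simp_all add: \<delta>_def phiD L.B.bracket_smult_left L.B.bracket_smult_right
        L'.B.bracket_smult_left L'.B.bracket_smult_right L'.B.M.minus_eq L'.B.smult_r_distr
        L'.B.smult_r_minus)
  have d_alt: "\<delta> x x = \<zero>\<^bsub>B'\<^esub>" if "x \<in> carrier B" for x
    using that by (simp add: \<delta>_def phiD L.B.bracket_alternating L'.B.bracket_alternating
        L'.B.M.minus_eq)
  have ex: "\<exists>v. v \<in> carrier V \<and> L'.\<iota> v = \<delta> x y" if xy: "x \<in> carrier B" "y \<in> carrier B" for x y
  proof -
    from small[OF xy] obtain w where "w \<in> carrier B'" "\<delta> x y = q \<odot>\<^bsub>B'\<^esub> w" by (auto simp: \<delta>_def)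
    then show ?thesis by (intro exI[of _ "red' w"]) auto
  qed
  define f where "f x y = (SOME v. v \<in> carrier V \<and> L'.\<iota> v = \<delta> x y)" for x y
  have f: "f x y \<in> carrier V" "L'.\<iota> (f x y) = \<delta> x y" if "x \<in> carrier B" "y \<in> carrier B" for x y
    using someI_ex[OF ex[OF that]] unfolding f_def by (rule conjunct1, rule conjunct2)
  \<comment> \<open>An argument over 0 is a multiple of \<open>p\<close>, which can be taken out of
    \<open>\<delta>\<close>, and \<open>p\<close> kills the values of
    \<open>\<delta>\<close>.\<close>
  have d_null: "\<delta> x y = \<zero>\<^bsub>B'\<^esub>" "\<delta> y x = \<zero>\<^bsub>B'\<^esub>"
    if xy: "x \<in> carrier B" "y \<in> carrier B" and x0: "red x = \<zero>\<^bsub>V\<^esub>" for x y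
  proof -
    obtain b where b: "b \<in> carrier B" "x = p \<odot>\<^bsub>B\<^esub> b" using L.kernel[OF xy(1) x0] by auto
    then show "\<delta> x y = \<zero>\<^bsub>B'\<^esub>" "\<delta> y x = \<zero>\<^bsub>B'\<^esub>"
      using xy f[of b y] f[of y b] L.p L'.p_smult_iota[of "f b y"] L'.p_smult_iota[of "f y b"]
      by (simp_all add: d_smult)
  qed
  have d_cong: "\<delta> x y = \<delta> x' y'"
    if "x \<in> carrier B" "x' \<in> carrier B" "y \<in> carrier B" "y' \<in> carrier B" "red x = red x'" "red y = red y'"
    for x x' y y'
  proof -
    have *: "red (x \<ominus>\<^bsub>B\<^esub> x') = \<zero>\<^bsub>V\<^esub>" "red (y \<ominus>\<^bsub>B\<^esub> y') = \<zero>\<^bsub>V\<^esub>"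
      using that by (simp_all add: L.red_zero_minus L.V.M.r_neg L.V.M.minus_eq)
    have e: "x = (x \<ominus>\<^bsub>B\<^esub> x') \<oplus>\<^bsub>B\<^esub> x'" "y = (y \<ominus>\<^bsub>B\<^esub> y') \<oplus>\<^bsub>B\<^esub> y'"
      using that by (simp_all add: L.B.M.minus_eq L.B.M.a_assoc L.B.M.l_neg)
    have "\<delta> x y = \<delta> x' y"
      using that d_add(1)[of "x \<ominus>\<^bsub>B\<^esub> x'" x' y] d_null(1)[OF _ _ *(1)] e(1) by simp
    also have "\<dots> = \<delta> x' y'"
      using that d_add(2)[of "y \<ominus>\<^bsub>B\<^esub> y'" y' x'] d_null(2)[OF _ _ *(2)] e(2) by simp
    finally show ?thesis .
  qed
  have ex: "\<exists>x. x \<in> carrier B \<and> red x = v" if "v \<in> carrier V" for v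
    using that by (auto elim!: L.obtain_lift)
  define s where "s v = (SOME x. x \<in> carrier B \<and> red x = v)" for v
  have s: "s v \<in> carrier B" "red (s v) = v" if "v \<in> carrier V" for v
    unfolding s_def using someI_ex[OF ex[OF that]] by blast+
  \<comment> \<open>Here \<open>f\<close> is the defect read in \<open>V\<close>, and
    \<open>s\<close> picks elements of \<open>B\<close> over the arguments; by \<open>d_cong\<close>
    another choice would give the same defect.\<close>
  define \<omega> where "\<omega> = (\<lambda>xs \<in> tuples V 2. f (s (xs ! 0)) (s (xs ! 1)))"
  have w: "\<omega> [red x, red y] \<in> carrier V" "L'.\<iota> (\<omega> [red x, red y]) = \<delta> x y"
    if "x \<in> carrier B" "y \<in> carrier B" for x y
    using that d_cong[of "s (red x)" x "s (red y)" y]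
    by (simp_all add: \<omega>_def tuples_def f s)
  have wc: "\<omega> [a, b] \<in> carrier V" if "a \<in> carrier V" "b \<in> carrier V" for a b
    using that w by (metis L.obtain_lift)
  have alt: "\<omega> \<in> alt_forms R V 2"
  proof (rule alt_forms_2I)
    fix a b c assume "a \<in> carrier V" "b \<in> carrier V" "c \<in> carrier V"
    then obtain x y z where *: "x \<in> carrier B" "y \<in> carrier B" "z \<in> carrier B"
      "a = red x" "b = red y" "c = red z" by (metis L.obtain_lift)
    have "L'.\<iota> (\<omega> [a \<oplus>\<^bsub>V\<^esub> b, c]) = L'.\<iota> (\<omega> [a, c] \<oplus>\<^bsub>V\<^esub> \<omega> [b, c])"
      "L'.\<iota> (\<omega> [a, b \<oplus>\<^bsub>V\<^esub> c]) = L'.\<iota> (\<omega> [a, b] \<oplus>\<^bsub>V\<^esub> \<omega> [a, c])"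
      using * by (simp_all add: L.red_add[symmetric] w L'.iota_add d_add)
    then show "\<omega> [a \<oplus>\<^bsub>V\<^esub> b, c] = \<omega> [a, c] \<oplus>\<^bsub>V\<^esub> \<omega> [b, c]" "\<omega> [a, b \<oplus>\<^bsub>V\<^esub> c] = \<omega> [a, b] \<oplus>\<^bsub>V\<^esub> \<omega> [a, c]"
      using * by (simp_all add: L'.iota_inject wc)
  next
    fix r a b assume r: "r \<in> carrier R" and "a \<in> carrier V" "b \<in> carrier V"
    then obtain x y where *: "x \<in> carrier B" "y \<in> carrier B" "a = red x" "b = red y"
      by (metis L.obtain_lift)
    have "L'.\<iota> (\<omega> [r \<odot>\<^bsub>V\<^esub> a, b]) = L'.\<iota> (r \<odot>\<^bsub>V\<^esub> \<omega> [a, b])"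
      "L'.\<iota> (\<omega> [a, r \<odot>\<^bsub>V\<^esub> b]) = L'.\<iota> (r \<odot>\<^bsub>V\<^esub> \<omega> [a, b])"
      using * r by (simp_all add: L.red_smult[symmetric] w L'.iota_smult d_smult)
    then show "\<omega> [r \<odot>\<^bsub>V\<^esub> a, b] = r \<odot>\<^bsub>V\<^esub> \<omega> [a, b]" "\<omega> [a, r \<odot>\<^bsub>V\<^esub> b] = r \<odot>\<^bsub>V\<^esub> \<omega> [a, b]"
      using * r by (simp_all add: L'.iota_inject wc)
  next
    fix a assume a: "a \<in> carrier V"
    then obtain x where *: "x \<in> carrier B" "a = red x" by (rule L.obtain_lift)
    then have "L'.\<iota> (\<omega> [a, a]) = L'.\<iota> \<zero>\<^bsub>V\<^esub>" by (simp add: w d_alt)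
    then show "\<omega> [a, a] = \<zero>\<^bsub>V\<^esub>" using a by (simp add: L'.iota_inject wc del: L'.iota_zero)
  qed (auto simp: \<omega>_def[symmetric] wc, simp add: \<omega>_def)
  have twist: "\<phi> (bracket B x y) = bracket B' (\<phi> x) (\<phi> y) \<oplus>\<^bsub>B'\<^esub> L'.\<iota> (\<omega> [red x, red y])"
    if "x \<in> carrier B" "y \<in> carrier B" for x y
    using that L'.B.M.r_neg2[of "bracket B' (\<phi> x) (\<phi> y)" "\<phi> (bracket B x y)"]
    by (simp add: w \<delta>_def L'.B.M.minus_eq L'.B.M.a_ac)
  have dw: "differential V 2 \<omega> [a, b, c] \<in> carrier V"
    if "a \<in> carrier V" "b \<in> carrier V" "c \<in> carrier V" for a b c
    using that by (simp add: L.V.differential_2 wc)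
  have "L'.obstruction = L.obstruction \<oplus>\<^bsub>form_space R V 3\<^esub> differential V 2 \<omega>"
  proof (rule extensionalityI[of _ "tuples V 3"])
    fix xs assume xs: "xs \<in> tuples V 3"
    then obtain a b c where abc: "a \<in> carrier V" "b \<in> carrier V" "c \<in> carrier V" "xs = [a, b, c]"
      by (auto simp: tuples_3)
    then obtain x y z where *: "x \<in> carrier B" "y \<in> carrier B" "z \<in> carrier B"
      "a = red x" "b = red y" "c = red z" by (metis L.obtain_lift)
    \<comment> \<open>Both embeddings multiply an element over \<open>v\<close> by \<open>q\<close>,
      and \<open>\<phi>\<close> carries elements over \<open>v\<close> to elements over
      \<open>v\<close>.\<close>
    have iota: "L'.\<iota> v = \<phi> (L.\<iota> v)" if v: "v \<in> carrier V" for v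
    proof -
      obtain u where "u \<in> carrier B" "v = red u" using v by (rule L.obtain_lift)
      then show ?thesis using L.q L'.iota_red[of "\<phi> u"] by (simp add: phiD red_phi)
    qed
    have "L'.\<iota> (L'.obstruction [a, b, c]) = jacobiator B' (\<phi> x) (\<phi> y) (\<phi> z)"
      using L'.obstruction_red(2)[of "\<phi> x" "\<phi> y" "\<phi> z"] * by (simp add: red_phi)
    also have "\<dots> = \<phi> (jacobiator B x y z) \<oplus>\<^bsub>B'\<^esub> L'.\<iota> (differential V 2 \<omega> [a, b, c])"
      using jacobiator_twist[OF L.pre_lift_axioms L'.pre_lift_axioms phi red_phi alt twist *(1-3)] *
      by simp
    also have "\<phi> (jacobiator B x y z) = L'.\<iota> (L.obstruction [a, b, c])"
      using * by (simp add: iota L.obstruction_red)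
    finally have "L'.\<iota> (L'.obstruction [a, b, c])
        = L'.\<iota> (L.obstruction [a, b, c] \<oplus>\<^bsub>V\<^esub> differential V 2 \<omega> [a, b, c])"
      using abc by (simp add: L'.iota_add L.obstruction_closed dw)
    then have "L'.obstruction [a, b, c] = L.obstruction [a, b, c] \<oplus>\<^bsub>V\<^esub> differential V 2 \<omega> [a, b, c]"
      using abc by (simp add: L'.iota_inject L.obstruction_closed L'.obstruction_closed dw)
    then show "L'.obstruction xs = (L.obstruction \<oplus>\<^bsub>form_space R V 3\<^esub> differential V 2 \<omega>) xs"
      using xs abc by (simp add: form_space_def)
  qed (simp_all add: L'.obstruction_def form_space_def)
  with alt show ?thesis by (rule that)
qed

section \<open>Cohomology classes\<close>

lemma coboundaries_3: "coboundaries R V 3 = differential V 2 ` alt_forms R V 2"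
  by (simp add: coboundaries_def numeral_3_eq_3 numeral_2_eq_2)

lemma cohomology_class_alt:
  "cohomology_class R V 3 J = (\<lambda>\<omega>. differential V 2 \<omega> \<oplus>\<^bsub>form_space R V 3\<^esub> J) ` alt_forms R V 2"
  by (auto simp: cohomology_class_def coboundaries_3 a_r_coset_def')

lemma differential_2_extensional: "differential V 2 \<omega> \<in> extensional (tuples V 3)"
  by (simp add: differential_def numeral_3_eq_3 numeral_2_eq_2)

lemma tuple_2_mem: "a \<in> carrier V \<Longrightarrow> b \<in> carrier V \<Longrightarrow> [a, b] \<in> tuples V 2"
  by (simp add: tuples_def)

lemma tuple_3_mem: "a \<in> carrier V \<Longrightarrow> b \<in> carrier V \<Longrightarrow> c \<in> carrier V \<Longrightarrow> [a, b, c] \<in> tuples V 3"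
  by (simp add: tuples_def)

text \<open>Reduces an equation between forms to one between values on triples, where the group laws
  of \<open>V\<close> apply.\<close>

lemma form_3_eqI:
  assumes "f \<in> extensional (tuples V 3)" "g \<in> extensional (tuples V 3)"
    and "\<And>a b c. \<lbrakk>a \<in> carrier V; b \<in> carrier V; c \<in> carrier V\<rbrakk> \<Longrightarrow> f [a, b, c] = g [a, b, c]"
  shows "f = g"
  using assms by (auto simp: tuples_3 intro!: extensionalityI[of _ "tuples V 3"])

lemma form_space_3_simps [simp]:
  "f \<oplus>\<^bsub>form_space R V 3\<^esub> g \<in> extensional (tuples V 3)"
  "\<lbrakk>a \<in> carrier V; b \<in> carrier V; c \<in> carrier V\<rbrakk> \<Longrightarrow>
     (f \<oplus>\<^bsub>form_space R V 3\<^esub> g) [a, b, c] = f [a, b, c] \<oplus>\<^bsub>V\<^esub> g [a, b, c]"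
  "\<lbrakk>a \<in> carrier V; b \<in> carrier V; c \<in> carrier V\<rbrakk> \<Longrightarrow>
     \<zero>\<^bsub>form_space R V 3\<^esub> [a, b, c] = \<zero>\<^bsub>V\<^esub>"
  by (simp_all add: form_space_def tuple_3_mem)

section \<open>Additivity of the differential in degree two\<close>

lemma (in module) alt_forms_2_add_minus:
  assumes \<omega>: "\<omega> \<in> alt_forms R M 2" and \<eta>: "\<eta> \<in> alt_forms R M 2"
  shows "(\<lambda>xs \<in> tuples M 2. \<omega> xs \<oplus>\<^bsub>M\<^esub> \<eta> xs) \<in> alt_forms R M 2" (is ?add)
    and "(\<lambda>xs \<in> tuples M 2. \<ominus>\<^bsub>M\<^esub> \<omega> xs) \<in> alt_forms R M 2" (is ?minus)
proof -
  note D = alt_forms_2D[OF \<omega>] and E = alt_forms_2D[OF \<eta>]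
  show ?add
    by (rule alt_forms_2I) (simp_all add: tuple_2_mem D(2-) E(2-) smult_r_distr M.a_ac)
  show ?minus
    by (rule alt_forms_2I) (simp_all add: tuple_2_mem D(2-) smult_r_minus M.minus_add M.a_ac)
qed

lemma (in module) alt_forms_2_zero: "(\<lambda>xs \<in> tuples M 2. \<zero>\<^bsub>M\<^esub>) \<in> alt_forms R M 2"
  by (rule alt_forms_2I) (simp_all add: tuple_2_mem)

context alternating_bracket
begin

lemma differential_2_closed:
  assumes "\<omega> \<in> alt_forms R M 2" "a \<in> carrier M" "b \<in> carrier M" "c \<in> carrier M"
  shows "differential M 2 \<omega> [a, b, c] \<in> carrier M"
  using assms by (simp add: differential_2 alt_forms_2D(2)[OF assms(1)])

lemma differential_2_add:
  assumes \<omega>: "\<omega> \<in> alt_forms R M 2" and \<eta>: "\<eta> \<in> alt_forms R M 2"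
    and "a \<in> carrier M" "b \<in> carrier M" "c \<in> carrier M"
  shows "differential M 2 (\<lambda>xs \<in> tuples M 2. \<omega> xs \<oplus>\<^bsub>M\<^esub> \<eta> xs) [a, b, c]
    = differential M 2 \<omega> [a, b, c] \<oplus>\<^bsub>M\<^esub> differential M 2 \<eta> [a, b, c]"
  using assms(3-)
  by (simp add: differential_2 tuple_2_mem alt_forms_2D(2)[OF \<omega>] alt_forms_2D(2)[OF \<eta>]
      bracket_add_right M.minus_add M.a_ac)

lemma differential_2_minus:
  assumes \<omega>: "\<omega> \<in> alt_forms R M 2" and "a \<in> carrier M" "b \<in> carrier M" "c \<in> carrier M"
  shows "differential M 2 (\<lambda>xs \<in> tuples M 2. \<ominus>\<^bsub>M\<^esub> \<omega> xs) [a, b, c] = \<ominus>\<^bsub>M\<^esub> differential M 2 \<omega> [a, b, c]"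
  using assms(2-)
  by (simp add: differential_2 tuple_2_mem alt_forms_2D(2)[OF \<omega>]
      bracket_minus_right M.minus_add M.a_ac)

lemma differential_2_zero:
  assumes "a \<in> carrier M" "b \<in> carrier M" "c \<in> carrier M"
  shows "differential M 2 (\<lambda>xs \<in> tuples M 2. \<zero>\<^bsub>M\<^esub>) [a, b, c] = \<zero>\<^bsub>M\<^esub>"
proof -
  have "\<ominus>\<^bsub>M\<^esub> \<zero>\<^bsub>M\<^esub> = \<zero>\<^bsub>M\<^esub>" by (rule M.minus_equality) simp_all
  with assms show ?thesis by (simp add: differential_2 tuple_2_mem \<open>\<ominus>\<^bsub>M\<^esub> \<zero>\<^bsub>M\<^esub> = \<zero>\<^bsub>M\<^esub>\<close>)
qed

text \<open>The translation \<open>\<eta>\<close> to \<open>\<eta> + \<omega>\<close>, with inverse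
  \<open>\<eta>\<close> to \<open>\<eta> - \<omega>\<close>, matches the elements of the two cosets;
  each direction gives one inclusion.\<close>

lemma cohomology_class_add_coboundary:
  assumes \<omega>: "\<omega> \<in> alt_forms R M 2" and J: "J \<in> tuples M 3 \<rightarrow> carrier M"
  shows "cohomology_class R M 3 (J \<oplus>\<^bsub>form_space R M 3\<^esub> differential M 2 \<omega>) = cohomology_class R M 3 J"
    (is "cohomology_class R M 3 ?J' = _")
proof -
  let ?F = "form_space R M 3" and ?d = "differential M 2"
  have Jc: "J [a, b, c] \<in> carrier M" if "a \<in> carrier M" "b \<in> carrier M" "c \<in> carrier M" for a b c
    using that J by (simp add: Pi_iff tuple_3_mem)
  have "?d \<eta> \<oplus>\<^bsub>?F\<^esub> ?J' \<in> cohomology_class R M 3 J"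
    if \<eta>: "\<eta> \<in> alt_forms R M 2" for \<eta>
  proof -
    have "?d \<eta> \<oplus>\<^bsub>?F\<^esub> ?J'
      = ?d (\<lambda>xs \<in> tuples M 2. \<eta> xs \<oplus>\<^bsub>M\<^esub> \<omega> xs) \<oplus>\<^bsub>?F\<^esub> J"
      by (rule form_3_eqI[where V = M]) (simp_all add: differential_2_add[OF \<eta> \<omega>] differential_2_closed[OF \<eta>]
          differential_2_closed[OF \<omega>] Jc M.a_ac)
    then show ?thesis
      unfolding cohomology_class_alt using alt_forms_2_add_minus(1)[OF \<eta> \<omega>] by (rule image_eqI)
  qed
  moreover have "?d \<eta> \<oplus>\<^bsub>?F\<^esub> J \<in> cohomology_class R M 3 ?J'"
    if \<eta>: "\<eta> \<in> alt_forms R M 2" for \<eta>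
  proof -
    let ?m = "\<lambda>xs \<in> tuples M 2. \<ominus>\<^bsub>M\<^esub> \<omega> xs"
    note \<omega>' = alt_forms_2_add_minus(2)[OF \<omega> \<omega>]
    have cancel: "x \<oplus>\<^bsub>M\<^esub> z = x \<oplus>\<^bsub>M\<^esub> \<ominus>\<^bsub>M\<^esub> y \<oplus>\<^bsub>M\<^esub> (z \<oplus>\<^bsub>M\<^esub> y)"
      if "x \<in> carrier M" "y \<in> carrier M" "z \<in> carrier M" for x y z
      using that by (simp add: M.a_assoc M.a_comm[of z y] M.r_neg1)
    have "?d \<eta> \<oplus>\<^bsub>?F\<^esub> J
      = ?d (\<lambda>xs \<in> tuples M 2. \<eta> xs \<oplus>\<^bsub>M\<^esub> ?m xs) \<oplus>\<^bsub>?F\<^esub> ?J'"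
    proof (rule form_3_eqI[where V = M])
      fix a b c assume abc: "a \<in> carrier M" "b \<in> carrier M" "c \<in> carrier M"
      show "(?d \<eta> \<oplus>\<^bsub>?F\<^esub> J) [a, b, c]
        = (?d (\<lambda>xs \<in> tuples M 2. \<eta> xs \<oplus>\<^bsub>M\<^esub> ?m xs) \<oplus>\<^bsub>?F\<^esub> ?J') [a, b, c]"
        unfolding form_space_3_simps(2)[OF abc] differential_2_add[OF \<eta> \<omega>' abc]
          differential_2_minus[OF \<omega> abc]
        by (intro cancel differential_2_closed[OF \<eta> abc] differential_2_closed[OF \<omega> abc] Jc abc)
    qed simp_all
    then show ?thesis
      unfolding cohomology_class_alt using alt_forms_2_add_minus(1)[OF \<eta> \<omega>'] by (rule image_eqI)
  qed
  ultimately show ?thesis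
    by (intro subset_antisym) (auto simp: cohomology_class_alt[of R M ?J'] cohomology_class_alt[of R M J])
qed

text \<open>The zero of \<open>cohomology\<close> is by definition the set of coboundaries; this
  identifies it with the class of the zero form.\<close>

lemma cohomology_class_zero: "cohomology_class R M 3 \<zero>\<^bsub>form_space R M 3\<^esub> = coboundaries R M 3"
proof -
  let ?F = "form_space R M 3" and ?d = "differential M 2"
  have "?d \<omega> \<oplus>\<^bsub>?F\<^esub> \<zero>\<^bsub>?F\<^esub> = ?d \<omega>"
    if \<omega>: "\<omega> \<in> alt_forms R M 2" for \<omega>
  proof (rule extensionalityI[OF _ differential_2_extensional])
    fix xs assume "xs \<in> tuples M 3"
    then show "(?d \<omega> \<oplus>\<^bsub>?F\<^esub> \<zero>\<^bsub>?F\<^esub>) xs = ?d \<omega> xs"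
      by (auto simp: form_space_def tuples_3 differential_2_closed[OF \<omega>])
  qed (simp add: form_space_def)
  then show ?thesis by (simp add: cohomology_class_alt coboundaries_3)
qed

text \<open>The zero 2-form is the witness. Applied to a class that is zero, the lemma yields a
  2-form whose differential is \<open>J\<close>. Sums of forms are extensional, so \<open>J\<close>
  has to be extensional too.\<close>

lemma mem_cohomology_class:
  assumes J: "J \<in> tuples M 3 \<rightarrow>\<^sub>E carrier M"
  shows "J \<in> cohomology_class R M 3 J"
proof -
  have "J = differential M 2 (\<lambda>xs \<in> tuples M 2. \<zero>\<^bsub>M\<^esub>) \<oplus>\<^bsub>form_space R M 3\<^esub> J"
  proof (rule extensionalityI)
    show "J \<in> extensional (tuples M 3)" using J by (simp add: PiE_def)
    fix xs assume xs: "xs \<in> tuples M 3"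
    then obtain a b c where "a \<in> carrier M" "b \<in> carrier M" "c \<in> carrier M" "xs = [a, b, c]"
      by (auto simp: tuples_3)
    then show "J xs = (differential M 2 (\<lambda>xs \<in> tuples M 2. \<zero>\<^bsub>M\<^esub>) \<oplus>\<^bsub>form_space R M 3\<^esub> J) xs"
      using xs PiE_mem[OF J xs] by (simp add: form_space_def differential_2_zero)
  qed (simp add: form_space_def)
  then show ?thesis
    unfolding cohomology_class_alt using alt_forms_2_zero by (intro image_eqI)
qed

end

section \<open>Removing the obstruction\<close>

text \<open>Module notions do not look at the bracket field, hence survive its replacement.\<close>

lemma bracket_update_simps [simp]:
  "module R (M\<lparr>bracket := f\<rparr>) = module R M"
  "a_inv (M\<lparr>bracket := f\<rparr>) = a_inv M"
  "finsum (M\<lparr>bracket := f\<rparr>) g A = finsum M g A"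
  "basis R (M\<lparr>bracket := f\<rparr>) E = basis R M E"
  by (simp_all add: module_def module_axioms_def abelian_group_def abelian_group_axioms_def
      abelian_monoid_def a_inv_def finsum_def finprod_def basis_def fun_eq_iff)

context infinitesimal_lift
begin

definition corrected :: "('v list \<Rightarrow> 'v) \<Rightarrow> ('a, 'b, 'n) bracket_module_scheme" where
  "corrected \<eta> = B\<lparr>bracket := \<lambda>x y. bracket B x y \<oplus>\<^bsub>B\<^esub> \<iota> (\<eta> [red x, red y])\<rparr>"

lemma corrected_simps [simp]:
  "carrier (corrected \<eta>) = carrier B" "add (corrected \<eta>) = add B" "ring.zero (corrected \<eta>) = ring.zero B"
  "smult (corrected \<eta>) = smult B"
  "bracket (corrected \<eta>) x y = bracket B x y \<oplus>\<^bsub>B\<^esub> \<iota> (\<eta> [red x, red y])"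
  by (simp_all add: corrected_def fun_eq_iff)

text \<open>The added term is bilinear and alternating because \<open>\<eta>\<close> is, and
  \<open>red\<close> kills it, so the new bracket still induces the bracket of
  \<open>V\<close>.\<close>

lemma corrected_pre_lift:
  assumes \<eta>: "\<eta> \<in> alt_forms R V 2"
  shows "pre_lift R (corrected \<eta>) V red p q"
proof -
  note D = alt_forms_2D[OF \<eta>]
  have m: "module R (corrected \<eta>)"
    by (simp add: corrected_def B.module_axioms)
  have "alternating_bracket R (corrected \<eta>)"
    by (intro alternating_bracket.intro m alternating_bracket_axioms.intro)
      (simp_all add: D(2-) red_add red_smult iota_add iota_smult B.bracket_add_left B.bracket_add_right
        B.bracket_smult_left B.bracket_smult_right B.smult_r_distr B.bracket_alternating B.M.a_ac)
  moreover have "linear_map R (corrected \<eta>) V red"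
    by (rule linear_mapI) (simp_all add: red_add red_smult)
  ultimately show ?thesis
    using p q surj smult_q_eq_0_iff kernel p_null q_null
    by (intro pre_lift.intro pre_lift_axioms.intro V.alternating_bracket_axioms)
      (simp_all add: red_add hom_bracket D(2))
qed

text \<open>Seen from the new bracket, the old one is a twist by \<open>- \<eta>\<close>. So
  \<open>jacobiator_twist\<close> with \<open>\<phi> = id\<close> subtracts the differential of
  \<open>\<eta>\<close>, which is the obstruction itself.\<close>

lemma corrected_jacobiator:
  assumes \<eta>: "\<eta> \<in> alt_forms R V 2" and ob: "obstruction = differential V 2 \<eta>"
    and x: "x \<in> carrier B" "y \<in> carrier B" "z \<in> carrier B"
  shows "jacobiator (corrected \<eta>) x y z = \<zero>\<^bsub>B\<^esub>"
proof -
  note D = alt_forms_2D[OF \<eta>]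
  interpret C: pre_lift R "corrected \<eta>" V red p q by (rule corrected_pre_lift[OF \<eta>])
  \<comment> \<open>The embedding formed with the corrected record is a different term, but it too
    multiplies an element over \<open>v\<close> by \<open>q\<close>.\<close>
  have iota: "C.\<iota> v = \<iota> v" if "v \<in> carrier V" for v
    using that by (auto elim!: obtain_lift)
  let ?\<omega> = "\<lambda>xs \<in> tuples V 2. \<ominus>\<^bsub>V\<^esub> \<eta> xs"
  have \<omega>: "?\<omega> \<in> alt_forms R V 2" by (rule V.alt_forms_2_add_minus(2)[OF \<eta> \<eta>])
  have twist: "id (bracket B x y) = bracket (corrected \<eta>) (id x) (id y) \<oplus>\<^bsub>corrected \<eta>\<^esub> C.\<iota> (?\<omega> [red x, red y])"
    if "x \<in> carrier B" "y \<in> carrier B" for x y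
    using that by (simp add: tuple_2_mem iota D(2) iota_minus B.M.a_assoc B.M.r_neg)
  have "linear_map R B (corrected \<eta>) id" by (rule linear_mapI) simp_all
  from jacobiator_twist[OF pre_lift_axioms C.pre_lift_axioms this _ \<omega> twist x]
  have "jacobiator (corrected \<eta>) x y z
      = jacobiator B x y z \<oplus>\<^bsub>B\<^esub> C.\<iota> (differential V 2 ?\<omega> [red x, red y, red z])"
    by (simp add: restrict_def)
  also have "\<dots> = jacobiator B x y z \<oplus>\<^bsub>B\<^esub> \<ominus>\<^bsub>B\<^esub> \<iota> (obstruction [red x, red y, red z])"
    using x by (simp add: V.differential_2_minus[OF \<eta>] iota V.differential_2_closed[OF \<eta>] ob iota_minus)
  also have "\<dots> = \<zero>\<^bsub>B\<^esub>"
    using x by (simp add: obstruction_red B.M.r_neg)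
  finally show ?thesis .
qed

end

section \<open>Restriction of scalars\<close>

text \<open>Used along \<open>R \<rightarrow> R/\<pi>\<^sup>j\<close> for the forms and along
  \<open>R/\<pi>\<^sup>k\<^sup>+\<^sup>1 \<rightarrow> R/\<pi>\<^sup>k\<close> for maps defined on a
  basis of a lift.\<close>

definition restrict_scalars ::
    "('r \<Rightarrow> 's) \<Rightarrow> ('s, 'b, 'n) bracket_module_scheme \<Rightarrow> ('r, 'b) bracket_module" where
  "restrict_scalars \<rho> M =
     \<lparr>carrier = carrier M, monoid.mult = undefined, one = undefined, ring.zero = ring.zero M,
      ring.add = ring.add M, smult = (\<lambda>r. smult M (\<rho> r)), bracket = bracket M\<rparr>"

lemma restrict_scalars_simps [simp]:
  "carrier (restrict_scalars \<rho> M) = carrier M"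
  "ring.zero (restrict_scalars \<rho> M) = ring.zero M"
  "ring.add (restrict_scalars \<rho> M) = ring.add M"
  "smult (restrict_scalars \<rho> M) r = smult M (\<rho> r)"
  "bracket (restrict_scalars \<rho> M) = bracket M"
  "finsum (restrict_scalars \<rho> M) f A = finsum M f A"
  "a_inv (restrict_scalars \<rho> M) x = a_inv M x"
  "add_pow (restrict_scalars \<rho> M) (i :: int) x = add_pow M i x"
  "jacobiator (restrict_scalars \<rho> M) = jacobiator M"
  "tuples (restrict_scalars \<rho> M) s = tuples M s"
  by (simp_all add: restrict_scalars_def finsum_def finprod_def a_inv_def m_inv_def add_pow_def
      jacobiator_def tuples_def fun_eq_iff int_pow_def nat_pow_def
      Let_def)


lemma module_restrict_scalars:
  assumes M: "module S M" and R: "cring R" and \<rho>: "\<rho> \<in> ring_hom R S"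
  shows "module R (restrict_scalars \<rho> M)"
proof -
  interpret M: module S M by (rule M)
  interpret R: cring R by (rule R)
  note h = ring_hom_memE[OF \<rho>]
  show ?thesis
  proof (rule moduleI[OF R])
    show "abelian_group (restrict_scalars \<rho> M)"
    proof (rule abelian_groupI)
      fix x assume "x \<in> carrier (restrict_scalars \<rho> M)"
      then show "\<exists>y \<in> carrier (restrict_scalars \<rho> M).
          y \<oplus>\<^bsub>restrict_scalars \<rho> M\<^esub> x = \<zero>\<^bsub>restrict_scalars \<rho> M\<^esub>"
        by (intro bexI[of _ "\<ominus>\<^bsub>M\<^esub> x"]) (simp_all add: M.M.l_neg)
    qed (simp_all add: M.M.a_ac)
  qed (simp_all add: h M.smult_l_distr M.smult_r_distr M.smult_assoc1)
qed

lemma alternating_bracket_restrict_scalars: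
  assumes M: "alternating_bracket S M" and R: "cring R" and \<rho>: "\<rho> \<in> ring_hom R S"
  shows "alternating_bracket R (restrict_scalars \<rho> M)"
proof -
  interpret M: alternating_bracket S M by (rule M)
  show ?thesis
    by (intro alternating_bracket.intro module_restrict_scalars[OF M.module_axioms R \<rho>]
        alternating_bracket_axioms.intro)
      (simp_all add: M.bracket_add_left M.bracket_add_right M.bracket_smult_left
        M.bracket_smult_right M.bracket_alternating ring_hom_memE(1)[OF \<rho>])
qed

text \<open>Every scalar of \<open>S\<close> comes from \<open>R\<close>, so laws over
  \<open>R\<close> are laws over \<open>S\<close>. This carries the corrected bracket, constructed
  over \<open>R\<close>, back to the truncation.\<close>

lemma alternating_bracket_of_restrict_scalars:
  assumes M: "module S M" and R: "alternating_bracket R (restrict_scalars \<rho> M)"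
    and surj: "carrier S = \<rho> ` carrier R"
  shows "alternating_bracket S M"
proof -
  interpret R: alternating_bracket R "restrict_scalars \<rho> M" by (rule R)
  show ?thesis
    by (intro alternating_bracket.intro M alternating_bracket_axioms.intro)
      (auto simp: surj R.bracket_closed[simplified] R.bracket_add_left[simplified]
        R.bracket_add_right[simplified] R.bracket_smult_left[simplified]
        R.bracket_smult_right[simplified] R.bracket_alternating[simplified])
qed

lemma bracket_algebra_iff:
  "bracket_algebra S M \<longleftrightarrow> alternating_bracket S M \<and> (\<exists>n. free_of_rank S M n)"
  unfolding bracket_algebra_def alternating_bracket_def bracket_algebra_axioms_def
    alternating_bracket_axioms_def
  by (rule iffI; elim conjE; intro conjI; assumption)

lemma linear_map_restrict_scalars:
  assumes "linear_map S M N f" "\<rho> \<in> ring_hom R S"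
  shows "linear_map R (restrict_scalars \<rho> M) (restrict_scalars \<rho> N) f"
  using assms by (auto simp: linear_map_def dest: ring_hom_memE(1))

lemma alt_forms_restrict_scalars:
  assumes "carrier K = \<rho> ` carrier R"
  shows "alt_forms R (restrict_scalars \<rho> V) s = alt_forms K V s"
  unfolding alt_forms_def assms by simp

lemma differential_restrict_scalars [simp]:
  "differential (restrict_scalars \<rho> V) s = differential V s"
  by (simp add: differential_def fun_eq_iff)

lemma form_space_restrict_scalars:
  "ring.zero (form_space R (restrict_scalars \<rho> V) s) = ring.zero (form_space K V s)"
  "ring.add (form_space R (restrict_scalars \<rho> V) s) = ring.add (form_space K V s)"
  by (simp_all add: form_space_def)

text \<open>Scalars occur only in the homogeneity condition on forms, where by surjectivity of
  \<open>\<rho>\<close> those of \<open>R\<close> and of \<open>K\<close> act alike; the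
  differential does not mention them.\<close>

lemma cohomology_restrict_scalars:
  assumes K: "carrier K = \<rho> ` carrier R"
  shows "cocycles R (restrict_scalars \<rho> V) s = cocycles K V s"
    and "coboundaries R (restrict_scalars \<rho> V) s = coboundaries K V s"
    and "cohomology_class R (restrict_scalars \<rho> V) s J = cohomology_class K V s J"
proof -
  note * = alt_forms_restrict_scalars[OF K] form_space_restrict_scalars[of R \<rho> V _ K]
  show "cocycles R (restrict_scalars \<rho> V) s = cocycles K V s"
    by (simp add: cocycles_def *)
  show **: "coboundaries R (restrict_scalars \<rho> V) s = coboundaries K V s"
    by (cases s) (simp_all add: coboundaries_def *)
  show "cohomology_class R (restrict_scalars \<rho> V) s J = cohomology_class K V s J"
    by (simp add: cohomology_class_def ** a_r_coset_def' *)
qed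

section \<open>Truncations of a discrete valuation ring\<close>

locale truncations =
  fixes R :: "('r, 'm) ring_scheme" and \<pi> :: 'r
  assumes dvr: "discrete_valuation_ring R" and unif: "uniformizer R \<pi>"
begin

sublocale principal_domain R
  using dvr by (simp add: discrete_valuation_ring_def)

abbreviation "T \<equiv> trunc R \<pi>"
abbreviation "S \<equiv> trunc_ring R \<pi>"

lemma pi_closed [simp]: "\<pi> \<in> carrier R"
  using unif by (simp add: uniformizer_def)

text \<open>Otherwise the zero ideal would be maximal and \<open>R\<close> a field.\<close>

lemma pi_nonzero: "\<pi> \<noteq> \<zero>\<^bsub>R\<^esub>"
proof
  assume "\<pi> = \<zero>\<^bsub>R\<^esub>"
  then have "PIdl\<^bsub>R\<^esub> \<pi> = {\<zero>\<^bsub>R\<^esub>}" by (auto simp: cgenideal_def intro!: exI[of _ "\<zero>\<^bsub>R\<^esub>"])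
  then have "maximalideal {\<zero>\<^bsub>R\<^esub>} R" using unif by (simp add: uniformizer_def)
  then have "field R" by (simp add: zeromaximalideal_eq_field)
  then show False using dvr by (simp add: discrete_valuation_ring_def)
qed

lemma pow_nonzero: "\<pi> [^]\<^bsub>R\<^esub> (j::nat) \<noteq> \<zero>\<^bsub>R\<^esub>"
  by (induct j) (simp_all add: integral_iff pi_nonzero)

lemma ideal_pow: "ideal (PIdl\<^bsub>R\<^esub> (\<pi> [^]\<^bsub>R\<^esub> (j::nat))) R"
  by (rule cgenideal_ideal) simp

lemma T_hom: "T j \<in> ring_hom R (S j)"
  unfolding trunc_ring_def trunc_def[abs_def] by (rule ideal.rcos_ring_hom[OF ideal_pow])

lemma S_cring: "cring (S j)"
  unfolding trunc_ring_def by (rule ideal.quotient_is_cring[OF ideal_pow is_cring])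

lemma S_carrier: "carrier (S j) = T j ` carrier R"
  unfolding trunc_ring_def trunc_def[abs_def]
  by (auto simp: FactRing_def A_RCOSETS_def')

lemmas T_closed [simp] = ring_hom_memE(1)[OF T_hom]
lemmas T_mult = ring_hom_memE(2)[OF T_hom]
lemmas T_add = ring_hom_memE(3)[OF T_hom]
lemmas T_one [simp] = ring_hom_memE(4)[OF T_hom]

lemma T_zero [simp]: "T j \<zero>\<^bsub>R\<^esub> = \<zero>\<^bsub>S j\<^esub>"
  using ring_hom_zero[OF T_hom ring_axioms] S_cring by (simp add: cring_def)

lemma T_eq_iff:
  assumes "r \<in> carrier R" "s \<in> carrier R"
  shows "T j r = T j s \<longleftrightarrow> (\<exists>a \<in> carrier R. r \<ominus>\<^bsub>R\<^esub> s = \<pi> [^]\<^bsub>R\<^esub> j \<otimes>\<^bsub>R\<^esub> a)"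
proof -
  have "T j r = T j s \<longleftrightarrow> r \<ominus>\<^bsub>R\<^esub> s \<in> PIdl\<^bsub>R\<^esub> (\<pi> [^]\<^bsub>R\<^esub> j)"
    using quotient_eq_iff_same_a_r_cos[OF ideal_pow assms, of j] by (simp add: trunc_def)
  also have "\<dots> \<longleftrightarrow> (\<exists>a \<in> carrier R. r \<ominus>\<^bsub>R\<^esub> s = \<pi> [^]\<^bsub>R\<^esub> j \<otimes>\<^bsub>R\<^esub> a)"
    by (auto simp: cgenideal_def m_comm)
  finally show ?thesis .
qed

lemma T_eq_zero_iff:
  assumes "r \<in> carrier R"
  shows "T j r = \<zero>\<^bsub>S j\<^esub> \<longleftrightarrow> (\<exists>a \<in> carrier R. r = \<pi> [^]\<^bsub>R\<^esub> j \<otimes>\<^bsub>R\<^esub> a)"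
  using T_eq_iff[OF assms zero_closed, of j] assms by (simp add: minus_eq)

lemma T_pow_zero [simp]: "T j (\<pi> [^]\<^bsub>R\<^esub> j) = \<zero>\<^bsub>S j\<^esub>"
  by (subst T_eq_zero_iff) (auto intro!: bexI[of _ "\<one>\<^bsub>R\<^esub>"])

lemma pow_cancel:
  assumes "a \<in> carrier R" "b \<in> carrier R" "i \<le> j"
    and "\<pi> [^]\<^bsub>R\<^esub> (i::nat) \<otimes>\<^bsub>R\<^esub> a = \<pi> [^]\<^bsub>R\<^esub> j \<otimes>\<^bsub>R\<^esub> b"
  shows "a = \<pi> [^]\<^bsub>R\<^esub> (j - i) \<otimes>\<^bsub>R\<^esub> b"
proof -
  have "\<pi> [^]\<^bsub>R\<^esub> i \<otimes>\<^bsub>R\<^esub> a = \<pi> [^]\<^bsub>R\<^esub> i \<otimes>\<^bsub>R\<^esub> (\<pi> [^]\<^bsub>R\<^esub> (j - i) \<otimes>\<^bsub>R\<^esub> b)"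
    using assms by (simp add: m_assoc[symmetric] nat_pow_mult)
  then show ?thesis
    using assms pow_nonzero[of i] by (simp add: m_lcancel)
qed

text \<open>Makes the residue field the truncation of level 1, so that it falls under the facts
  about \<open>T j\<close> and \<open>S j\<close>.\<close>

lemma residue_field_eq: "residue_field R \<pi> = S 1"
  by (simp add: residue_field_def trunc_ring_def)

lemma S_1_field: "field (S 1)"
proof -
  have "maximalideal (PIdl\<^bsub>R\<^esub> \<pi>) R" using unif by (simp add: uniformizer_def)
  then show ?thesis
    using maximalideal.quotient_is_field[OF _ is_cring] by (simp add: trunc_ring_def)
qed

abbreviation res :: "nat \<Rightarrow> ('r set, 'b, 'n) bracket_module_scheme \<Rightarrow> ('r, 'b) bracket_module" where
  "res j \<equiv> restrict_scalars (T j)"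

lemma module_res: "module (S j) M \<Longrightarrow> module R (res j M)"
  by (rule module_restrict_scalars[OF _ is_cring T_hom])

lemma basis_expansion_R:
  assumes M: "module (S j) M" and E: "basis (S j) M E" and v: "v \<in> carrier M"
  obtains r where "r \<in> E \<rightarrow> carrier R" "v = (\<Oplus>\<^bsub>M\<^esub> e \<in> E. T j (r e) \<odot>\<^bsub>M\<^esub> e)"
proof -
  interpret M: module "S j" M by (rule M)
  obtain c where c: "c \<in> E \<rightarrow> carrier (S j)" "v = (\<Oplus>\<^bsub>M\<^esub> e \<in> E. c e \<odot>\<^bsub>M\<^esub> e)"
    using basis_expansion[OF E v] .
  then have "\<forall>e \<in> E. \<exists>r. r \<in> carrier R \<and> c e = T j r" by (auto simp: S_carrier)
  then obtain r where r: "\<forall>e \<in> E. r e \<in> carrier R \<and> c e = T j (r e)" by (rule bchoice[THEN exE])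
  have "v = (\<Oplus>\<^bsub>M\<^esub> e \<in> E. T j (r e) \<odot>\<^bsub>M\<^esub> e)"
    unfolding c(2) by (rule M.M.finsum_cong') (use r E in \<open>auto simp: basis_def\<close>)
  with r show ?thesis by (intro that[of r]) auto
qed

lemma basis_independent_R:
  assumes M: "module (S j) M" and E: "basis (S j) M E" and r: "r \<in> E \<rightarrow> carrier R"
    and 0: "(\<Oplus>\<^bsub>M\<^esub> e \<in> E. T j (r e) \<odot>\<^bsub>M\<^esub> e) = \<zero>\<^bsub>M\<^esub>" and e: "e \<in> E"
  obtains a where "a \<in> carrier R" "r e = \<pi> [^]\<^bsub>R\<^esub> j \<otimes>\<^bsub>R\<^esub> a"
proof -
  interpret M: module "S j" M by (rule M)
  have "(\<Oplus>\<^bsub>M\<^esub> e \<in> E. \<zero>\<^bsub>S j\<^esub> \<odot>\<^bsub>M\<^esub> e) = (\<Oplus>\<^bsub>M\<^esub> e \<in> E. \<zero>\<^bsub>M\<^esub>)"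
    by (rule M.M.finsum_cong') (use E in \<open>auto simp: basis_def\<close>)
  then have "T j (r e) = \<zero>\<^bsub>S j\<^esub>"
    using r 0 by (intro basis_unique[OF M E _ _ _ e]) (auto simp: Pi_iff)
  then show ?thesis using that r e by (auto simp: T_eq_zero_iff Pi_iff)
qed

text \<open>Freeness reduces this to coordinates lifted to \<open>R\<close>. There
  \<open>\<pi>\<^sup>i\<close> times a coordinate is divisible by \<open>\<pi>\<^sup>j\<close>, and
  \<open>\<pi>\<^sup>i\<close> cancels because \<open>R\<close> is a domain.\<close>

lemma annihilator_pow:
  assumes M: "module (S j) M" and E: "basis (S j) M E" and v: "v \<in> carrier M"
    and i: "i \<le> j" and 0: "T j (\<pi> [^]\<^bsub>R\<^esub> i) \<odot>\<^bsub>M\<^esub> v = \<zero>\<^bsub>M\<^esub>"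
  obtains w where "w \<in> carrier M" "v = T j (\<pi> [^]\<^bsub>R\<^esub> (j - i)) \<odot>\<^bsub>M\<^esub> w"
proof -
  interpret M: module "S j" M by (rule M)
  from E have fin: "finite E" and sub: "\<And>e. e \<in> E \<Longrightarrow> e \<in> carrier M" by (auto simp: basis_def)
  obtain r where r: "r \<in> E \<rightarrow> carrier R" "v = (\<Oplus>\<^bsub>M\<^esub> e \<in> E. T j (r e) \<odot>\<^bsub>M\<^esub> e)"
    using basis_expansion_R[OF M E v] .
  note rc = Pi_mem[OF r(1)]
  have "(\<Oplus>\<^bsub>M\<^esub> e \<in> E. T j (\<pi> [^]\<^bsub>R\<^esub> i \<otimes>\<^bsub>R\<^esub> r e) \<odot>\<^bsub>M\<^esub> e)
      = (\<Oplus>\<^bsub>M\<^esub> e \<in> E. T j (\<pi> [^]\<^bsub>R\<^esub> i) \<odot>\<^bsub>M\<^esub> (T j (r e) \<odot>\<^bsub>M\<^esub> e))"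
    by (rule M.M.finsum_cong') (auto simp: rc sub T_mult M.smult_assoc1)
  also have "\<dots> = \<zero>\<^bsub>M\<^esub>"
    using 0 M.finsum_smult_ldistr[OF fin, of "T j (\<pi> [^]\<^bsub>R\<^esub> i)" "\<lambda>e. T j (r e) \<odot>\<^bsub>M\<^esub> e"] r(2)
    by (auto simp: rc sub)
  finally have sum: "(\<Oplus>\<^bsub>M\<^esub> e \<in> E. T j (\<pi> [^]\<^bsub>R\<^esub> i \<otimes>\<^bsub>R\<^esub> r e) \<odot>\<^bsub>M\<^esub> e) = \<zero>\<^bsub>M\<^esub>" .
  have "\<exists>a. a \<in> carrier R \<and> r e = \<pi> [^]\<^bsub>R\<^esub> (j - i) \<otimes>\<^bsub>R\<^esub> a" if e: "e \<in> E" for e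
  proof -
    obtain a where "a \<in> carrier R" "\<pi> [^]\<^bsub>R\<^esub> i \<otimes>\<^bsub>R\<^esub> r e = \<pi> [^]\<^bsub>R\<^esub> j \<otimes>\<^bsub>R\<^esub> a"
      by (rule basis_independent_R[OF M E _ sum e]) (auto simp: rc)
    then show ?thesis using pow_cancel[OF rc[OF e] _ i] by blast
  qed
  then have "\<forall>e \<in> E. \<exists>a. a \<in> carrier R \<and> r e = \<pi> [^]\<^bsub>R\<^esub> (j - i) \<otimes>\<^bsub>R\<^esub> a" by blast
  then obtain a where a': "\<forall>e \<in> E. a e \<in> carrier R \<and> r e = \<pi> [^]\<^bsub>R\<^esub> (j - i) \<otimes>\<^bsub>R\<^esub> a e"
    by (rule bchoice[THEN exE])
  then have a: "a e \<in> carrier R" "r e = \<pi> [^]\<^bsub>R\<^esub> (j - i) \<otimes>\<^bsub>R\<^esub> a e" if "e \<in> E" for e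
    using that by simp_all
  let ?w = "\<Oplus>\<^bsub>M\<^esub> e \<in> E. T j (a e) \<odot>\<^bsub>M\<^esub> e"
  have "v = (\<Oplus>\<^bsub>M\<^esub> e \<in> E. T j (\<pi> [^]\<^bsub>R\<^esub> (j - i)) \<odot>\<^bsub>M\<^esub> (T j (a e) \<odot>\<^bsub>M\<^esub> e))"
    unfolding r(2) by (rule M.M.finsum_cong') (auto simp: a sub T_mult M.smult_assoc1)
  also have "\<dots> = T j (\<pi> [^]\<^bsub>R\<^esub> (j - i)) \<odot>\<^bsub>M\<^esub> ?w"
    by (rule M.finsum_smult_ldistr[symmetric]) (auto simp: fin a sub)
  finally have "v = T j (\<pi> [^]\<^bsub>R\<^esub> (j - i)) \<odot>\<^bsub>M\<^esub> ?w" .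
  moreover have "?w \<in> carrier M" by (rule M.M.finsum_closed) (auto simp: a sub)
  ultimately show ?thesis using that by blast
qed

end

section \<open>The reduction to the residue field\<close>

locale truncated_algebra = truncations R \<pi> + L: alternating_bracket "trunc_ring R \<pi> k" L
  for R :: "('r, 'm) ring_scheme" and \<pi> :: 'r and k :: nat
    and L :: "('r set, 'l, 'n) bracket_module_scheme" +
  assumes k: "1 \<le> k"
begin

abbreviation "I \<equiv> pi_multiples R \<pi> k L"
abbreviation "Q \<equiv> reduction_map R \<pi> k L"
abbreviation "Lb \<equiv> reduction R \<pi> k L"

lemma I_iff: "x \<in> I \<longleftrightarrow> (\<exists>z \<in> carrier L. x = T k \<pi> \<odot>\<^bsub>L\<^esub> z)"
  by (auto simp: pi_multiples_def)

lemma I_abelian_subgroup: "abelian_subgroup I L"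
proof (rule abelian_subgroupI3[OF additive_subgroupI L.M.abelian_group_axioms],
    rule group.subgroupI[OF L.M.a_group], simp_all)
  show "I \<subseteq> carrier L" by (auto simp: I_iff)
  show "I \<noteq> {}" by (auto simp: pi_multiples_def)
next
  fix a assume "a \<in> I"
  then obtain x where x: "x \<in> carrier L" "a = T k \<pi> \<odot>\<^bsub>L\<^esub> x" by (auto simp: I_iff)
  then have "\<ominus>\<^bsub>L\<^esub> a = T k \<pi> \<odot>\<^bsub>L\<^esub> (\<ominus>\<^bsub>L\<^esub> x)" by (simp add: L.smult_r_minus)
  then show "inv\<^bsub>add_monoid L\<^esub> a \<in> I"
    using x by (auto simp: I_iff a_inv_def[symmetric])
next
  fix a b assume "a \<in> I" "b \<in> I"
  then obtain x y where "x \<in> carrier L" "a = T k \<pi> \<odot>\<^bsub>L\<^esub> x" "y \<in> carrier L" "b = T k \<pi> \<odot>\<^bsub>L\<^esub> y"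
    by (auto simp: I_iff)
  then show "a \<oplus>\<^bsub>L\<^esub> b \<in> I"
    by (auto simp: I_iff L.smult_r_distr[symmetric] intro!: bexI[of _ "x \<oplus>\<^bsub>L\<^esub> y"])
qed

lemma mem_Q:
  assumes "x \<in> carrier L"
  shows "y \<in> Q x \<longleftrightarrow> y \<in> carrier L \<and> Q y = Q x"
proof -
  interpret I: abelian_subgroup I L by (rule I_abelian_subgroup)
  show ?thesis
    unfolding reduction_map_def
    using assms by (metis I.a_elemrcos_carrier I.a_repr_independence' I.a_repr_independenceD)
qed

lemma Q_eq_iff:
  assumes "x \<in> carrier L" "y \<in> carrier L"
  shows "Q x = Q y \<longleftrightarrow> (\<exists>z \<in> carrier L. x = y \<oplus>\<^bsub>L\<^esub> T k \<pi> \<odot>\<^bsub>L\<^esub> z)"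
proof -
  interpret I: abelian_subgroup I L by (rule I_abelian_subgroup)
  have "Q x = Q y \<longleftrightarrow> x \<in> Q y" using assms by (simp add: mem_Q)
  also have "\<dots> \<longleftrightarrow> x \<oplus>\<^bsub>L\<^esub> \<ominus>\<^bsub>L\<^esub> y \<in> I"
    unfolding reduction_map_def using assms by (simp add: I.a_rcos_module)
  also have "\<dots> \<longleftrightarrow> (\<exists>z \<in> carrier L. x = y \<oplus>\<^bsub>L\<^esub> T k \<pi> \<odot>\<^bsub>L\<^esub> z)"
  proof -
    have "x \<oplus>\<^bsub>L\<^esub> \<ominus>\<^bsub>L\<^esub> y = u \<longleftrightarrow> x = y \<oplus>\<^bsub>L\<^esub> u" if "u \<in> carrier L" for u
      using that assms by (metis L.M.a_comm L.M.add.inv_solve_right' L.M.a_inv_closed L.M.minus_minus)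
    then show ?thesis by (auto simp: I_iff)
  qed
  finally show ?thesis .
qed

lemma Q_zero_iff:
  assumes "x \<in> carrier L"
  shows "Q x = Q \<zero>\<^bsub>L\<^esub> \<longleftrightarrow> (\<exists>z \<in> carrier L. x = T k \<pi> \<odot>\<^bsub>L\<^esub> z)"
  using assms by (auto simp: Q_eq_iff)

lemma Lb_carrier: "carrier Lb = Q ` carrier L"
  by (auto simp: reduction_def Let_def reduction_map_def A_RCOSETS_def')

lemma Lb_zero: "\<zero>\<^bsub>Lb\<^esub> = Q \<zero>\<^bsub>L\<^esub>"
proof -
  interpret I: abelian_subgroup I L by (rule I_abelian_subgroup)
  show ?thesis by (simp add: reduction_def Let_def reduction_map_def I.a_subset)
qed

lemma Q_add:
  assumes "x \<in> carrier L" "y \<in> carrier L"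
  shows "Q x \<oplus>\<^bsub>Lb\<^esub> Q y = Q (x \<oplus>\<^bsub>L\<^esub> y)"
proof -
  interpret I: abelian_subgroup I L by (rule I_abelian_subgroup)
  show ?thesis using assms by (simp add: reduction_def Let_def reduction_map_def I.a_rcos_sum)
qed

lemma mem_T_1:
  assumes "r \<in> carrier R"
  shows "s \<in> T 1 r \<longleftrightarrow> s \<in> carrier R \<and> T 1 s = T 1 r"
proof -
  interpret P: ideal "PIdl\<^bsub>R\<^esub> (\<pi> [^]\<^bsub>R\<^esub> (1::nat))" R by (rule ideal_pow)
  interpret P: abelian_subgroup "PIdl\<^bsub>R\<^esub> (\<pi> [^]\<^bsub>R\<^esub> (1::nat))" R
    by (rule abelian_subgroupI3[OF P.additive_subgroup_axioms abelian_group_axioms])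
  show ?thesis
    unfolding trunc_def
    using assms by (metis P.a_elemrcos_carrier P.a_repr_independence' P.a_repr_independenceD)
qed

text \<open>\<open>reduction\<close> takes the union over all representatives of both cosets. The
  point is that every pair of representatives yields the same coset, so the union is that
  coset.\<close>

lemma Q_smult:
  assumes r: "r \<in> carrier R" and x: "x \<in> carrier L"
  shows "T 1 r \<odot>\<^bsub>Lb\<^esub> Q x = Q (T k r \<odot>\<^bsub>L\<^esub> x)"
proof -
  have *: "Q (T k s \<odot>\<^bsub>L\<^esub> y) = Q (T k r \<odot>\<^bsub>L\<^esub> x)" if "s \<in> T 1 r" "y \<in> Q x" for s y
  proof -
    have s: "s \<in> carrier R" "T 1 s = T 1 r" using that r by (simp_all add: mem_T_1 del: One_nat_def)
    then obtain a where a: "a \<in> carrier R" "s \<ominus>\<^bsub>R\<^esub> r = \<pi> \<otimes>\<^bsub>R\<^esub> a"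
      using r by (auto simp: T_eq_iff)
    have "s = r \<oplus>\<^bsub>R\<^esub> (s \<ominus>\<^bsub>R\<^esub> r)"
      using r s by (simp add: minus_eq a_comm[of s "\<ominus>\<^bsub>R\<^esub> r"] r_neg2)
    then have s_eq: "s = r \<oplus>\<^bsub>R\<^esub> \<pi> \<otimes>\<^bsub>R\<^esub> a" using a(2) by simp
    have "y \<in> carrier L" "Q y = Q x" using that x by (simp_all add: mem_Q)
    then obtain z where z: "z \<in> carrier L" "y = x \<oplus>\<^bsub>L\<^esub> T k \<pi> \<odot>\<^bsub>L\<^esub> z"
      using x by (auto simp: Q_eq_iff)
    have "T k r \<odot>\<^bsub>L\<^esub> (T k \<pi> \<odot>\<^bsub>L\<^esub> z) = T k \<pi> \<odot>\<^bsub>L\<^esub> (T k r \<odot>\<^bsub>L\<^esub> z)"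
      using r z by (simp add: L.smult_assoc1[symmetric] L.R.m_comm)
    then have "T k r \<odot>\<^bsub>L\<^esub> y = T k r \<odot>\<^bsub>L\<^esub> x \<oplus>\<^bsub>L\<^esub> T k \<pi> \<odot>\<^bsub>L\<^esub> (T k r \<odot>\<^bsub>L\<^esub> z)"
      using r x z by (simp add: L.smult_r_distr)
    \<comment> \<open>With \<open>s = r + \<pi>a\<close> and \<open>y = x + \<pi>z\<close>, the
      difference of \<open>sy\<close> and \<open>rx\<close> is
      \<open>\<pi>(ay + rz)\<close>.\<close>
    then have "T k s \<odot>\<^bsub>L\<^esub> y = T k r \<odot>\<^bsub>L\<^esub> x \<oplus>\<^bsub>L\<^esub> T k \<pi> \<odot>\<^bsub>L\<^esub> (T k a \<odot>\<^bsub>L\<^esub> y \<oplus>\<^bsub>L\<^esub> T k r \<odot>\<^bsub>L\<^esub> z)"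
      using r x z(1) a(1) \<open>y \<in> carrier L\<close>
      by (simp add: s_eq T_add T_mult L.smult_l_distr L.smult_r_distr L.smult_assoc1 L.M.a_ac)
    then show ?thesis
      using r x z a s \<open>y \<in> carrier L\<close>
      by (subst Q_eq_iff) (auto intro!: bexI[of _ "T k a \<odot>\<^bsub>L\<^esub> y \<oplus>\<^bsub>L\<^esub> T k r \<odot>\<^bsub>L\<^esub> z"])
  qed
  have "r \<in> T 1 r" "x \<in> Q x" using r x by (simp_all add: mem_T_1 mem_Q del: One_nat_def)
  then have "(\<Union>s\<in>T 1 r. \<Union>y\<in>Q x. Q (T k s \<odot>\<^bsub>L\<^esub> y)) = Q (T k r \<odot>\<^bsub>L\<^esub> x)"
    using * by blast
  then show ?thesis by (simp add: reduction_def Let_def reduction_map_def)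
qed

text \<open>As for scalars, the union collapses to one coset, since \<open>\<pi>L\<close> is an
  ideal for the bracket.\<close>

lemma Q_bracket:
  assumes x: "x \<in> carrier L" and y: "y \<in> carrier L"
  shows "bracket Lb (Q x) (Q y) = Q (bracket L x y)"
proof -
  have *: "Q (bracket L x' y') = Q (bracket L x y)" if "x' \<in> Q x" "y' \<in> Q y" for x' y'
  proof -
    have "x' \<in> carrier L" "Q x' = Q x" "y' \<in> carrier L" "Q y' = Q y"
      using that x y by (simp_all add: mem_Q)
    then obtain z w where z: "z \<in> carrier L" "x' = x \<oplus>\<^bsub>L\<^esub> T k \<pi> \<odot>\<^bsub>L\<^esub> z"
      and w: "w \<in> carrier L" "y' = y \<oplus>\<^bsub>L\<^esub> T k \<pi> \<odot>\<^bsub>L\<^esub> w"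
      using x y by (auto simp: Q_eq_iff)
    \<comment> \<open>Changing the first argument and then the second gives \<open>[z, y']\<close>
      with the new \<open>y'\<close> but \<open>[x, w]\<close> with the old
      \<open>x\<close>.\<close>
    have "bracket L x' y' = bracket L x y \<oplus>\<^bsub>L\<^esub> T k \<pi> \<odot>\<^bsub>L\<^esub> (bracket L z y' \<oplus>\<^bsub>L\<^esub> bracket L x w)"
      using x y z w
      by (simp add: L.bracket_add_left L.bracket_add_right L.bracket_smult_left
          L.bracket_smult_right L.smult_r_distr L.M.a_ac)
    then show ?thesis
      using x y z w \<open>y' \<in> carrier L\<close> \<open>x' \<in> carrier L\<close>
      by (subst Q_eq_iff) (auto intro!: bexI[of _ "bracket L z y' \<oplus>\<^bsub>L\<^esub> bracket L x w"])
  qed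
  have "x \<in> Q x" "y \<in> Q y" using x y by (simp_all add: mem_Q)
  then have "(\<Union>x'\<in>Q x. \<Union>y'\<in>Q y. Q (bracket L x' y')) = Q (bracket L x y)"
    using * by blast
  then show ?thesis by (simp add: reduction_def Let_def reduction_map_def)
qed

lemma Lb_alternating_bracket: "alternating_bracket (S 1) Lb"
proof -
  have "abelian_group Lb"
    by (rule reduction_tensor(1)[OF is_cring pi_closed L.module_axioms])
  then have "module (S 1) Lb"
    by (rule moduleI[OF S_cring])
      (auto simp: S_carrier Lb_carrier Q_smult Q_add T_add[where j = 1, symmetric]
        T_mult[where j = 1, symmetric] T_one[of 1, symmetric] T_add[where j = k] T_mult[where j = k]
        L.smult_l_distr L.smult_r_distr L.smult_assoc1 T_one[of k] simp del: T_one One_nat_def)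
  then show ?thesis
    by (intro alternating_bracket.intro alternating_bracket_axioms.intro)
      (auto simp: S_carrier Lb_carrier Q_smult Q_add Q_bracket Lb_zero L.bracket_add_left
        L.bracket_add_right L.bracket_smult_left L.bracket_smult_right L.bracket_alternating simp del: One_nat_def)
qed

end

section \<open>Lifts of a truncated algebra\<close>

locale algebra_lift = truncated_algebra R \<pi> k L
  for R :: "('r, 'm) ring_scheme" and \<pi> :: 'r and k :: nat
    and L :: "('r set, 'l, 'n) bracket_module_scheme" +
  fixes B :: "('r set, 'b) bracket_module" and \<mu> :: "'b \<Rightarrow> 'l"
  assumes lift: "bracket_algebra_lift R \<pi> k L B \<mu>"
    and lie: "lie_algebra (trunc_ring R \<pi> k) L"
begin

sublocale B: alternating_bracket "trunc_ring R \<pi> (k + 1)" B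
  using lift by (simp add: bracket_algebra_lift_def bracket_algebra_iff)

lemma mu_add: "x \<in> carrier B \<Longrightarrow> y \<in> carrier B \<Longrightarrow> \<mu> (x \<oplus>\<^bsub>B\<^esub> y) = \<mu> x \<oplus>\<^bsub>L\<^esub> \<mu> y"
  and mu_smult: "r \<in> carrier R \<Longrightarrow> x \<in> carrier B \<Longrightarrow> \<mu> (T (k + 1) r \<odot>\<^bsub>B\<^esub> x) = T k r \<odot>\<^bsub>L\<^esub> \<mu> x"
  and mu_bracket: "x \<in> carrier B \<Longrightarrow> y \<in> carrier B \<Longrightarrow> \<mu> (bracket B x y) = bracket L (\<mu> x) (\<mu> y)"
  and mu_surj: "\<mu> ` carrier B = carrier L"
  using lift unfolding bracket_algebra_lift_def by blast+

lemma mu_closed [simp]: "x \<in> carrier B \<Longrightarrow> \<mu> x \<in> carrier L"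
  using mu_surj by blast

lemma obtain_bases:
  obtains E F where "basis (S k) L E" "basis (S (k + 1)) B F" "card E = card F"
  using lift unfolding bracket_algebra_lift_def free_of_rank_iff by metis

abbreviation "red \<equiv> lift_lambda R \<pi> k L \<mu>"

lemma red_def: "red x = Q (\<mu> x)"
  by (simp add: lift_lambda_def)

lemma mu_linear: "linear_map R (res (k + 1) B) (res k L) \<mu>"
  by (rule linear_mapI) (simp_all add: mu_add mu_smult del: One_nat_def)

lemma red_linear: "linear_map R (res (k + 1) B) (res 1 Lb) red"
  by (rule linear_mapI)
    (auto simp: red_def mu_add mu_smult Lb_carrier Q_add Q_smult simp del: One_nat_def)

lemma red_surj: "red ` carrier B = carrier Lb"
  by (simp add: red_def[abs_def] Lb_carrier mu_surj[symmetric] image_image)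

lemma red_smult:
  "r \<in> carrier R \<Longrightarrow> x \<in> carrier B \<Longrightarrow> red (T (k + 1) r \<odot>\<^bsub>B\<^esub> x) = T 1 r \<odot>\<^bsub>Lb\<^esub> red x"
  using linear_mapD(3)[OF red_linear, of r x] by (simp del: One_nat_def)

section \<open>The kernels of the maps from a lift to \<open>V\<close> and to
  \<open>L\<close>\<close>

text \<open>Since \<open>B\<close> and \<open>L\<close> have the same rank, the images in \<open>L/\<pi>L\<close> of a basis of \<open>B\<close> are linearly
  independent over the residue field.\<close>

lemma red_kernel:
  assumes x: "x \<in> carrier B" and x0: "red x = \<zero>\<^bsub>Lb\<^esub>"
  obtains b where "b \<in> carrier B" "x = T (k + 1) \<pi> \<odot>\<^bsub>B\<^esub> b"
proof -
  obtain E F where E: "basis (S k) L E" and F: "basis (S (k + 1)) B F" and EF: "card E = card F"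
    using obtain_bases .
  interpret V: alternating_bracket "S 1" Lb by (rule Lb_alternating_bracket)
  interpret K: field "S 1" by (rule S_1_field)
  note BR = module_res[OF B.module_axioms] and LR = module_res[OF L.module_axioms]
    and VR = module_res[OF V.module_axioms]
  from E have Efin: "finite E" and Ec: "\<And>e. e \<in> E \<Longrightarrow> e \<in> carrier L" by (auto simp: basis_def)
  from F have Ffin: "finite F" and Fc: "\<And>f. f \<in> F \<Longrightarrow> f \<in> carrier B" by (auto simp: basis_def)
  have redc: "red y \<in> carrier Lb" if "y \<in> carrier B" for y
    using that by (simp add: red_def Lb_carrier)
  have red_sum: "red (\<Oplus>\<^bsub>B\<^esub> f \<in> F. T (k + 1) (r f) \<odot>\<^bsub>B\<^esub> f) = (\<Oplus>\<^bsub>Lb\<^esub> f \<in> F. T 1 (r f) \<odot>\<^bsub>Lb\<^esub> red f)"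
    if r: "r \<in> F \<rightarrow> carrier R" for r
  proof -
    have "red (\<Oplus>\<^bsub>B\<^esub> f \<in> F. T (k + 1) (r f) \<odot>\<^bsub>B\<^esub> f)
        = (\<Oplus>\<^bsub>Lb\<^esub> f \<in> F. red (T (k + 1) (r f) \<odot>\<^bsub>B\<^esub> f))"
      using linear_map_finsum[OF BR VR red_linear Ffin, of "\<lambda>f. T (k + 1) (r f) \<odot>\<^bsub>B\<^esub> f"] r Fc
      by (simp add: Pi_iff del: One_nat_def)
    also have "\<dots> = (\<Oplus>\<^bsub>Lb\<^esub> f \<in> F. T 1 (r f) \<odot>\<^bsub>Lb\<^esub> red f)"
      by (rule V.M.finsum_cong')
        (use r Fc redc in \<open>auto simp: Pi_iff red_smult simp del: One_nat_def\<close>)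
    finally show ?thesis .
  qed
  obtain r where r: "r \<in> F \<rightarrow> carrier R" "x = (\<Oplus>\<^bsub>B\<^esub> f \<in> F. T (k + 1) (r f) \<odot>\<^bsub>B\<^esub> f)"
    using basis_expansion_R[OF B.module_axioms F x] .
  \<comment> \<open>If some \<open>r f\<close> were not divisible by \<open>\<pi>\<close>, the
    relation \<open>red x = 0\<close> would express \<open>red f\<close> by the other
    \<open>red g\<close>. Then \<open>V\<close> would be spanned by fewer vectors than
    \<open>E\<close> has, the images of \<open>E\<close> in \<open>V\<close> would be dependent, and
    this is excluded by the freeness of \<open>L\<close>.\<close>
  have "\<exists>a. a \<in> carrier R \<and> r f = \<pi> \<otimes>\<^bsub>R\<^esub> a" if f0: "f \<in> F" for f
  proof (rule ccontr)
    assume neg: "\<nexists>a. a \<in> carrier R \<and> r f = \<pi> \<otimes>\<^bsub>R\<^esub> a"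
    let ?I = "F - {f}" and ?c = "\<lambda>g. T 1 (r g)"
    have cc: "?c g \<in> carrier (S 1)" if "g \<in> F" for g
      using r that by (auto simp: Pi_iff simp del: One_nat_def)
    have c0: "?c f \<noteq> \<zero>\<^bsub>S 1\<^esub>"
      using neg r f0 by (auto simp: T_eq_zero_iff Pi_iff)
    define b where "b = inv\<^bsub>S 1\<^esub> (?c f)"
    have b: "b \<in> carrier (S 1)" "b \<otimes>\<^bsub>S 1\<^esub> ?c f = \<one>\<^bsub>S 1\<^esub>"
      using c0 cc[OF f0] K.field_Units by (auto simp: b_def simp del: One_nat_def)
    have split: "(\<Oplus>\<^bsub>Lb\<^esub> g \<in> F. d g \<odot>\<^bsub>Lb\<^esub> red g) = d f \<odot>\<^bsub>Lb\<^esub> red f \<oplus>\<^bsub>Lb\<^esub> (\<Oplus>\<^bsub>Lb\<^esub> g \<in> ?I. d g \<odot>\<^bsub>Lb\<^esub> red g)"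
      if "d \<in> F \<rightarrow> carrier (S 1)" for d
      using V.M.finsum_insert[of ?I f "\<lambda>g. d g \<odot>\<^bsub>Lb\<^esub> red g"] Ffin f0 that redc Fc
      by (auto simp: insert_absorb Pi_iff simp del: One_nat_def)
    let ?s = "\<Oplus>\<^bsub>Lb\<^esub> g \<in> ?I. ?c g \<odot>\<^bsub>Lb\<^esub> red g"
    have sc: "?s \<in> carrier Lb"
      by (rule V.M.finsum_closed) (use cc redc Fc in \<open>auto simp del: One_nat_def\<close>)
    have "?c f \<odot>\<^bsub>Lb\<^esub> red f \<oplus>\<^bsub>Lb\<^esub> ?s = \<zero>\<^bsub>Lb\<^esub>"
      using split[of ?c] red_sum[OF r(1)] x0 r(2) cc by (simp add: Pi_iff del: One_nat_def)
    then have "b \<odot>\<^bsub>Lb\<^esub> (?c f \<odot>\<^bsub>Lb\<^esub> red f \<oplus>\<^bsub>Lb\<^esub> ?s) = \<zero>\<^bsub>Lb\<^esub>"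
      using b(1) by (simp del: One_nat_def)
    then have "red f \<oplus>\<^bsub>Lb\<^esub> b \<odot>\<^bsub>Lb\<^esub> ?s = \<zero>\<^bsub>Lb\<^esub>"
      using b sc cc[OF f0] redc[OF Fc[OF f0]]
      by (simp add: V.smult_r_distr V.smult_assoc1[symmetric] del: One_nat_def)
    then have redf: "red f = (\<ominus>\<^bsub>S 1\<^esub> b) \<odot>\<^bsub>Lb\<^esub> ?s"
      using b(1) sc redc[OF Fc[OF f0]]
      by (simp add: V.smult_l_minus V.M.minus_equality[symmetric] V.M.a_comm del: One_nat_def)
    have span: "\<exists>a. a \<in> ?I \<rightarrow> carrier (S 1) \<and> v = (\<Oplus>\<^bsub>Lb\<^esub> g \<in> ?I. a g \<odot>\<^bsub>Lb\<^esub> red g)"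
      if v: "v \<in> carrier Lb" for v
    proof -
      obtain y where y: "y \<in> carrier B" "v = red y" using v red_surj by blast
      obtain t where t: "t \<in> F \<rightarrow> carrier R" "y = (\<Oplus>\<^bsub>B\<^esub> f \<in> F. T (k + 1) (t f) \<odot>\<^bsub>B\<^esub> f)"
        using basis_expansion_R[OF B.module_axioms F y(1)] .
      let ?d = "\<lambda>g. T 1 (t g)"
      have dc: "?d g \<in> carrier (S 1)" if "g \<in> F" for g
        using t that by (auto simp: Pi_iff simp del: One_nat_def)
      \<comment> \<open>Substituting \<open>redf\<close> for \<open>red f\<close> adds
        \<open>?m\<close> times \<open>?c g\<close> to the coefficient of each remaining
        \<open>red g\<close>.\<close>
      let ?m = "?d f \<otimes>\<^bsub>S 1\<^esub> (\<ominus>\<^bsub>S 1\<^esub> b)"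
      have mc: "?m \<in> carrier (S 1)" using dc f0 b by (simp del: One_nat_def)
      have "v = ?d f \<odot>\<^bsub>Lb\<^esub> red f \<oplus>\<^bsub>Lb\<^esub> (\<Oplus>\<^bsub>Lb\<^esub> g \<in> ?I. ?d g \<odot>\<^bsub>Lb\<^esub> red g)"
        using split[of ?d] red_sum[OF t(1)] y t(2) dc by (simp add: Pi_iff del: One_nat_def)
      also have "?d f \<odot>\<^bsub>Lb\<^esub> red f = ?m \<odot>\<^bsub>Lb\<^esub> ?s"
        using dc[OF f0] b sc by (simp add: redf V.smult_assoc1 del: One_nat_def)
      also have "\<dots> = (\<Oplus>\<^bsub>Lb\<^esub> g \<in> ?I. ?m \<odot>\<^bsub>Lb\<^esub> (?c g \<odot>\<^bsub>Lb\<^esub> red g))"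
        by (rule V.finsum_smult_ldistr)
          (use Ffin mc cc redc Fc in \<open>auto simp del: One_nat_def\<close>)
      also have "\<dots> \<oplus>\<^bsub>Lb\<^esub> (\<Oplus>\<^bsub>Lb\<^esub> g \<in> ?I. ?d g \<odot>\<^bsub>Lb\<^esub> red g)
          = (\<Oplus>\<^bsub>Lb\<^esub> g \<in> ?I. ?m \<odot>\<^bsub>Lb\<^esub> (?c g \<odot>\<^bsub>Lb\<^esub> red g) \<oplus>\<^bsub>Lb\<^esub> ?d g \<odot>\<^bsub>Lb\<^esub> red g)"
        by (rule V.M.finsum_addf[symmetric])
          (use mc cc dc redc Fc in \<open>auto simp del: One_nat_def\<close>)
      also have "\<dots> = (\<Oplus>\<^bsub>Lb\<^esub> g \<in> ?I. (?m \<otimes>\<^bsub>S 1\<^esub> ?c g \<oplus>\<^bsub>S 1\<^esub> ?d g) \<odot>\<^bsub>Lb\<^esub> red g)"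
      proof (rule V.M.finsum_cong')
        show "?m \<odot>\<^bsub>Lb\<^esub> (?c g \<odot>\<^bsub>Lb\<^esub> red g) \<oplus>\<^bsub>Lb\<^esub> ?d g \<odot>\<^bsub>Lb\<^esub> red g
            = (?m \<otimes>\<^bsub>S 1\<^esub> ?c g \<oplus>\<^bsub>S 1\<^esub> ?d g) \<odot>\<^bsub>Lb\<^esub> red g" if "g \<in> ?I" for g
          using that mc cc[of g] dc[of g] redc[OF Fc, of g]
          by (simp add: V.smult_l_distr V.smult_assoc1 del: One_nat_def)
      qed (use mc cc dc redc Fc in \<open>auto simp del: One_nat_def\<close>)
      finally show ?thesis
        using mc cc dc
        by (intro exI[of _ "\<lambda>g. ?m \<otimes>\<^bsub>S 1\<^esub> ?c g \<oplus>\<^bsub>S 1\<^esub> ?d g"] conjI) (auto simp del: One_nat_def)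
    qed
    have "\<forall>e \<in> E. \<exists>a. a \<in> ?I \<rightarrow> carrier (S 1) \<and> Q e = (\<Oplus>\<^bsub>Lb\<^esub> g \<in> ?I. a g \<odot>\<^bsub>Lb\<^esub> red g)"
      using span Ec by (auto simp: Lb_carrier)
    then obtain a where a: "\<forall>e \<in> E. a e \<in> ?I \<rightarrow> carrier (S 1) \<and> Q e = (\<Oplus>\<^bsub>Lb\<^esub> g \<in> ?I. a e g \<odot>\<^bsub>Lb\<^esub> red g)"
      by (rule bchoice[THEN exE])
    \<comment> \<open>The equality of the ranks of \<open>B\<close> and \<open>L\<close> is used
      here.\<close>
    have "card ?I < card E"
      using EF card_Diff1_less[OF Ffin f0] by simp
    then have "\<exists>z \<in> E \<rightarrow> carrier (S 1). (\<exists>e \<in> E. z e \<noteq> \<zero>\<^bsub>S 1\<^esub>) \<and> (\<Oplus>\<^bsub>Lb\<^esub> e \<in> E. z e \<odot>\<^bsub>Lb\<^esub> Q e) = \<zero>\<^bsub>Lb\<^esub>"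
      by (intro V.exists_dependence[OF S_1_field, of ?I E red a]) (use Ffin Efin redc Fc a in auto)
    then obtain z e0 where z: "z \<in> E \<rightarrow> carrier (S 1)" "e0 \<in> E" "z e0 \<noteq> \<zero>\<^bsub>S 1\<^esub>"
      "(\<Oplus>\<^bsub>Lb\<^esub> e \<in> E. z e \<odot>\<^bsub>Lb\<^esub> Q e) = \<zero>\<^bsub>Lb\<^esub>" by blast
    have "\<forall>e \<in> E. \<exists>s. s \<in> carrier R \<and> z e = T 1 s" using z(1) by (auto simp: S_carrier simp del: One_nat_def)
    then obtain s where s: "\<forall>e \<in> E. s e \<in> carrier R \<and> z e = T 1 (s e)" by (rule bchoice[THEN exE])
    let ?w = "\<Oplus>\<^bsub>L\<^esub> e \<in> E. T k (s e) \<odot>\<^bsub>L\<^esub> e"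
    have wc: "?w \<in> carrier L" by (rule L.M.finsum_closed) (use s Ec in auto)
    have Qlin: "linear_map R (res k L) (res 1 Lb) Q"
      by (rule linear_mapI) (auto simp: Lb_carrier Q_add Q_smult simp del: One_nat_def)
    have "Q ?w = (\<Oplus>\<^bsub>Lb\<^esub> e \<in> E. Q (T k (s e) \<odot>\<^bsub>L\<^esub> e))"
      using linear_map_finsum[OF LR VR Qlin Efin, of "\<lambda>e. T k (s e) \<odot>\<^bsub>L\<^esub> e"] s Ec
      by (simp add: Pi_iff del: One_nat_def)
    also have "\<dots> = (\<Oplus>\<^bsub>Lb\<^esub> e \<in> E. z e \<odot>\<^bsub>Lb\<^esub> Q e)"
      by (rule V.M.finsum_cong') (use s Ec in \<open>auto simp: Q_smult Lb_carrier simp del: One_nat_def\<close>)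
    finally have "Q ?w = Q \<zero>\<^bsub>L\<^esub>" using z(4) by (simp add: Lb_zero)
    then obtain y where y: "y \<in> carrier L" "?w = T k \<pi> \<odot>\<^bsub>L\<^esub> y" using wc by (auto simp: Q_zero_iff)
    \<comment> \<open>The dependence lifts to a relation in \<open>L\<close> up to
      \<open>\<pi>L\<close> only. Multiplication by this power makes it an exact relation, with
      coefficients divisible by \<open>\<pi>\<^sup>k\<close>; cancelling the power leaves a factor
      \<open>\<pi>\<close> in \<open>s e0\<close>, against \<open>z e0 \<noteq> 0\<close>.\<close>
    let ?p = "\<pi> [^]\<^bsub>R\<^esub> (k - 1)"
    have pk: "?p \<otimes>\<^bsub>R\<^esub> \<pi> = \<pi> [^]\<^bsub>R\<^esub> k" using k by (cases k) simp_all
    have "T k ?p \<odot>\<^bsub>L\<^esub> ?w = T k (\<pi> [^]\<^bsub>R\<^esub> k) \<odot>\<^bsub>L\<^esub> y"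
      using y by (simp add: y(2) L.smult_assoc1[symmetric] T_mult[symmetric] pk
          del: One_nat_def T_pow_zero)
    then have "T k ?p \<odot>\<^bsub>L\<^esub> ?w = \<zero>\<^bsub>L\<^esub>" using y(1) by simp
    also have "T k ?p \<odot>\<^bsub>L\<^esub> ?w = (\<Oplus>\<^bsub>L\<^esub> e \<in> E. T k ?p \<odot>\<^bsub>L\<^esub> (T k (s e) \<odot>\<^bsub>L\<^esub> e))"
      by (rule L.finsum_smult_ldistr) (use s Ec Efin in auto)
    also have "\<dots> = (\<Oplus>\<^bsub>L\<^esub> e \<in> E. T k (?p \<otimes>\<^bsub>R\<^esub> s e) \<odot>\<^bsub>L\<^esub> e)"
      by (rule L.M.finsum_cong') (use s Ec in \<open>auto simp: T_mult L.smult_assoc1\<close>)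
    finally have sum: "(\<Oplus>\<^bsub>L\<^esub> e \<in> E. T k (?p \<otimes>\<^bsub>R\<^esub> s e) \<odot>\<^bsub>L\<^esub> e) = \<zero>\<^bsub>L\<^esub>" .
    obtain u where u: "u \<in> carrier R" "?p \<otimes>\<^bsub>R\<^esub> s e0 = \<pi> [^]\<^bsub>R\<^esub> k \<otimes>\<^bsub>R\<^esub> u"
      by (rule basis_independent_R[OF L.module_axioms E _ sum z(2)]) (use s in auto)
    have "s e0 = \<pi> [^]\<^bsub>R\<^esub> (k - (k - 1)) \<otimes>\<^bsub>R\<^esub> u"
      by (rule pow_cancel[OF _ u(1) _ u(2)]) (use s z(2) in auto)
    moreover have "k - (k - 1) = 1" using k by simp
    ultimately have "T 1 (s e0) = \<zero>\<^bsub>S 1\<^esub>" using u(1) s z(2) by (subst T_eq_zero_iff) auto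
    then show False using z(2,3) s by auto
  qed
  then have "\<forall>f \<in> F. \<exists>a. a \<in> carrier R \<and> r f = \<pi> \<otimes>\<^bsub>R\<^esub> a" by blast
  then obtain a where a: "\<forall>f \<in> F. a f \<in> carrier R \<and> r f = \<pi> \<otimes>\<^bsub>R\<^esub> a f" by (rule bchoice[THEN exE])
  let ?b = "\<Oplus>\<^bsub>B\<^esub> f \<in> F. T (k + 1) (a f) \<odot>\<^bsub>B\<^esub> f"
  have "x = (\<Oplus>\<^bsub>B\<^esub> f \<in> F. T (k + 1) \<pi> \<odot>\<^bsub>B\<^esub> (T (k + 1) (a f) \<odot>\<^bsub>B\<^esub> f))"
    unfolding r(2) by (rule B.M.finsum_cong')
      (use a Fc in \<open>auto simp: T_mult B.smult_assoc1 simp del: One_nat_def\<close>)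
  also have "\<dots> = T (k + 1) \<pi> \<odot>\<^bsub>B\<^esub> ?b"
    by (rule B.finsum_smult_ldistr[symmetric]) (use a Fc Ffin in \<open>auto simp del: One_nat_def\<close>)
  finally have "x = T (k + 1) \<pi> \<odot>\<^bsub>B\<^esub> ?b" .
  moreover have "?b \<in> carrier B"
    by (rule B.M.finsum_closed) (use a Fc in \<open>auto simp del: One_nat_def\<close>)
  ultimately show ?thesis using that by blast
qed

lemma red_pi_multiple:
  assumes "b \<in> carrier B"
  shows "red (T (k + 1) \<pi> \<odot>\<^bsub>B\<^esub> b) = \<zero>\<^bsub>Lb\<^esub>"
proof -
  have "red (T (k + 1) \<pi> \<odot>\<^bsub>B\<^esub> b) = Q (T k \<pi> \<odot>\<^bsub>L\<^esub> \<mu> b)"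
    unfolding red_def using assms by (subst mu_smult) simp_all
  also have "\<dots> = \<zero>\<^bsub>Lb\<^esub>" using assms by (auto simp: Lb_zero Q_zero_iff)
  finally show ?thesis .
qed

text \<open>Factors \<open>\<pi>\<close> are split off one by one. If
  \<open>x = \<pi>\<^sup>ib\<close> with \<open>i < k\<close>, then \<open>\<pi>\<^sup>i\<close>
  annihilates \<open>\<mu> b\<close> in the free module \<open>L\<close>, so \<open>\<mu> b\<close>
  is a multiple of \<open>\<pi>\<close>; hence \<open>red b = 0\<close>, and
  \<open>red_kernel\<close> makes \<open>b\<close> a multiple of \<open>\<pi>\<close>.\<close>

lemma mu_kernel:
  assumes x: "x \<in> carrier B" and x0: "\<mu> x = \<zero>\<^bsub>L\<^esub>"
  obtains b where "b \<in> carrier B" "x = T (k + 1) (\<pi> [^]\<^bsub>R\<^esub> k) \<odot>\<^bsub>B\<^esub> b"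
proof -
  obtain E F where E: "basis (S k) L E" and "basis (S (k + 1)) B F" "card E = card F"
    using obtain_bases .
  have "i \<le> k \<Longrightarrow> \<exists>b \<in> carrier B. x = T (k + 1) (\<pi> [^]\<^bsub>R\<^esub> i) \<odot>\<^bsub>B\<^esub> b" for i :: nat
  proof (induct i)
    case 0
    then show ?case using x by (intro bexI[of _ x]) (simp_all del: One_nat_def)
  next
    case (Suc i)
    then obtain b where b: "b \<in> carrier B" "x = T (k + 1) (\<pi> [^]\<^bsub>R\<^esub> i) \<odot>\<^bsub>B\<^esub> b" by auto
    then have "T k (\<pi> [^]\<^bsub>R\<^esub> i) \<odot>\<^bsub>L\<^esub> \<mu> b = \<zero>\<^bsub>L\<^esub>"
      using x0 mu_smult[of "\<pi> [^]\<^bsub>R\<^esub> i" b] by simp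
    then obtain w where w: "w \<in> carrier L" "\<mu> b = T k (\<pi> [^]\<^bsub>R\<^esub> (k - i)) \<odot>\<^bsub>L\<^esub> w"
      using annihilator_pow[OF L.module_axioms E, of "\<mu> b" i] b Suc(2) by auto
    have "\<pi> [^]\<^bsub>R\<^esub> (k - i) = \<pi> \<otimes>\<^bsub>R\<^esub> \<pi> [^]\<^bsub>R\<^esub> (k - Suc i)"
      using Suc(2) by (simp add: nat_pow_Suc2[symmetric] Suc_diff_Suc del: nat_pow_Suc)
    then have "\<mu> b = T k \<pi> \<odot>\<^bsub>L\<^esub> (T k (\<pi> [^]\<^bsub>R\<^esub> (k - Suc i)) \<odot>\<^bsub>L\<^esub> w)"
      using w by (simp add: T_mult L.smult_assoc1)
    then have "red b = \<zero>\<^bsub>Lb\<^esub>"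
      using w b by (auto simp: red_def Lb_zero Q_zero_iff)
    then obtain b' where b': "b' \<in> carrier B" "b = T (k + 1) \<pi> \<odot>\<^bsub>B\<^esub> b'"
      using red_kernel b by blast
    then have "x = T (k + 1) (\<pi> [^]\<^bsub>R\<^esub> Suc i) \<odot>\<^bsub>B\<^esub> b'"
      unfolding b(2) b'(2) by (simp add: T_mult B.smult_assoc1 del: One_nat_def)
    then show ?case using b'(1) by blast
  qed
  from this[of k] show ?thesis using that by auto
qed

text \<open>Both conditions say that \<open>x\<close> lies in \<open>\<pi>B\<close>: the first
  because \<open>B\<close> is free over the truncation of level \<open>k + 1\<close>, the second by
  \<open>red_kernel\<close>.\<close>

lemma annihilator_pi_k:
  assumes x: "x \<in> carrier B"
  shows "T (k + 1) (\<pi> [^]\<^bsub>R\<^esub> k) \<odot>\<^bsub>B\<^esub> x = \<zero>\<^bsub>B\<^esub> \<longleftrightarrow> red x = \<zero>\<^bsub>Lb\<^esub>"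
proof
  assume 0: "T (k + 1) (\<pi> [^]\<^bsub>R\<^esub> k) \<odot>\<^bsub>B\<^esub> x = \<zero>\<^bsub>B\<^esub>"
  obtain E F where "basis (S k) L E" and F: "basis (S (k + 1)) B F" and "card E = card F"
    using obtain_bases .
  obtain w where "w \<in> carrier B" "x = T (k + 1) (\<pi> [^]\<^bsub>R\<^esub> (k + 1 - k)) \<odot>\<^bsub>B\<^esub> w"
    by (rule annihilator_pow[OF B.module_axioms F x _ 0]) auto
  then show "red x = \<zero>\<^bsub>Lb\<^esub>" using red_pi_multiple[of w] by simp
next
  assume "red x = \<zero>\<^bsub>Lb\<^esub>"
  then obtain b where b: "b \<in> carrier B" "x = T (k + 1) \<pi> \<odot>\<^bsub>B\<^esub> b" using red_kernel x by blast
  have pi_Suc: "\<pi> [^]\<^bsub>R\<^esub> (k + 1) = \<pi> [^]\<^bsub>R\<^esub> k \<otimes>\<^bsub>R\<^esub> \<pi>" by simp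
  from b have "T (k + 1) (\<pi> [^]\<^bsub>R\<^esub> k) \<odot>\<^bsub>B\<^esub> x = T (k + 1) (\<pi> [^]\<^bsub>R\<^esub> (k + 1)) \<odot>\<^bsub>B\<^esub> b"
    by (simp add: pi_Suc T_mult B.smult_assoc1 del: T_pow_zero One_nat_def)
  also have "\<dots> = \<zero>\<^bsub>B\<^esub>" using b(1) by (simp only: T_pow_zero B.smult_l_null)
  finally show "T (k + 1) (\<pi> [^]\<^bsub>R\<^esub> k) \<odot>\<^bsub>B\<^esub> x = \<zero>\<^bsub>B\<^esub>" .
qed

text \<open>Here the Jacobi identity of \<open>L\<close> enters. Together with
  \<open>mu_kernel\<close> it makes the Jacobiator of \<open>B\<close> a multiple of
  \<open>\<pi>\<^sup>k\<close>.\<close>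

lemma mu_jacobiator:
  assumes "x \<in> carrier B" "y \<in> carrier B" "z \<in> carrier B"
  shows "\<mu> (jacobiator B x y z) = \<zero>\<^bsub>L\<^esub>"
proof -
  have "\<mu> (jacobiator B x y z) = jacobiator L (\<mu> x) (\<mu> y) (\<mu> z)"
    using assms by (simp add: jacobiator_def mu_add mu_bracket)
  then show ?thesis using assms lie_algebra.jacobi[OF lie] by simp
qed

sublocale C: infinitesimal_lift R "res (k + 1) B" "res 1 Lb" red \<pi> "\<pi> [^]\<^bsub>R\<^esub> k"
proof (intro infinitesimal_lift.intro pre_lift.intro pre_lift_axioms.intro
    infinitesimal_lift_axioms.intro)
  interpret V: alternating_bracket "S 1" Lb by (rule Lb_alternating_bracket)
  show "alternating_bracket R (res (k + 1) B)"
    by (rule alternating_bracket_restrict_scalars[OF B.alternating_bracket_axioms is_cring T_hom])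
  show "alternating_bracket R (res 1 Lb)"
    by (rule alternating_bracket_restrict_scalars[OF V.alternating_bracket_axioms is_cring T_hom])
  show "linear_map R (res (k + 1) B) (res 1 Lb) red" by (rule red_linear)
  show "red ` carrier (res (k + 1) B) = carrier (res 1 Lb)" using red_surj by simp
  show "red (bracket (res (k + 1) B) x y) = bracket (res 1 Lb) (red x) (red y)"
    if "x \<in> carrier (res (k + 1) B)" "y \<in> carrier (res (k + 1) B)" for x y
    using that by (simp add: red_def mu_bracket Q_bracket)
  show "\<exists>b \<in> carrier (res (k + 1) B). x = \<pi> \<odot>\<^bsub>res (k + 1) B\<^esub> b"
    if "x \<in> carrier (res (k + 1) B)" "red x = \<zero>\<^bsub>res 1 Lb\<^esub>" for x
    using that red_kernel[of x] by auto
  have T1: "T 1 \<pi> = \<zero>\<^bsub>S 1\<^esub>" "T 1 (\<pi> [^]\<^bsub>R\<^esub> k) = \<zero>\<^bsub>S 1\<^esub>"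
  proof -
    have "\<pi> = \<pi> [^]\<^bsub>R\<^esub> (1::nat)" by simp
    then show "T 1 \<pi> = \<zero>\<^bsub>S 1\<^esub>" using T_pow_zero[of 1] by metis
    \<comment> \<open>Splitting off a factor \<open>\<pi>\<close> is possible because
      \<open>k \<ge> 1\<close>.\<close>
    have "\<pi> [^]\<^bsub>R\<^esub> k = \<pi> [^]\<^bsub>R\<^esub> (1::nat) \<otimes>\<^bsub>R\<^esub> \<pi> [^]\<^bsub>R\<^esub> (k - 1)"
      using k by (subst nat_pow_mult) simp_all
    then show "T 1 (\<pi> [^]\<^bsub>R\<^esub> k) = \<zero>\<^bsub>S 1\<^esub>"
      by (subst T_eq_zero_iff) (auto intro!: bexI[of _ "\<pi> [^]\<^bsub>R\<^esub> (k - 1)"])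
  qed
  show "\<pi> \<odot>\<^bsub>res 1 Lb\<^esub> v = \<zero>\<^bsub>res 1 Lb\<^esub>" "\<pi> [^]\<^bsub>R\<^esub> k \<odot>\<^bsub>res 1 Lb\<^esub> v = \<zero>\<^bsub>res 1 Lb\<^esub>"
    if "v \<in> carrier (res 1 Lb)" for v
    using that by (simp_all add: T1 del: One_nat_def)
  show "\<exists>w \<in> carrier (res (k + 1) B). jacobiator (res (k + 1) B) x y z = \<pi> [^]\<^bsub>R\<^esub> k \<odot>\<^bsub>res (k + 1) B\<^esub> w"
    if "x \<in> carrier (res (k + 1) B)" "y \<in> carrier (res (k + 1) B)" "z \<in> carrier (res (k + 1) B)" for x y z
    using that mu_kernel[of "jacobiator B x y z"] mu_jacobiator[of x y z] by auto
qed (simp_all add: annihilator_pi_k[simplified])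

lemma J_form_eq: "J_form R \<pi> k L B \<mu> = C.obstruction"
  by (simp only: J_form_def C.obstruction_def C.chi_def lift_chi_def restrict_scalars_simps)

lemma lie_algebra_iff: "lie_algebra (S (k + 1)) B \<longleftrightarrow> J_form R \<pi> k L B \<mu> = \<zero>\<^bsub>form_space R (res 1 Lb) 3\<^esub>"
proof -
  have "bracket_algebra (S (k + 1)) B" using lift by (simp add: bracket_algebra_lift_def)
  then show ?thesis
    unfolding J_form_eq C.obstruction_zero_iff
    by (auto simp: lie_algebra_def lie_algebra_axioms_def)
qed

end

section \<open>Free modules of coordinates\<close>

text \<open>The bracket field is left open, to be filled by a record update. For a truncation
  \<open>S\<close> the vectors have the type \<open>'r coord\<close> of the final statement.\<close>

definition coords :: "('s, 'm) ring_scheme \<Rightarrow> nat \<Rightarrow> ('s, nat \<Rightarrow> 's) bracket_module" where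
  "coords S n =
     \<lparr>carrier = {..<n} \<rightarrow>\<^sub>E carrier S, monoid.mult = undefined, one = undefined,
      ring.zero = (\<lambda>i\<in>{..<n}. \<zero>\<^bsub>S\<^esub>), ring.add = (\<lambda>x y. \<lambda>i\<in>{..<n}. x i \<oplus>\<^bsub>S\<^esub> y i),
      smult = (\<lambda>a x. \<lambda>i\<in>{..<n}. a \<otimes>\<^bsub>S\<^esub> x i), bracket = undefined\<rparr>"

definition unit_vector :: "('s, 'm) ring_scheme \<Rightarrow> nat \<Rightarrow> nat \<Rightarrow> nat \<Rightarrow> 's" where
  "unit_vector S n i = (\<lambda>j\<in>{..<n}. if j = i then \<one>\<^bsub>S\<^esub> else \<zero>\<^bsub>S\<^esub>)"

lemma coords_simps [simp]:
  "carrier (coords S n) = {..<n} \<rightarrow>\<^sub>E carrier S"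
  "i < n \<Longrightarrow> \<zero>\<^bsub>coords S n\<^esub> i = \<zero>\<^bsub>S\<^esub>"
  "i < n \<Longrightarrow> (x \<oplus>\<^bsub>coords S n\<^esub> y) i = x i \<oplus>\<^bsub>S\<^esub> y i"
  "i < n \<Longrightarrow> (a \<odot>\<^bsub>coords S n\<^esub> x) i = a \<otimes>\<^bsub>S\<^esub> x i"
  by (simp_all add: coords_def)

lemma coords_ext:
  assumes "x \<in> {..<n} \<rightarrow>\<^sub>E A" "y \<in> {..<n} \<rightarrow>\<^sub>E B" "\<And>i. i < n \<Longrightarrow> x i = y i"
  shows "x = y"
  using assms by (intro PiE_ext[of x "{..<n}" "\<lambda>_. A \<union> B"]) (auto simp: PiE_def)

lemma module_coords:
  assumes "cring S"
  shows "module S (coords S n)"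
proof -
  interpret cring S by (rule assms)
  let ?M = "coords S n"
  have c: "x \<oplus>\<^bsub>?M\<^esub> y \<in> {..<n} \<rightarrow>\<^sub>E carrier S" "\<zero>\<^bsub>?M\<^esub> \<in> {..<n} \<rightarrow>\<^sub>E carrier S"
    if "x \<in> {..<n} \<rightarrow>\<^sub>E carrier S" "y \<in> {..<n} \<rightarrow>\<^sub>E carrier S" for x y
    using that by (auto simp: coords_def)
  have z: "\<zero>\<^bsub>?M\<^esub> \<in> {..<n} \<rightarrow>\<^sub>E carrier S" by (auto simp: coords_def)
  have s: "a \<odot>\<^bsub>?M\<^esub> x \<in> {..<n} \<rightarrow>\<^sub>E carrier S" if "a \<in> carrier S" "x \<in> {..<n} \<rightarrow>\<^sub>E carrier S" for a x
    using that by (auto simp: coords_def)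
  have xc: "x i \<in> carrier S" if "x \<in> {..<n} \<rightarrow>\<^sub>E carrier S" "i < n" for x i
    using that by auto
  have "abelian_group ?M"
  proof (rule abelian_groupI)
    fix x assume x: "x \<in> carrier ?M"
    let ?y = "\<lambda>i\<in>{..<n}. \<ominus>\<^bsub>S\<^esub> x i"
    have y: "?y \<in> carrier ?M" using x by auto
    have "?y \<oplus>\<^bsub>?M\<^esub> x = \<zero>\<^bsub>?M\<^esub>"
      by (rule coords_ext[OF c(1) z]) (use x y xc in \<open>auto simp: l_neg\<close>)
    with y show "\<exists>y \<in> carrier ?M. y \<oplus>\<^bsub>?M\<^esub> x = \<zero>\<^bsub>?M\<^esub>" by blast
  next
    fix x y w assume "x \<in> carrier ?M" "y \<in> carrier ?M" "w \<in> carrier ?M"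
    then show "x \<oplus>\<^bsub>?M\<^esub> y \<oplus>\<^bsub>?M\<^esub> w = x \<oplus>\<^bsub>?M\<^esub> (y \<oplus>\<^bsub>?M\<^esub> w)"
      by (intro coords_ext[OF c(1) c(1)]) (simp_all add: c(1) xc a_assoc)
  next
    fix x y assume "x \<in> carrier ?M" "y \<in> carrier ?M"
    then show "x \<oplus>\<^bsub>?M\<^esub> y = y \<oplus>\<^bsub>?M\<^esub> x"
      by (intro coords_ext[OF c(1) c(1)]) (simp_all add: xc a_comm)
  next
    fix x assume "x \<in> carrier ?M"
    then show "\<zero>\<^bsub>?M\<^esub> \<oplus>\<^bsub>?M\<^esub> x = x"
      by (intro coords_ext[OF c(1)]) (simp_all add: xc z)
  qed (simp_all add: c(1) z)
  then show ?thesis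
  proof (rule moduleI[OF assms])
    fix a b x assume "a \<in> carrier S" "b \<in> carrier S" "x \<in> carrier ?M"
    then show "(a \<oplus>\<^bsub>S\<^esub> b) \<odot>\<^bsub>?M\<^esub> x = a \<odot>\<^bsub>?M\<^esub> x \<oplus>\<^bsub>?M\<^esub> b \<odot>\<^bsub>?M\<^esub> x"
      "(a \<otimes>\<^bsub>S\<^esub> b) \<odot>\<^bsub>?M\<^esub> x = a \<odot>\<^bsub>?M\<^esub> (b \<odot>\<^bsub>?M\<^esub> x)"
      by (intro coords_ext[OF s c(1)] coords_ext[OF s s]; simp add: s xc l_distr m_assoc)+
  next
    fix a x y assume "a \<in> carrier S" "x \<in> carrier ?M" "y \<in> carrier ?M"
    then show "a \<odot>\<^bsub>?M\<^esub> (x \<oplus>\<^bsub>?M\<^esub> y) = a \<odot>\<^bsub>?M\<^esub> x \<oplus>\<^bsub>?M\<^esub> a \<odot>\<^bsub>?M\<^esub> y"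
      by (intro coords_ext[OF s c(1)]) (simp_all add: s c(1) xc r_distr)
  next
    fix x assume "x \<in> carrier ?M"
    then show "\<one>\<^bsub>S\<^esub> \<odot>\<^bsub>?M\<^esub> x = x"
      by (intro coords_ext[OF s]) (simp_all add: xc)
  qed (simp_all add: s)
qed

lemma coords_finsum:
  assumes S: "cring S" and A: "finite A" "f \<in> A \<rightarrow> carrier (coords S n)" and j: "j < n"
  shows "finsum (coords S n) f A j = (\<Oplus>\<^bsub>S\<^esub> a \<in> A. f a j)"
proof -
  interpret S: cring S by (rule S)
  interpret M: module S "coords S n" by (rule module_coords[OF S])
  show ?thesis
    using A
  proof (induct A)
    case (insert a A)
    have "f b j \<in> carrier S" if "b \<in> insert a A" for b
      using insert.prems that j by (auto simp: Pi_iff PiE_def)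
    moreover have "finsum (coords S n) f (insert a A)
        = f a \<oplus>\<^bsub>coords S n\<^esub> finsum (coords S n) f A"
      using insert by (intro M.M.finsum_insert) auto
    ultimately show ?case using insert j by (simp add: Pi_iff)
  qed (use j in simp)
qed

text \<open>Over the zero ring all unit vectors would coincide and their set would not have
  \<open>n\<close> elements; this is what \<open>nontrivial\<close> prevents.\<close>

lemma basis_unit_vectors:
  assumes S: "cring S" and nontrivial: "\<one>\<^bsub>S\<^esub> \<noteq> \<zero>\<^bsub>S\<^esub>"
  shows "inj_on (unit_vector S n) {..<n}"
    and "basis S (coords S n) (unit_vector S n ` {..<n})"
proof -
  interpret S: cring S by (rule S)
  interpret M: module S "coords S n" by (rule module_coords[OF S])
  let ?u = "unit_vector S n" and ?M = "coords S n"
  let ?U = "?u ` {..<n}"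
  show inj: "inj_on ?u {..<n}"
  proof (rule inj_onI)
    fix i j assume "i \<in> {..<n}" "j \<in> {..<n}" "?u i = ?u j"
    then have "?u i i = ?u j i" by simp
    then show "i = j" using \<open>i \<in> {..<n}\<close> nontrivial by (auto simp: unit_vector_def split: if_splits)
  qed
  have sub: "?U \<subseteq> carrier ?M" by (auto simp: unit_vector_def split: if_splits)
  \<comment> \<open>Reading off coordinate \<open>j\<close> recovers the coefficient at the
    \<open>j\<close>-th unit vector, which gives existence and uniqueness of coordinates
    alike.\<close>
  have coord: "(\<Oplus>\<^bsub>?M\<^esub> e \<in> ?U. c e \<odot>\<^bsub>?M\<^esub> e) j = c (?u j)"
    if c: "c \<in> ?U \<rightarrow> carrier S" and j: "j < n" for c j
  proof -
    have "(\<Oplus>\<^bsub>?M\<^esub> e \<in> ?U. c e \<odot>\<^bsub>?M\<^esub> e) j = (\<Oplus>\<^bsub>S\<^esub> e \<in> ?U. (c e \<odot>\<^bsub>?M\<^esub> e) j)"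
      by (rule coords_finsum[OF S _ _ j]) (use c sub in \<open>auto simp del: coords_simps(1)\<close>)
    also have "\<dots> = (\<Oplus>\<^bsub>S\<^esub> e \<in> ?U. if ?u j = e then c e else \<zero>\<^bsub>S\<^esub>)"
    proof (rule S.finsum_cong')
      fix e assume "e \<in> ?U"
      then obtain i where i: "i < n" "e = ?u i" by auto
      have "?u j = e \<longleftrightarrow> j = i" by (simp add: i inj_on_eq_iff[OF inj] j)
      moreover have "e j = (if j = i then \<one>\<^bsub>S\<^esub> else \<zero>\<^bsub>S\<^esub>)" using i j by (simp add: unit_vector_def)
      moreover have "c e \<in> carrier S" using c \<open>e \<in> ?U\<close> by blast
      ultimately show "(c e \<odot>\<^bsub>?M\<^esub> e) j = (if ?u j = e then c e else \<zero>\<^bsub>S\<^esub>)"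
        using j by simp
    qed (use c in auto)
    also have "\<dots> = c (?u j)"
      by (rule S.add.finprod_singleton) (use c j in auto)
    finally show ?thesis .
  qed
  show "basis S ?M ?U"
    unfolding basis_def
  proof (intro conjI ballI)
    fix v assume v: "v \<in> carrier ?M"
    have vc: "v j \<in> carrier S" if "j < n" for j using v that by (simp add: PiE_iff)
    define c where "c = (\<lambda>e \<in> ?U. v (inv_into {..<n} ?u e))"
    have cu: "c (?u j) = v j" if "j < n" for j
      using that by (simp add: c_def inv_into_f_f[OF inj])
    have c: "c \<in> ?U \<rightarrow>\<^sub>E carrier S"
      unfolding c_def restrict_PiE_iff using vc by (simp add: inv_into_f_f[OF inj])
    then have c': "c \<in> ?U \<rightarrow> carrier S" by (simp add: PiE_def)
    show "\<exists>!c. c \<in> ?U \<rightarrow>\<^sub>E carrier S \<and> v = (\<Oplus>\<^bsub>?M\<^esub> e \<in> ?U. c e \<odot>\<^bsub>?M\<^esub> e)"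
    proof (rule ex1I[of _ c], intro conjI c)
      have "(\<Oplus>\<^bsub>?M\<^esub> e \<in> ?U. c e \<odot>\<^bsub>?M\<^esub> e) \<in> carrier ?M"
        by (rule M.M.finsum_closed) (use c' sub in \<open>auto simp del: coords_simps(1)\<close>)
      then show "v = (\<Oplus>\<^bsub>?M\<^esub> e \<in> ?U. c e \<odot>\<^bsub>?M\<^esub> e)"
        using v by (intro coords_ext[of v n _ _ "carrier S"])
          (simp_all only: coords_simps(1) coord[OF c'] cu)
    next
      fix d assume d: "d \<in> ?U \<rightarrow>\<^sub>E carrier S \<and> v = (\<Oplus>\<^bsub>?M\<^esub> e \<in> ?U. d e \<odot>\<^bsub>?M\<^esub> e)"
      then have d': "d \<in> ?U \<rightarrow> carrier S" by (simp add: PiE_def)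
      have du: "d (?u j) = v j" if "j < n" for j
        using coord[OF d' that] conjunct2[OF d] by (simp only:)
      show "d = c"
      proof (rule PiE_ext)
        show "d \<in> ?U \<rightarrow>\<^sub>E carrier S" "c \<in> ?U \<rightarrow>\<^sub>E carrier S" using d c by simp_all
        fix e assume "e \<in> ?U"
        then obtain j where "j < n" "e = ?u j" by auto
        then show "d e = c e" by (simp add: du cu)
      qed
    qed
  qed (use sub in auto)
qed

section \<open>Extending an alternating bracket from a basis\<close>

text \<open>Summing over \<open>j < i\<close> only makes the bracket alternating for any choice of the values
  \<open>C i j = [e\<^sub>i, e\<^sub>j]\<close>.\<close>

definition structure_bracket ::
    "('s, 'm) ring_scheme \<Rightarrow> nat \<Rightarrow> (nat \<Rightarrow> nat \<Rightarrow> nat \<Rightarrow> 's) \<Rightarrow> (nat \<Rightarrow> 's) \<Rightarrow> (nat \<Rightarrow> 's) \<Rightarrow> nat \<Rightarrow> 's" where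
  "structure_bracket S n C x y = (\<Oplus>\<^bsub>coords S n\<^esub> p \<in> {(i, j). j < i \<and> i < n}.
     (x (fst p) \<otimes>\<^bsub>S\<^esub> y (snd p) \<ominus>\<^bsub>S\<^esub> x (snd p) \<otimes>\<^bsub>S\<^esub> y (fst p))
       \<odot>\<^bsub>coords S n\<^esub> C (fst p) (snd p))"

lemma finite_index_pairs [simp]: "finite {(i, j). j < i \<and> i < (n::nat)}"
  by (rule finite_subset[of _ "{..<n} \<times> {..<n}"]) auto

lemma alternating_bracket_updateI:
  assumes "module S M"
    and "\<And>x y. \<lbrakk>x \<in> carrier M; y \<in> carrier M\<rbrakk> \<Longrightarrow> f x y \<in> carrier M"
    and "\<And>x. x \<in> carrier M \<Longrightarrow> f x x = \<zero>\<^bsub>M\<^esub>"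
    and "\<And>a x y. \<lbrakk>a \<in> carrier S; x \<in> carrier M; y \<in> carrier M\<rbrakk> \<Longrightarrow> f (a \<odot>\<^bsub>M\<^esub> x) y = a \<odot>\<^bsub>M\<^esub> f x y"
    and "\<And>a x y. \<lbrakk>a \<in> carrier S; x \<in> carrier M; y \<in> carrier M\<rbrakk> \<Longrightarrow> f x (a \<odot>\<^bsub>M\<^esub> y) = a \<odot>\<^bsub>M\<^esub> f x y"
    and "\<And>x y z. \<lbrakk>x \<in> carrier M; y \<in> carrier M; z \<in> carrier M\<rbrakk> \<Longrightarrow> f (x \<oplus>\<^bsub>M\<^esub> y) z = f x z \<oplus>\<^bsub>M\<^esub> f y z"
    and "\<And>x y z. \<lbrakk>x \<in> carrier M; y \<in> carrier M; z \<in> carrier M\<rbrakk> \<Longrightarrow> f x (y \<oplus>\<^bsub>M\<^esub> z) = f x y \<oplus>\<^bsub>M\<^esub> f x z"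
  shows "alternating_bracket S (M\<lparr>bracket := f\<rparr>)"
  using assms
  by (intro alternating_bracket.intro alternating_bracket_axioms.intro) simp_all

text \<open>The coefficients are the 2 by 2 minors of the pair \<open>x\<close>, \<open>y\<close>.
  They are bilinear and alternating, and the \<open>C i j\<close> are constants.\<close>

lemma structure_bracket_alternating:
  assumes S: "cring S"
    and C: "\<And>i j. \<lbrakk>j < i; i < n\<rbrakk> \<Longrightarrow> C i j \<in> carrier (coords S n)"
  shows "alternating_bracket S ((coords S n)\<lparr>bracket := structure_bracket S n C\<rparr>)"
proof -
  interpret S: cring S by (rule S)
  interpret M: module S "coords S n" by (rule module_coords[OF S])
  let ?M = "coords S n"
  define P where "P = {(i, j). j < i \<and> i < n}"
  have P: "finite P" "\<And>p. p \<in> P \<Longrightarrow> fst p < n \<and> snd p < n" by (auto simp: P_def)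
  let ?b = "structure_bracket S n C"
  define D where "D x y p = x (fst p) \<otimes>\<^bsub>S\<^esub> y (snd p) \<ominus>\<^bsub>S\<^esub> x (snd p) \<otimes>\<^bsub>S\<^esub> y (fst p)"
    for x y :: "nat \<Rightarrow> 'a" and p
  have b: "?b x y = (\<Oplus>\<^bsub>?M\<^esub> p \<in> P. D x y p \<odot>\<^bsub>?M\<^esub> C (fst p) (snd p))" for x y
    by (simp add: structure_bracket_def D_def P_def)
  have Cc: "C (fst p) (snd p) \<in> carrier ?M" if "p \<in> P" for p
    using that C by (auto simp: P_def simp del: coords_simps(1))
  have xc: "x (fst p) \<in> carrier S" "x (snd p) \<in> carrier S" if "x \<in> carrier ?M" "p \<in> P" for x p
    using that P(2) by (auto simp: PiE_iff)
  have Dc: "D x y p \<in> carrier S" if "x \<in> carrier ?M" "y \<in> carrier ?M" "p \<in> P" for x y p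
    using xc[OF that(1,3)] xc[OF that(2,3)] by (simp add: D_def)
  have D_add: "D (x \<oplus>\<^bsub>?M\<^esub> x') y p = D x y p \<oplus>\<^bsub>S\<^esub> D x' y p" "D y (x \<oplus>\<^bsub>?M\<^esub> x') p = D y x p \<oplus>\<^bsub>S\<^esub> D y x' p"
    if "x \<in> carrier ?M" "x' \<in> carrier ?M" "y \<in> carrier ?M" "p \<in> P" for x x' y p
  proof -
    have "fst p < n" "snd p < n" using that(4) P(2) by auto
    then show "D (x \<oplus>\<^bsub>?M\<^esub> x') y p = D x y p \<oplus>\<^bsub>S\<^esub> D x' y p" "D y (x \<oplus>\<^bsub>?M\<^esub> x') p = D y x p \<oplus>\<^bsub>S\<^esub> D y x' p"
      using xc[OF that(1,4)] xc[OF that(2,4)] xc[OF that(3,4)]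
      by (simp_all add: D_def S.minus_eq S.l_distr S.r_distr S.minus_add S.a_ac)
  qed
  have D_smult: "D (a \<odot>\<^bsub>?M\<^esub> x) y p = a \<otimes>\<^bsub>S\<^esub> D x y p" "D y (a \<odot>\<^bsub>?M\<^esub> x) p = a \<otimes>\<^bsub>S\<^esub> D y x p"
    if "a \<in> carrier S" "x \<in> carrier ?M" "y \<in> carrier ?M" "p \<in> P" for a x y p
  proof -
    have "fst p < n" "snd p < n" using that(4) P(2) by auto
    then show "D (a \<odot>\<^bsub>?M\<^esub> x) y p = a \<otimes>\<^bsub>S\<^esub> D x y p" "D y (a \<odot>\<^bsub>?M\<^esub> x) p = a \<otimes>\<^bsub>S\<^esub> D y x p"
      using that(1) xc[OF that(2,4)] xc[OF that(3,4)]
      by (simp_all add: D_def S.minus_eq S.r_distr S.r_minus S.m_ac)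
  qed
  have D_alt: "D x x p = \<zero>\<^bsub>S\<^esub>" if "x \<in> carrier ?M" "p \<in> P" for x p
    using xc[OF that] by (simp add: D_def S.m_comm S.minus_eq S.r_neg)
  have closed: "?b x y \<in> carrier ?M" if "x \<in> carrier ?M" "y \<in> carrier ?M" for x y
    unfolding b by (rule M.M.finsum_closed) (use Dc Cc that in \<open>auto simp del: coords_simps(1)\<close>)
  have sum_add: "(\<Oplus>\<^bsub>?M\<^esub> p \<in> P. (f p \<oplus>\<^bsub>S\<^esub> g p) \<odot>\<^bsub>?M\<^esub> C (fst p) (snd p))
      = (\<Oplus>\<^bsub>?M\<^esub> p \<in> P. f p \<odot>\<^bsub>?M\<^esub> C (fst p) (snd p)) \<oplus>\<^bsub>?M\<^esub> (\<Oplus>\<^bsub>?M\<^esub> p \<in> P. g p \<odot>\<^bsub>?M\<^esub> C (fst p) (snd p))"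
    if "f \<in> P \<rightarrow> carrier S" "g \<in> P \<rightarrow> carrier S" for f g
  proof -
    have "(\<Oplus>\<^bsub>?M\<^esub> p \<in> P. (f p \<oplus>\<^bsub>S\<^esub> g p) \<odot>\<^bsub>?M\<^esub> C (fst p) (snd p))
        = (\<Oplus>\<^bsub>?M\<^esub> p \<in> P. f p \<odot>\<^bsub>?M\<^esub> C (fst p) (snd p) \<oplus>\<^bsub>?M\<^esub> g p \<odot>\<^bsub>?M\<^esub> C (fst p) (snd p))"
      by (rule M.M.finsum_cong')
        (use that Cc in \<open>simp_all add: Pi_iff M.smult_l_distr del: coords_simps(1)\<close>)
    then show ?thesis
      using that Cc by (simp add: M.M.finsum_addf Pi_iff del: coords_simps(1))
  qed
  have sum_smult: "(\<Oplus>\<^bsub>?M\<^esub> p \<in> P. (a \<otimes>\<^bsub>S\<^esub> f p) \<odot>\<^bsub>?M\<^esub> C (fst p) (snd p))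
      = a \<odot>\<^bsub>?M\<^esub> (\<Oplus>\<^bsub>?M\<^esub> p \<in> P. f p \<odot>\<^bsub>?M\<^esub> C (fst p) (snd p))"
    if "f \<in> P \<rightarrow> carrier S" "a \<in> carrier S" for f a
  proof -
    have "(\<Oplus>\<^bsub>?M\<^esub> p \<in> P. (a \<otimes>\<^bsub>S\<^esub> f p) \<odot>\<^bsub>?M\<^esub> C (fst p) (snd p))
        = (\<Oplus>\<^bsub>?M\<^esub> p \<in> P. a \<odot>\<^bsub>?M\<^esub> (f p \<odot>\<^bsub>?M\<^esub> C (fst p) (snd p)))"
      by (rule M.M.finsum_cong')
        (use that Cc in \<open>simp_all add: Pi_iff M.smult_assoc1 del: coords_simps(1)\<close>)
    then show ?thesis
      using that Cc by (simp add: M.finsum_smult_ldistr P(1) Pi_iff del: coords_simps(1))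
  qed
  have cong: "(\<Oplus>\<^bsub>?M\<^esub> p \<in> P. f p \<odot>\<^bsub>?M\<^esub> C (fst p) (snd p)) = (\<Oplus>\<^bsub>?M\<^esub> p \<in> P. g p \<odot>\<^bsub>?M\<^esub> C (fst p) (snd p))"
    if "\<And>p. p \<in> P \<Longrightarrow> f p = g p" "g \<in> P \<rightarrow> carrier S" for f g
    by (rule M.M.finsum_cong')
      (use that Cc in \<open>simp_all add: Pi_iff del: coords_simps(1)\<close>)
  have D_Pi: "D x y \<in> P \<rightarrow> carrier S" if "x \<in> carrier ?M" "y \<in> carrier ?M" for x y
    using Dc that by blast
  show ?thesis
  proof (rule alternating_bracket_updateI[OF M.module_axioms])
    show "?b x y \<in> carrier ?M" if "x \<in> carrier ?M" "y \<in> carrier ?M" for x y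
      using that by (rule closed)
    show "?b x x = \<zero>\<^bsub>?M\<^esub>" if x: "x \<in> carrier ?M" for x
    proof -
      have "?b x x = (\<Oplus>\<^bsub>?M\<^esub> p \<in> P. \<zero>\<^bsub>?M\<^esub>)"
        unfolding b by (rule M.M.finsum_cong')
          (use D_alt[OF x] Cc in \<open>simp_all add: Pi_iff del: coords_simps(1)\<close>)
      then show ?thesis by simp
    qed
  next
    fix a x y assume a: "a \<in> carrier S" and xy: "x \<in> carrier ?M" "y \<in> carrier ?M"
    show "?b (a \<odot>\<^bsub>?M\<^esub> x) y = a \<odot>\<^bsub>?M\<^esub> ?b x y" "?b x (a \<odot>\<^bsub>?M\<^esub> y) = a \<odot>\<^bsub>?M\<^esub> ?b x y"
      unfolding b sum_smult[OF D_Pi[OF xy] a, symmetric]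
      by (rule cong; use D_smult[OF a] D_Pi a xy in \<open>simp add: Pi_iff del: coords_simps(1)\<close>)+
  next
    fix x y z assume xyz: "x \<in> carrier ?M" "y \<in> carrier ?M" "z \<in> carrier ?M"
    show "?b (x \<oplus>\<^bsub>?M\<^esub> y) z = ?b x z \<oplus>\<^bsub>?M\<^esub> ?b y z"
      unfolding b sum_add[OF D_Pi[OF xyz(1,3)] D_Pi[OF xyz(2,3)], symmetric]
      by (rule cong) (use D_add D_Pi xyz in \<open>simp_all add: Pi_iff del: coords_simps(1)\<close>)
    show "?b x (y \<oplus>\<^bsub>?M\<^esub> z) = ?b x y \<oplus>\<^bsub>?M\<^esub> ?b x z"
      unfolding b sum_add[OF D_Pi[OF xyz(1,2)] D_Pi[OF xyz(1,3)], symmetric]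
      by (rule cong) (use D_add D_Pi xyz in \<open>simp_all add: Pi_iff del: coords_simps(1)\<close>)
  qed
qed

text \<open>For these two unit vectors the minor is 1 at \<open>(i, j)\<close> and 0 at every other
  pair of the sum; the pair \<open>(j, i)\<close>, where it would be -1, is excluded by the ordering
  of the indices.\<close>

lemma structure_bracket_unit_vectors:
  assumes S: "cring S"
    and C: "\<And>i j. \<lbrakk>j < i; i < n\<rbrakk> \<Longrightarrow> C i j \<in> carrier (coords S n)"
    and ij: "j < i" "i < n"
  shows "structure_bracket S n C (unit_vector S n i) (unit_vector S n j) = C i j"
proof -
  interpret S: cring S by (rule S)
  interpret M: module S "coords S n" by (rule module_coords[OF S])
  let ?M = "coords S n" and ?P = "{(i, j). j < i \<and> i < n}"
  have "structure_bracket S n C (unit_vector S n i) (unit_vector S n j)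
      = (\<Oplus>\<^bsub>?M\<^esub> p \<in> ?P. if (i, j) = p then C (fst p) (snd p) else \<zero>\<^bsub>?M\<^esub>)"
    unfolding structure_bracket_def
  proof (rule M.M.finsum_cong')
    fix p assume p: "p \<in> ?P"
    let ?u = "unit_vector S n"
    have "?u i (fst p) \<otimes>\<^bsub>S\<^esub> ?u j (snd p) \<ominus>\<^bsub>S\<^esub> ?u i (snd p) \<otimes>\<^bsub>S\<^esub> ?u j (fst p)
        = (if (i, j) = p then \<one>\<^bsub>S\<^esub> else \<zero>\<^bsub>S\<^esub>)"
      using p ij by (auto simp: unit_vector_def S.minus_eq)
    then show "(?u i (fst p) \<otimes>\<^bsub>S\<^esub> ?u j (snd p) \<ominus>\<^bsub>S\<^esub> ?u i (snd p) \<otimes>\<^bsub>S\<^esub> ?u j (fst p)) \<odot>\<^bsub>?M\<^esub> C (fst p) (snd p)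
        = (if (i, j) = p then C (fst p) (snd p) else \<zero>\<^bsub>?M\<^esub>)"
      using C p by (auto simp del: coords_simps(1))
  qed (use C in \<open>auto simp del: coords_simps(1)\<close>)
  also have "\<dots> = C (fst (i, j)) (snd (i, j))"
    by (rule M.M.add.finprod_singleton) (use ij C in \<open>auto simp del: coords_simps(1)\<close>)
  finally show ?thesis by simp
qed

section \<open>Existence of lifts\<close>

context truncations
begin

text \<open>The projection \<open>R/\<pi>\<^sup>k\<^sup>+\<^sup>1 \<rightarrow>
  R/\<pi>\<^sup>k\<close>, through an arbitrary representative. It turns \<open>L\<close> into a
  module over the ring over which lifts are free, so that maps into \<open>L\<close> can be
  prescribed on a basis.\<close>

definition lower :: "nat \<Rightarrow> 'r set \<Rightarrow> 'r set" where
  "lower k A = T k (SOME r. r \<in> carrier R \<and> T (k + 1) r = A)"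

lemma lower_T [simp]:
  assumes r: "r \<in> carrier R"
  shows "lower k (T (k + 1) r) = T k r"
proof -
  let ?s = "SOME s. s \<in> carrier R \<and> T (k + 1) s = T (k + 1) r"
  have s: "?s \<in> carrier R \<and> T (k + 1) ?s = T (k + 1) r"
    by (rule someI[of _ r]) (use r in simp)
  then obtain a where a: "a \<in> carrier R" "?s \<ominus>\<^bsub>R\<^esub> r = \<pi> [^]\<^bsub>R\<^esub> (k + 1) \<otimes>\<^bsub>R\<^esub> a"
    using r T_eq_iff[of ?s r "k + 1"] by blast
  then have "?s \<ominus>\<^bsub>R\<^esub> r = \<pi> [^]\<^bsub>R\<^esub> k \<otimes>\<^bsub>R\<^esub> (\<pi> \<otimes>\<^bsub>R\<^esub> a)" by (simp add: m_assoc)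
  then have "T k ?s = T k r" using s r m_closed[OF pi_closed a(1)] T_eq_iff[of ?s r k] by blast
  then show ?thesis by (simp add: lower_def)
qed

lemma lower_hom: "lower k \<in> ring_hom (S (k + 1)) (S k)"
proof (rule ring_hom_memI)
  have eq: "A \<in> carrier (S (k + 1)) \<longleftrightarrow> (\<exists>r \<in> carrier R. A = T (k + 1) r)" for A
    by (auto simp: S_carrier)
  fix A assume "A \<in> carrier (S (k + 1))"
  then obtain r where r: "r \<in> carrier R" "A = T (k + 1) r" unfolding eq by blast
  show "lower k A \<in> carrier (S k)" using r by (simp del: One_nat_def)
  fix B assume "B \<in> carrier (S (k + 1))"
  then obtain s where s: "s \<in> carrier R" "B = T (k + 1) s" unfolding eq by blast
  show "lower k (A \<otimes>\<^bsub>S (k + 1)\<^esub> B) = lower k A \<otimes>\<^bsub>S k\<^esub> lower k B"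
    unfolding r(2) s(2) T_mult[OF r(1) s(1), symmetric] using r(1) s(1)
    by (simp add: T_mult[where j = k] del: One_nat_def)
  show "lower k (A \<oplus>\<^bsub>S (k + 1)\<^esub> B) = lower k A \<oplus>\<^bsub>S k\<^esub> lower k B"
    unfolding r(2) s(2) T_add[OF r(1) s(1), symmetric] using r(1) s(1)
    by (simp add: T_add[where j = k] del: One_nat_def)
next
  show "lower k \<one>\<^bsub>S (k + 1)\<^esub> = \<one>\<^bsub>S k\<^esub>"
    using lower_T[of "\<one>\<^bsub>R\<^esub>" k] by (simp del: lower_T One_nat_def)
qed

text \<open>If 1 were a multiple of a positive power of \<open>\<pi>\<close>, it would vanish in the
  residue field.\<close>

lemma S_nontrivial: "\<one>\<^bsub>S (k + 1)\<^esub> \<noteq> \<zero>\<^bsub>S (k + 1)\<^esub>"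
proof
  assume "\<one>\<^bsub>S (k + 1)\<^esub> = \<zero>\<^bsub>S (k + 1)\<^esub>"
  then have "T (k + 1) \<one>\<^bsub>R\<^esub> = \<zero>\<^bsub>S (k + 1)\<^esub>" by (simp del: One_nat_def)
  then obtain a where a: "a \<in> carrier R" "\<one>\<^bsub>R\<^esub> = \<pi> [^]\<^bsub>R\<^esub> (k + 1) \<otimes>\<^bsub>R\<^esub> a"
    using T_eq_zero_iff[of "\<one>\<^bsub>R\<^esub>" "k + 1"] by blast
  have "\<pi> [^]\<^bsub>R\<^esub> (k + 1) \<otimes>\<^bsub>R\<^esub> a = \<pi> [^]\<^bsub>R\<^esub> (1::nat) \<otimes>\<^bsub>R\<^esub> (\<pi> [^]\<^bsub>R\<^esub> k \<otimes>\<^bsub>R\<^esub> a)"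
    using a(1) by (simp add: m_ac)
  with a(2) have "\<one>\<^bsub>R\<^esub> = \<pi> [^]\<^bsub>R\<^esub> (1::nat) \<otimes>\<^bsub>R\<^esub> (\<pi> [^]\<^bsub>R\<^esub> k \<otimes>\<^bsub>R\<^esub> a)" by (rule trans)
  moreover have "\<pi> [^]\<^bsub>R\<^esub> k \<otimes>\<^bsub>R\<^esub> a \<in> carrier R" using a by simp
  ultimately have "T 1 \<one>\<^bsub>R\<^esub> = \<zero>\<^bsub>S 1\<^esub>"
    using T_eq_zero_iff[of "\<one>\<^bsub>R\<^esub>" 1] one_closed by blast
  moreover interpret F: field "S 1" by (rule S_1_field)
  have "\<one>\<^bsub>S 1\<^esub> \<noteq> \<zero>\<^bsub>S 1\<^esub>" by (rule F.one_not_zero)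
  ultimately show False by (simp only: T_one)
qed

end

text \<open>Coordinate vectors are mapped onto \<open>L\<close> by sending unit vectors to the basis
  \<open>E\<close>. Brackets of unit vectors may be any preimages of the brackets in
  \<open>L\<close>: the Jacobi identity is not asked of the lift, so the choices need not be
  compatible.\<close>

lemma (in truncated_algebra) exists_lift:
  assumes E: "basis (S k) L E"
  obtains B :: "('r set, 'r coord) bracket_module" and \<mu> where "bracket_algebra_lift R \<pi> k L B \<mu>"
proof -
  let ?S = "S (k + 1)" and ?n = "card E"
  let ?B = "coords ?S ?n" and ?u = "unit_vector ?S ?n" and ?L = "restrict_scalars (lower k) L"
  interpret S: cring ?S by (rule S_cring)
  interpret B: module ?S ?B by (rule module_coords[OF S_cring])
  interpret L': alternating_bracket ?S ?L
    by (rule alternating_bracket_restrict_scalars[OF L.alternating_bracket_axioms S_cring lower_hom])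
  note basis = basis_unit_vectors[OF S_cring S_nontrivial, where n = ?n]
  let ?U = "?u ` {..<?n}"
  have Ufin: "finite ?U" and Usub: "\<And>e. e \<in> ?U \<Longrightarrow> e \<in> carrier ?B"
    using basis(2) unfolding basis_def by blast+
  from E have Efin: "finite E" and Ec: "\<And>e. e \<in> E \<Longrightarrow> e \<in> carrier L" by (auto simp: basis_def)
  have Ucard: "card ?U = card E" using card_image[OF basis(1)] by simp
  obtain g where g: "bij_betw g ?U E" using finite_same_card_bij[OF Ufin Efin Ucard] by blast
  then have gE: "g e \<in> E" if "e \<in> ?U" for e using that by (auto simp: bij_betw_def)
  have gc: "g \<in> ?U \<rightarrow> carrier ?L" using gE Ec by auto
  obtain \<mu> where \<mu>: "linear_map ?S ?B ?L \<mu>" and \<mu>_basis: "\<And>e. e \<in> ?U \<Longrightarrow> \<mu> e = g e"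
    using basis_linear_extension[OF B.module_axioms L'.module_axioms basis(2) gc] by blast
  note \<mu>D = linear_mapD[OF \<mu>]
  have surj: "\<mu> ` carrier ?B = carrier L"
  proof (intro subset_antisym subsetI)
    fix v assume "v \<in> \<mu> ` carrier ?B"
    then show "v \<in> carrier L" using \<mu>D(1) by auto
  next
    fix v assume v: "v \<in> carrier L"
    obtain r where r: "r \<in> E \<rightarrow> carrier R" "v = (\<Oplus>\<^bsub>L\<^esub> e \<in> E. T k (r e) \<odot>\<^bsub>L\<^esub> e)"
      using basis_expansion_R[OF L.module_axioms E v] .
    have rc: "r (g e) \<in> carrier R" if "e \<in> ?U" for e using r(1) gE[OF that] by blast
    let ?b = "\<Oplus>\<^bsub>?B\<^esub> e \<in> ?U. T (k + 1) (r (g e)) \<odot>\<^bsub>?B\<^esub> e"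
    have cl: "(\<lambda>e. T (k + 1) (r (g e)) \<odot>\<^bsub>?B\<^esub> e) \<in> ?U \<rightarrow> carrier ?B"
      using rc Usub by (intro Pi_I B.smult_closed T_closed)
    have "\<mu> ?b = (\<Oplus>\<^bsub>?L\<^esub> e \<in> ?U. \<mu> (T (k + 1) (r (g e)) \<odot>\<^bsub>?B\<^esub> e))"
      by (rule linear_map_finsum[OF B.module_axioms L'.module_axioms \<mu> Ufin cl])
    also have "\<dots> = (\<Oplus>\<^bsub>L\<^esub> e \<in> ?U. \<mu> (T (k + 1) (r (g e)) \<odot>\<^bsub>?B\<^esub> e))" by simp
    also have "\<dots> = (\<Oplus>\<^bsub>L\<^esub> e \<in> ?U. T k (r (g e)) \<odot>\<^bsub>L\<^esub> g e)"
    proof (rule L.M.finsum_cong')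
      fix e assume e: "e \<in> ?U"
      show "\<mu> (T (k + 1) (r (g e)) \<odot>\<^bsub>?B\<^esub> e) = T k (r (g e)) \<odot>\<^bsub>L\<^esub> g e"
        using \<mu>D(3)[OF T_closed[OF rc[OF e]] Usub[OF e]] \<mu>_basis[OF e] rc[OF e]
        by (simp del: One_nat_def)
    next
      show "(\<lambda>e. T k (r (g e)) \<odot>\<^bsub>L\<^esub> g e) \<in> ?U \<rightarrow> carrier L"
        by (intro Pi_I L.smult_closed T_closed rc Ec gE)
    qed simp
    also have "\<dots> = (\<Oplus>\<^bsub>L\<^esub> e \<in> g ` ?U. T k (r e) \<odot>\<^bsub>L\<^esub> e)"
    proof (rule L.M.finsum_reindex[symmetric])
      show "(\<lambda>e. T k (r e) \<odot>\<^bsub>L\<^esub> e) \<in> g ` ?U \<rightarrow> carrier L"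
      proof (rule Pi_I)
        fix e assume "e \<in> g ` ?U"
        then obtain x where "x \<in> ?U" "e = g x" by (rule imageE)
        then show "T k (r e) \<odot>\<^bsub>L\<^esub> e \<in> carrier L" using rc[of x] gE[of x] Ec[of e] by simp
      qed
      show "inj_on g ?U" using g by (simp add: bij_betw_def)
    qed
    also have "g ` ?U = E" using g by (simp add: bij_betw_def)
    finally have "\<mu> ?b = v" using r(2) by simp
    moreover have "?b \<in> carrier ?B" by (rule B.M.finsum_closed[OF cl])
    ultimately show "v \<in> \<mu> ` carrier ?B" by blast
  qed
  have "\<exists>c. c \<in> carrier ?B \<and> \<mu> c = bracket L (\<mu> (?u i)) (\<mu> (?u j))" if "j < i" "i < ?n" for i j
  proof -
    have "?u i \<in> carrier ?B" "?u j \<in> carrier ?B" using that by (intro Usub imageI; simp)+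
    then have "bracket L (\<mu> (?u i)) (\<mu> (?u j)) \<in> \<mu> ` carrier ?B"
      unfolding surj by (intro L.bracket_closed \<mu>D(1)[unfolded restrict_scalars_simps])
    then obtain c where "bracket L (\<mu> (?u i)) (\<mu> (?u j)) = \<mu> c" "c \<in> carrier ?B" by (rule imageE)
    then show ?thesis by (intro exI[of _ c] conjI) (simp_all only:)
  qed
  note C_ex = someI_ex[OF this]
  \<comment> \<open>Only the values for \<open>j < i\<close> matter; the bracket extends them by
    antisymmetry.\<close>
  define C where "C i j = (SOME c. c \<in> carrier ?B \<and> \<mu> c = bracket L (\<mu> (?u i)) (\<mu> (?u j)))" for i j
  have C: "C i j \<in> carrier ?B" "\<mu> (C i j) = bracket L (\<mu> (?u i)) (\<mu> (?u j))" if "j < i" "i < ?n" for i j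
    using C_ex[OF that] unfolding C_def by (rule conjunct1, rule conjunct2)
  let ?b = "structure_bracket ?S ?n C"
  let ?B' = "?B\<lparr>bracket := ?b\<rparr>"
  interpret B': alternating_bracket ?S ?B'
    by (rule structure_bracket_alternating[OF S_cring C(1)])
  have bc: "?b x y \<in> carrier ?B" if "x \<in> carrier ?B" "y \<in> carrier ?B" for x y
    using B'.bracket_closed[of x y] that by simp
  have units: "\<mu> (?b x y) = bracket L (\<mu> x) (\<mu> y)" if xy: "x \<in> ?U" "y \<in> ?U" for x y
  proof -
    obtain i j where ij: "i < ?n" "j < ?n" "x = ?u i" "y = ?u j" using xy by blast
    have x: "x \<in> carrier ?B" and y: "y \<in> carrier ?B" using xy Usub by blast+
    note mx = \<mu>D(1)[OF x] and my = \<mu>D(1)[OF y]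
    have \<mu>_minus: "\<mu> (\<ominus>\<^bsub>?B\<^esub> v) = \<ominus>\<^bsub>L\<^esub> \<mu> v" if "v \<in> carrier ?B" for v
      using linear_map_zero_minus(2)[OF B.module_axioms L'.module_axioms \<mu> that] by simp
    have \<mu>_zero: "\<mu> \<zero>\<^bsub>?B\<^esub> = \<zero>\<^bsub>L\<^esub>"
      using linear_map_zero_minus(1)[OF B.module_axioms L'.module_axioms \<mu>] by simp
    consider "j < i" | "i = j" | "i < j" by linarith
    then show ?thesis
    proof cases
      case 1
      then show ?thesis
        using structure_bracket_unit_vectors[OF S_cring C(1) 1 ij(1)] C(2)[OF 1 ij(1)] ij by simp
    next
      case 2
      have "?b x x = \<zero>\<^bsub>?B\<^esub>" using B'.bracket_alternating[of x] x by simp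
      then show ?thesis
        using 2 ij mx \<mu>_zero L.bracket_alternating[of "\<mu> x"] by simp
    next
      case 3
      have "?b x y = \<ominus>\<^bsub>?B\<^esub> ?b y x" using B'.bracket_swap[of y x] x y by simp
      also have "?b y x = C j i"
        using structure_bracket_unit_vectors[OF S_cring C(1) 3 ij(2)] ij by simp
      finally have "\<mu> (?b x y) = \<ominus>\<^bsub>L\<^esub> bracket L (\<mu> y) (\<mu> x)"
        using \<mu>_minus[OF C(1)[OF 3 ij(2)]] C(2)[OF 3 ij(2)] ij by simp
      also have "\<dots> = bracket L (\<mu> x) (\<mu> y)"
        using L.bracket_swap[of "\<mu> y" "\<mu> x"] mx my by simp
      finally show ?thesis .
    qed
  qed
  have lin: "linear_map ?S ?B ?L (\<lambda>x. \<mu> (?b x y))" "linear_map ?S ?B ?L (\<lambda>x. bracket L (\<mu> x) (\<mu> y))"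
    "linear_map ?S ?B ?L (\<lambda>x. \<mu> (?b y x))" "linear_map ?S ?B ?L (\<lambda>x. bracket L (\<mu> y) (\<mu> x))"
    if y: "y \<in> carrier ?B" for y
  proof -
    have my: "\<mu> y \<in> carrier ?L" by (rule \<mu>D(1)[OF y])
    note b = B'.bracket_add_left[simplified] B'.bracket_add_right[simplified]
      B'.bracket_smult_left[simplified] B'.bracket_smult_right[simplified]
    note l = L'.bracket_add_left[simplified] L'.bracket_add_right[simplified]
      L'.bracket_smult_left[simplified] L'.bracket_smult_right[simplified]
    note d = \<mu>D(1)[simplified] \<mu>D(2)[simplified] \<mu>D(3)[simplified] bc[simplified]
    show "linear_map ?S ?B ?L (\<lambda>x. \<mu> (?b x y))" "linear_map ?S ?B ?L (\<lambda>x. bracket L (\<mu> x) (\<mu> y))"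
      "linear_map ?S ?B ?L (\<lambda>x. \<mu> (?b y x))" "linear_map ?S ?B ?L (\<lambda>x. bracket L (\<mu> y) (\<mu> x))"
      using y my by (intro linear_mapI; simp add: b l d)+
  qed
  have hom: "\<mu> (?b x y) = bracket L (\<mu> x) (\<mu> y)" if x: "x \<in> carrier ?B" and y: "y \<in> carrier ?B" for x y
  \<comment> \<open>The bases are used twice: the outer comparison reduces the first argument to a
    unit vector, the inner one the second.\<close>
  proof (rule linear_map_eq_on_basis[OF B.module_axioms L'.module_axioms basis(2) lin(1,2)[OF y] _ x])
    fix e assume e: "e \<in> ?U"
    show "\<mu> (?b e y) = bracket L (\<mu> e) (\<mu> y)"
      by (rule linear_map_eq_on_basis[OF B.module_axioms L'.module_axioms basis(2)
          lin(3,4)[OF Usub[OF e]] units[OF e] y])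
  qed
  have "free_of_rank ?S ?B' ?n" "free_of_rank (S k) L ?n"
    unfolding free_of_rank_iff using basis(2) Ucard E by auto
  moreover have "\<mu> (T (k + 1) r \<odot>\<^bsub>?B\<^esub> x) = T k r \<odot>\<^bsub>L\<^esub> \<mu> x" if "r \<in> carrier R" "x \<in> carrier ?B" for r x
    using \<mu>D(3)[OF T_closed[OF that(1)] that(2)] that(1) by (simp del: One_nat_def)
  ultimately have "bracket_algebra_lift R \<pi> k L ?B' \<mu>"
    unfolding bracket_algebra_lift_def bracket_algebra_iff
    using B'.alternating_bracket_axioms surj \<mu>D(2) hom
    by (intro conjI) (auto simp del: One_nat_def coords_simps)
  then show ?thesis by (rule that)
qed

section \<open>The obstruction class\<close>

lemma algebra_liftI:
  assumes "discrete_valuation_ring R" "uniformizer R \<pi>" "1 \<le> k" "lie_algebra (trunc_ring R \<pi> k) L"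
    and "bracket_algebra_lift R \<pi> k L B \<mu>"
  shows "algebra_lift R \<pi> k L B \<mu>"
  using assms
  by (intro algebra_lift.intro truncated_algebra.intro truncations.intro
      truncated_algebra_axioms.intro algebra_lift_axioms.intro)
    (simp_all add: lie_algebra_def bracket_algebra_iff)

lemma (in truncated_algebra) cohomology_res:
  "cocycles R (res 1 Lb) s = cocycles (residue_field R \<pi>) Lb s"
  "coboundaries R (res 1 Lb) s = coboundaries (residue_field R \<pi>) Lb s"
  "cohomology_class R (res 1 Lb) s J = cohomology_class (residue_field R \<pi>) Lb s J"
  using cohomology_restrict_scalars[of "S 1" "T 1" R Lb] S_carrier[of 1]
  by (simp_all add: residue_field_eq del: One_nat_def)

context algebra_lift
begin

lemma J_form_cocycle: "J_form R \<pi> k L B \<mu> \<in> obstruction_cocycles R \<pi> k L"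
  using C.obstruction_cocycle by (simp only: J_form_eq cohomology_res)

lemma J_form_PiE: "J_form R \<pi> k L B \<mu> \<in> tuples (res 1 Lb) 3 \<rightarrow>\<^sub>E carrier (res 1 Lb)"
  using C.obstruction_alt_form unfolding J_form_eq alt_forms_def by blast

lemma J_class_eq: "J_class R \<pi> k L B \<mu> = cohomology_class R (res 1 Lb) 3 (J_form R \<pi> k L B \<mu>)"
  by (simp only: cohomology_res)

lemma J_class_zero:
  assumes "lie_algebra (S (k + 1)) B"
  shows "J_class R \<pi> k L B \<mu> = \<zero>\<^bsub>obstruction_cohomology R \<pi> k L\<^esub>"
proof -
  have "J_form R \<pi> k L B \<mu> = \<zero>\<^bsub>form_space R (res 1 Lb) 3\<^esub>"
    using assms by (simp only: lie_algebra_iff)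
  then have "J_class R \<pi> k L B \<mu> = coboundaries R (res 1 Lb) 3"
    unfolding J_class_eq by (simp only: C.V.cohomology_class_zero)
  then show ?thesis by (simp add: cohomology_def cohomology_res del: One_nat_def)
qed

text \<open>Values of \<open>\<iota>\<close> are multiples of \<open>\<pi>\<^sup>k\<close>, which is
  0 on \<open>L\<close>. The corrected bracket therefore still lies over the bracket of
  \<open>L\<close>.\<close>

lemma mu_iota:
  assumes "v \<in> carrier (res 1 Lb)"
  shows "\<mu> (C.\<iota> v) = \<zero>\<^bsub>L\<^esub>"
proof -
  obtain x where x: "x \<in> carrier (res (k + 1) B)" "v = red x" using assms by (rule C.obtain_lift)
  then have "C.\<iota> v = T (k + 1) (\<pi> [^]\<^bsub>R\<^esub> k) \<odot>\<^bsub>B\<^esub> x" using C.iota_red[of x] by (simp del: One_nat_def)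
  then show ?thesis using x mu_smult[of "\<pi> [^]\<^bsub>R\<^esub> k" x] by simp
qed

text \<open>A vanishing class makes \<open>J\<close> the differential of some \<open>\<eta>\<close>,
  and the corrected bracket is then a Lie bracket. The new lift has the carrier, the type and the
  map \<open>\<mu>\<close> of the old one.\<close>

lemma lie_lift_of_J_class_zero:
  assumes J0: "J_class R \<pi> k L B \<mu> = \<zero>\<^bsub>obstruction_cohomology R \<pi> k L\<^esub>"
  obtains B' :: "('r set, 'b) bracket_module" where "lie_algebra_lift R \<pi> k L B' \<mu>"
proof -
  let ?V = "res 1 Lb"
  have "J_form R \<pi> k L B \<mu> \<in> cohomology_class R ?V 3 (J_form R \<pi> k L B \<mu>)"
    by (rule C.V.mem_cohomology_class[OF J_form_PiE])
  also have "\<dots> = coboundaries R ?V 3"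
    using J0 unfolding J_class_eq by (simp add: cohomology_def cohomology_res del: One_nat_def)
  finally obtain \<eta> where \<eta>: "\<eta> \<in> alt_forms R ?V 2" and J: "C.obstruction = differential ?V 2 \<eta>"
    unfolding coboundaries_3 J_form_eq by blast
  \<comment> \<open>\<open>C.corrected\<close> belongs to the module over \<open>R\<close>. The same
    bracket is put on \<open>B\<close> itself, to have a module over the truncation;
    \<open>res\<close> relates the two.\<close>
  define B' where "B' = B\<lparr>bracket := \<lambda>x y. bracket B x y \<oplus>\<^bsub>B\<^esub> C.\<iota> (\<eta> [red x, red y])\<rparr>"
  have res: "res (k + 1) B' = C.corrected \<eta>"
    unfolding B'_def C.corrected_def by (simp add: restrict_scalars_def)
  interpret D: pre_lift R "C.corrected \<eta>" ?V red \<pi> "\<pi> [^]\<^bsub>R\<^esub> k"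
    by (rule C.corrected_pre_lift[OF \<eta>])
  have "module (S (k + 1)) B'" unfolding B'_def bracket_update_simps by (rule B.module_axioms)
  then have alt: "alternating_bracket (S (k + 1)) B'"
    using D.B.alternating_bracket_axioms S_carrier unfolding res[symmetric]
    by (rule alternating_bracket_of_restrict_scalars)
  have B': "carrier B' = carrier B" "ring.add B' = ring.add B" "smult B' = smult B" "ring.zero B' = ring.zero B"
    "free_of_rank (S (k + 1)) B' = free_of_rank (S (k + 1)) B"
    "\<And>x y. bracket B' x y = bracket B x y \<oplus>\<^bsub>B\<^esub> C.\<iota> (\<eta> [red x, red y])"
    by (simp_all add: B'_def fun_eq_iff free_of_rank_iff del: One_nat_def)
  have \<eta>c: "\<eta> [red x, red y] \<in> carrier ?V" if "x \<in> carrier B" "y \<in> carrier B" for x y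
    using alt_forms_2D(2)[OF \<eta>] C.red_closed that by (simp del: One_nat_def)
  have "\<mu> (bracket B' x y) = bracket L (\<mu> x) (\<mu> y)" if xy: "x \<in> carrier B" "y \<in> carrier B" for x y
  proof -
    have "C.\<iota> (\<eta> [red x, red y]) \<in> carrier B"
      using C.iota_closed[OF \<eta>c[OF xy]] by (simp only: restrict_scalars_simps)
    then show ?thesis
      using xy by (simp add: B' mu_add mu_bracket mu_iota[OF \<eta>c[OF xy]] del: One_nat_def)
  qed
  then have lift': "bracket_algebra_lift R \<pi> k L B' \<mu>"
    using lift alt unfolding bracket_algebra_lift_def bracket_algebra_iff
    by (simp add: B'(1-5) del: One_nat_def)
  have "jacobiator B' x y z = \<zero>\<^bsub>B'\<^esub>" if "x \<in> carrier B'" "y \<in> carrier B'" "z \<in> carrier B'" for x y z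
    using C.corrected_jacobiator[OF \<eta> J, of x y z] that unfolding res[symmetric]
    by (simp add: B' del: One_nat_def)
  then have "lie_algebra (S (k + 1)) B'"
    using lift' by (intro lie_algebra.intro lie_algebra_axioms.intro)
      (simp_all add: bracket_algebra_lift_def)
  with lift' have "lie_algebra_lift R \<pi> k L B' \<mu>" by (simp add: lie_algebra_lift_def)
  then show ?thesis by (rule that)
qed

lemma mu_linear_lower: "linear_map (S (k + 1)) B (restrict_scalars (lower k) L) \<mu>"
proof (rule linear_mapI)
  fix a x assume "a \<in> carrier (S (k + 1))" and x: "x \<in> carrier B"
  then obtain r where "r \<in> carrier R" "a = T (k + 1) r" unfolding S_carrier by blast
  then show "\<mu> (a \<odot>\<^bsub>B\<^esub> x) = a \<odot>\<^bsub>restrict_scalars (lower k) L\<^esub> \<mu> x"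
    using x by (simp add: mu_smult del: One_nat_def)
qed (simp_all add: mu_add)

end

text \<open>The two lifts may live on different types, so a class computed from the coordinate lift
  also governs lifts on an arbitrary type. A map over \<open>L\<close> is obtained by sending each
  vector of a basis of \<open>B\<close> to some element of \<open>B'\<close> with the same image in
  \<open>L\<close>.\<close>

lemma J_class_unique:
  assumes L: "algebra_lift R \<pi> k L B \<mu>" and L': "algebra_lift R \<pi> k L B' \<mu>'"
  shows "J_class R \<pi> k L B' \<mu>' = J_class R \<pi> k L B \<mu>"
proof -
  interpret L: algebra_lift R \<pi> k L B \<mu> by (rule L)
  interpret L': algebra_lift R \<pi> k L B' \<mu>' by (rule L')
  let ?S = "trunc_ring R \<pi> (k + 1)" and ?L = "restrict_scalars (L.lower k) L"
  interpret M: alternating_bracket ?S ?L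
    by (rule alternating_bracket_restrict_scalars[OF L.L.alternating_bracket_axioms L.S_cring L.lower_hom])
  obtain E F where F: "basis ?S B F" using L.obtain_bases by metis
  then have Fc: "\<And>f. f \<in> F \<Longrightarrow> f \<in> carrier B" by (auto simp: basis_def)
  have "\<forall>f \<in> F. \<exists>b. b \<in> carrier B' \<and> \<mu>' b = \<mu> f"
  proof
    fix f assume "f \<in> F"
    then have "\<mu> f \<in> \<mu>' ` carrier B'" unfolding L'.mu_surj by (intro L.mu_closed Fc)
    then show "\<exists>b. b \<in> carrier B' \<and> \<mu>' b = \<mu> f" by (metis imageE)
  qed
  then obtain g where g: "\<forall>f \<in> F. g f \<in> carrier B' \<and> \<mu>' (g f) = \<mu> f" by (rule bchoice[THEN exE])
  then have "g \<in> F \<rightarrow> carrier B'" by blast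
  then obtain \<phi> where \<phi>: "linear_map ?S B B' \<phi>" and \<phi>_basis: "\<And>f. f \<in> F \<Longrightarrow> \<phi> f = g f"
    using basis_linear_extension[OF L.B.module_axioms L'.B.module_axioms F] by blast
  have \<phi>c: "\<phi> x \<in> carrier B'" if "x \<in> carrier B" for x by (rule linear_mapD(1)[OF \<phi> that])
  have "linear_map ?S B ?L (\<lambda>x. \<mu>' (\<phi> x))"
    using linear_mapD[OF \<phi>] linear_mapD[OF L'.mu_linear_lower] by (intro linear_mapI) simp_all
  then have mu_phi: "\<mu>' (\<phi> x) = \<mu> x" if "x \<in> carrier B" for x
    by (rule linear_map_eq_on_basis[OF L.B.module_axioms M.module_axioms F _ L.mu_linear_lower _ that])
      (use g in \<open>simp add: \<phi>_basis\<close>)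
  have small: "\<exists>w \<in> carrier (L.res (k + 1) B').
      \<phi> (bracket (L.res (k + 1) B) x y) \<ominus>\<^bsub>L.res (k + 1) B'\<^esub> bracket (L.res (k + 1) B') (\<phi> x) (\<phi> y)
        = \<pi> [^]\<^bsub>R\<^esub> k \<odot>\<^bsub>L.res (k + 1) B'\<^esub> w"
    if xy: "x \<in> carrier (L.res (k + 1) B)" "y \<in> carrier (L.res (k + 1) B)" for x y
  proof -
    let ?d = "\<phi> (bracket B x y) \<oplus>\<^bsub>B'\<^esub> \<ominus>\<^bsub>B'\<^esub> bracket B' (\<phi> x) (\<phi> y)"
    have c: "\<phi> (bracket B x y) \<in> carrier B'" "bracket B' (\<phi> x) (\<phi> y) \<in> carrier B'"
      using xy by (simp_all add: \<phi>c)
    have "\<mu>' (\<ominus>\<^bsub>B'\<^esub> bracket B' (\<phi> x) (\<phi> y)) = \<ominus>\<^bsub>L\<^esub> \<mu>' (bracket B' (\<phi> x) (\<phi> y))"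
      using linear_map_zero_minus(2)[OF L'.B.module_axioms M.module_axioms L'.mu_linear_lower c(2)]
      by simp
    \<comment> \<open>Both \<open>\<mu>\<close> and \<open>\<mu>'\<close> preserve brackets, so the
      defect of \<open>\<phi>\<close> dies in \<open>L\<close>; by \<open>mu_kernel\<close> it is a
      multiple of \<open>\<pi>\<^sup>k\<close>.\<close>
    then have "\<mu>' ?d = \<zero>\<^bsub>L\<^esub>"
      using xy c by (simp add: L'.mu_add L'.mu_bracket mu_phi L.mu_bracket \<phi>c L.L.M.r_neg)
    moreover have "?d \<in> carrier B'" using c by simp
    ultimately obtain w where "w \<in> carrier B'" "?d = trunc R \<pi> (k + 1) (\<pi> [^]\<^bsub>R\<^esub> k) \<odot>\<^bsub>B'\<^esub> w"
      using L'.mu_kernel by blast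
    then show ?thesis
      by (intro bexI[of _ w]) (simp_all add: a_minus_def del: One_nat_def)
  qed
  have \<phi>R: "linear_map R (L.res (k + 1) B) (L.res (k + 1) B') \<phi>"
    by (rule linear_map_restrict_scalars[OF \<phi> L.T_hom])
  have red: "L'.red (\<phi> x) = L.red x" if "x \<in> carrier (L.res (k + 1) B)" for x
    using that by (simp add: L.red_def L'.red_def mu_phi)
  obtain \<omega> where \<omega>: "\<omega> \<in> alt_forms R (L.res 1 L.Lb) 2"
    "L'.C.obstruction = L.C.obstruction \<oplus>\<^bsub>form_space R (L.res 1 L.Lb) 3\<^esub> differential (L.res 1 L.Lb) 2 \<omega>"
    using obstruction_compare[OF L.C.infinitesimal_lift_axioms L'.C.infinitesimal_lift_axioms \<phi>R red small]
    by blast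
  have "L.C.obstruction \<in> tuples (L.res 1 L.Lb) 3 \<rightarrow> carrier (L.res 1 L.Lb)"
    using L.J_form_PiE unfolding L.J_form_eq PiE_def by blast
  then show ?thesis
    unfolding L.J_class_eq L'.J_class_eq unfolding L.J_form_eq L'.J_form_eq \<omega>(2)
    by (rule L.C.V.cohomology_class_add_coboundary[OF \<omega>(1)])
qed

lemma J_class_zero_of_lie_lift:
  assumes "discrete_valuation_ring R" "uniformizer R \<pi>" "1 \<le> k" "lie_algebra (trunc_ring R \<pi> k) L"
    and "lie_algebra_lift R \<pi> k L B \<mu>"
  shows "J_class R \<pi> k L B \<mu> = \<zero>\<^bsub>obstruction_cohomology R \<pi> k L\<^esub>"
proof (rule algebra_lift.J_class_zero[OF algebra_liftI[OF assms(1-4)]])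
  show "bracket_algebra_lift R \<pi> k L B \<mu>" "lie_algebra (trunc_ring R \<pi> (k + 1)) B"
    using assms(5) by (simp_all add: lie_algebra_lift_def)
qed

theorem theorem2p1:
  fixes R :: "('r, 'm) ring_scheme" and \<pi> :: 'r and k :: nat
    and L :: "('r set, 'l, 'n) bracket_module_scheme"
  assumes "discrete_valuation_ring R"
    and "uniformizer R \<pi>"
    and "1 \<le> k"
    and "lie_algebra (trunc_ring R \<pi> k) L"
  shows "(\<exists>(B :: ('r set, 'r coord) bracket_module) \<mu>. bracket_algebra_lift R \<pi> k L B \<mu>) \<and>
    (\<exists>J \<in> carrier (obstruction_cohomology R \<pi> k L).
      (\<forall>(B :: ('r set, 'r coord) bracket_module) \<mu>. bracket_algebra_lift R \<pi> k L B \<mu> \<longrightarrow>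
         J_form R \<pi> k L B \<mu> \<in> obstruction_cocycles R \<pi> k L \<and> J_class R \<pi> k L B \<mu> = J) \<and>
      (\<forall>(B :: ('r set, 'b) bracket_module) \<mu>. bracket_algebra_lift R \<pi> k L B \<mu> \<longrightarrow>
         J_form R \<pi> k L B \<mu> \<in> obstruction_cocycles R \<pi> k L \<and> J_class R \<pi> k L B \<mu> = J) \<and>
      (J = \<zero>\<^bsub>obstruction_cohomology R \<pi> k L\<^esub> \<longleftrightarrow>
         (\<exists>(B :: ('r set, 'r coord) bracket_module) \<mu>. lie_algebra_lift R \<pi> k L B \<mu>)) \<and>
      ((\<exists>(B :: ('r set, 'b) bracket_module) \<mu>. lie_algebra_lift R \<pi> k L B \<mu>) \<longrightarrow>
         J = \<zero>\<^bsub>obstruction_cohomology R \<pi> k L\<^esub>))"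
proof -
  note lift = algebra_liftI[OF assms]
  interpret A: truncated_algebra R \<pi> k L
    using assms by (intro truncated_algebra.intro truncations.intro truncated_algebra_axioms.intro)
      (simp_all add: lie_algebra_def bracket_algebra_iff)
  obtain n where "free_of_rank (trunc_ring R \<pi> k) L n"
    using assms(4) by (auto simp: lie_algebra_def bracket_algebra_iff)
  then obtain E where "basis (trunc_ring R \<pi> k) L E" by (auto simp: free_of_rank_iff)
  then obtain B0 :: "('r set, 'r coord) bracket_module" and \<mu>0 where B0: "bracket_algebra_lift R \<pi> k L B0 \<mu>0"
    by (rule A.exists_lift)
  interpret B0: algebra_lift R \<pi> k L B0 \<mu>0 by (rule lift[OF B0])
  \<comment> \<open>The class is fixed by one lift on coordinates, to which all others are
    compared.\<close>
  let ?J = "J_class R \<pi> k L B0 \<mu>0"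
  have J: "?J \<in> carrier (obstruction_cohomology R \<pi> k L)"
    using B0.J_form_cocycle by (simp add: cohomology_def)
  note cocycle = algebra_lift.J_form_cocycle[OF lift]
  note unique = J_class_unique[OF B0.algebra_lift_axioms lift]
  note zero = J_class_zero_of_lie_lift[OF assms]
  show ?thesis
  proof (intro conjI bexI[of _ ?J] J allI impI iffI)
    show "\<exists>(B :: ('r set, 'r coord) bracket_module) \<mu>. bracket_algebra_lift R \<pi> k L B \<mu>"
      using B0 by (intro exI)
  next
    fix B :: "('r set, 'r coord) bracket_module" and \<mu>
    assume "bracket_algebra_lift R \<pi> k L B \<mu>"
    then show "J_form R \<pi> k L B \<mu> \<in> obstruction_cocycles R \<pi> k L" "J_class R \<pi> k L B \<mu> = ?J"
      by (rule cocycle, rule unique)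
  next
    fix B :: "('r set, 'b) bracket_module" and \<mu>
    assume "bracket_algebra_lift R \<pi> k L B \<mu>"
    then show "J_form R \<pi> k L B \<mu> \<in> obstruction_cocycles R \<pi> k L" "J_class R \<pi> k L B \<mu> = ?J"
      by (rule cocycle, rule unique)
  next
    assume J0: "?J = \<zero>\<^bsub>obstruction_cohomology R \<pi> k L\<^esub>"
    \<comment> \<open>Correcting \<open>B0\<close> keeps its type, so the Lie algebra lift is found
      on coordinates as required.\<close>
    obtain B :: "('r set, 'r coord) bracket_module" where "lie_algebra_lift R \<pi> k L B \<mu>0"
      using J0 by (rule B0.lie_lift_of_J_class_zero)
    then show "\<exists>(B :: ('r set, 'r coord) bracket_module) \<mu>. lie_algebra_lift R \<pi> k L B \<mu>"
      by (intro exI)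
  next
    assume "\<exists>(B :: ('r set, 'r coord) bracket_module) \<mu>. lie_algebra_lift R \<pi> k L B \<mu>"
    then obtain B :: "('r set, 'r coord) bracket_module" and \<mu> where B: "lie_algebra_lift R \<pi> k L B \<mu>"
      by (elim exE)
    then have "bracket_algebra_lift R \<pi> k L B \<mu>" by (simp add: lie_algebra_lift_def)
    \<comment> \<open>The form of a Lie algebra lift is zero, and by uniqueness its class is the
      common one.\<close>
    from unique[OF this] zero[OF B] show "?J = \<zero>\<^bsub>obstruction_cohomology R \<pi> k L\<^esub>" by (rule trans[OF sym])
  next
    assume "\<exists>(B :: ('r set, 'b) bracket_module) \<mu>. lie_algebra_lift R \<pi> k L B \<mu>"
    then obtain B :: "('r set, 'b) bracket_module" and \<mu> where B: "lie_algebra_lift R \<pi> k L B \<mu>"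
      by (elim exE)
    then have "bracket_algebra_lift R \<pi> k L B \<mu>" by (simp add: lie_algebra_lift_def)
    from unique[OF this] zero[OF B] show "?J = \<zero>\<^bsub>obstruction_cohomology R \<pi> k L\<^esub>" by (rule trans[OF sym])
  qed
qed

end
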